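(* Let $g>0$, $\mu>0$, let $\bar\rho=\bar\rho(x_3)\in L^\infty(\mathbb{R})$ satisfy $\bar\rho'\in C_0^\infty(\mathbb{R})$, $\inf_{\mathbb{R}}\bar\rho>0$ and $\bar\rho'(x_3^0)>0$ for some $x_3^0$, and let $M$, $\mathcal A$, $\mathbb{A}^{\mathrm g}$ be as in the context. For each $\xi=(\xi_1,\xi_2)\in\mathbb{A}^{\mathrm g}$ there exist $\lambda=\lambda(\xi)>0$ and functions $(\varphi,\theta,\psi,\pi)=(\varphi,\theta,\psi,\pi)(\xi,x_3)$, all belonging to $H^\infty(\mathbb{R})=\bigcap_{k\ge0}H^k(\mathbb{R})$, solving the system $$\begin{cases}\lambda^2\bar\rho\varphi-\lambda\xi_1\pi+\lambda\mu(|\xi|^2\varphi-\varphi'')=M^2B_1,\\ \lambda^2\bar\rho\theta-\lambda\xi_2\pi+\lambda\mu(|\xi|^2\theta-\theta'')=M^2B_2,\\ \lambda^2\bar\rho\psi+\lambda\pi'+\lambda\mu(|\xi|^2\psi-\psi'')-g\bar\rho'\psi=M^2B_3,\\ \xi_1\varphi+\xi_2\theta+\psi'=0\end{cases}$$ on $\mathbb{R}$ with $\varphi(\pm\infty)=\theta(\pm\infty)=\psi(\pm\infty)=0$, where $(B_1,B_2,B_3)=(0,\ \xi_1\xi_2\varphi-\xi_1^2\theta,\ -(\xi_1^2\psi+\xi_1\varphi'))$ in the horizontal case and $(B_1,B_2,B_3)=(\varphi''+\xi_1\psi',\ \theta''+\xi_2\psi',\ 0)$ in the vertical case. Moreover $\psi\in\mathcal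 A$.
   Context: $'=d/dx_3$. $M_{\mathrm c}:=\sqrt{\sup_{\psi\in H^1(\mathbb{R}),\psi\not\equiv0}\int g\bar\rho'\psi^2dx_3/\int|\psi'|^2dx_3}\in(0,\infty]$. Horizontal case ($\bar{\mathbf M}=M\mathbf e_1$): $M\neq0$ constant; for $0<|M\xi_1|/|\xi|<M_{\mathrm c}$, $S(\xi):=\sqrt{\sup_{\psi\in H^1,\psi\not\equiv0}(g|\xi|^2\int\bar\rho'\psi^2/(M\xi_1)^2-\int|\psi'|^2)/\int|\psi|^2}$; $\mathbb{A}^{\mathrm g}:=(\{\xi:|\xi_1M|/|\xi|\in(0,M_{\mathrm c}),|\xi|<S(\xi)\}\cup\{\xi_1=0\})\setminus\{\mathbf 0\}$. Vertical case ($\bar{\mathbf M}=M\mathbf e_3$): $M$ constant with $|M|\in(0,M_{\mathrm c})$; $\mathcal M_{\mathrm{vc}}:=\{\psi\in H^2:\int(g\bar\rho'\psi^2-M^2|\psi'|^2)>0\}$; $|\xi|^M_{\mathrm{vc}}:=\sqrt{\inf_{\psi\in\mathcal M_{\mathrm{vc}}}M^2\int|\psi''|^2/\int(g\bar\rho'\psi^2-M^2|\psi'|^2)}$; $\mathbb{A}^{\mathrm g}:=\{\xi:|\xi|>|\xi|^M_{\mathrm{vc}}\}$. $\mathcal A:=\{\psi\in H^2(\mathbb{R}):\int\bar\rho(|\xi|^2\psi^2+|\psi'|^2)dx_3=1\}$. *)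

theory Defs
  imports "HOL-Analysis.Analysis"
begin

definition C_inf :: "(real \<Rightarrow> real) \<Rightarrow> bool" where
  "C_inf f \<longleftrightarrow> (\<forall>k x. ((deriv ^^ k) f) differentiable (at x))"

definition test_fun :: "(real \<Rightarrow> real) \<Rightarrow> bool" where
  "test_fun \<phi> \<longleftrightarrow> C_inf \<phi> \<and> compact (closure {x. \<phi> x \<noteq> 0})"

definition L2 :: "(real \<Rightarrow> real) \<Rightarrow> bool" where
  "L2 f \<longleftrightarrow> f \<in> borel_measurable lborel \<and> integrable lborel (\<lambda>x. (f x)\<^sup>2)"

definition weak_deriv :: "(real \<Rightarrow> real) \<Rightarrow> (real \<Rightarrow> real) \<Rightarrow> bool" where
  "weak_deriv f g \<longleftrightarrow> (\<forall>\<phi>. test_fun \<phi> \<longrightarrow>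
      (LINT x|lborel. f x * deriv \<phi> x) = - (LINT x|lborel. g x * \<phi> x))"

definition Hk :: "nat \<Rightarrow> (real \<Rightarrow> real) \<Rightarrow> bool" where
  "Hk k f \<longleftrightarrow> (\<exists>D :: nat \<Rightarrow> real \<Rightarrow> real. D 0 = f \<and> (\<forall>j\<le>k. L2 (D j))
       \<and> (\<forall>j<k. weak_deriv (D j) (D (Suc j))))"

definition Hinf :: "(real \<Rightarrow> real) \<Rightarrow> bool" where
  "Hinf f \<longleftrightarrow> (\<forall>k. Hk k f)"

text \<open>the (a.e. unique) L2 weak derivative\<close>
definition wderiv :: "(real \<Rightarrow> real) \<Rightarrow> real \<Rightarrow> real" where
  "wderiv f = (SOME g. L2 g \<and> weak_deriv f g)"

definition nonzero_L2 :: "(real \<Rightarrow> real) \<Rightarrow> bool" where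
  "nonzero_L2 \<psi> \<longleftrightarrow> \<not> (AE x in lborel. \<psi> x = 0)"

definition Mc_sq :: "real \<Rightarrow> (real \<Rightarrow> real) \<Rightarrow> ereal" where
  "Mc_sq g rho = (SUP \<psi> \<in> {\<psi>. Hk 1 \<psi> \<and> nonzero_L2 \<psi>}.
      ereal ((LINT x|lborel. g * deriv rho x * (\<psi> x)\<^sup>2) / (LINT x|lborel. (wderiv \<psi> x)\<^sup>2)))"

definition Mc :: "real \<Rightarrow> (real \<Rightarrow> real) \<Rightarrow> ereal" where
  "Mc g rho = (if Mc_sq g rho = \<infinity> then \<infinity> else ereal (sqrt (real_of_ereal (Mc_sq g rho))))"

definition S_hor :: "real \<Rightarrow> (real \<Rightarrow> real) \<Rightarrow> real \<Rightarrow> real \<times> real \<Rightarrow> real" where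
  "S_hor g rho M \<xi> = sqrt (Sup {((g * (norm \<xi>)\<^sup>2 * (LINT x|lborel. deriv rho x * (\<psi> x)\<^sup>2)) / (M * fst \<xi>)\<^sup>2
        - (LINT x|lborel. (wderiv \<psi> x)\<^sup>2)) / (LINT x|lborel. (\<psi> x)\<^sup>2)
      | \<psi>. Hk 1 \<psi> \<and> nonzero_L2 \<psi>})"

definition Ag_hor :: "real \<Rightarrow> (real \<Rightarrow> real) \<Rightarrow> real \<Rightarrow> (real \<times> real) set" where
  "Ag_hor g rho M = ({\<xi>. 0 < \<bar>fst \<xi> * M\<bar> / norm \<xi> \<and> ereal (\<bar>fst \<xi> * M\<bar> / norm \<xi>) < Mc g rho
        \<and> norm \<xi> < S_hor g rho M \<xi>} \<union> {\<xi>. fst \<xi> = 0}) - {(0, 0)}"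

definition vc_quot :: "real \<Rightarrow> (real \<Rightarrow> real) \<Rightarrow> real \<Rightarrow> (real \<Rightarrow> real) \<Rightarrow> real" where
  "vc_quot g rho M \<psi> = (LINT x|lborel. g * deriv rho x * (\<psi> x)\<^sup>2 - M\<^sup>2 * (wderiv \<psi> x)\<^sup>2)"

definition M_vc :: "real \<Rightarrow> (real \<Rightarrow> real) \<Rightarrow> real \<Rightarrow> (real \<Rightarrow> real) set" where
  "M_vc g rho M = {\<psi>. Hk 2 \<psi> \<and> vc_quot g rho M \<psi> > 0}"

definition xi_vc :: "real \<Rightarrow> (real \<Rightarrow> real) \<Rightarrow> real \<Rightarrow> real" where
  "xi_vc g rho M = sqrt (Inf ((\<lambda>\<psi>. M\<^sup>2 * (LINT x|lborel. (wderiv (wderiv \<psi>) x)\<^sup>2) / vc_quot g rho M \<psi>)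
      ` M_vc g rho M))"

definition Ag_ver :: "real \<Rightarrow> (real \<Rightarrow> real) \<Rightarrow> real \<Rightarrow> (real \<times> real) set" where
  "Ag_ver g rho M = {\<xi>. norm \<xi> > xi_vc g rho M}"

datatype field_dir = Horizontal | Vertical

definition admissible_M :: "field_dir \<Rightarrow> real \<Rightarrow> (real \<Rightarrow> real) \<Rightarrow> real \<Rightarrow> bool" where
  "admissible_M d g rho M = (case d of
      Horizontal \<Rightarrow> M \<noteq> 0
    | Vertical \<Rightarrow> 0 < \<bar>M\<bar> \<and> ereal \<bar>M\<bar> < Mc g rho)"

definition Ag :: "field_dir \<Rightarrow> real \<Rightarrow> (real \<Rightarrow> real) \<Rightarrow> real \<Rightarrow> (real \<times> real) set" where
  "Ag d g rho M = (case d of Horizontal \<Rightarrow> Ag_hor g rho M | Vertical \<Rightarrow> Ag_ver g rho M)"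

definition calA :: "(real \<Rightarrow> real) \<Rightarrow> real \<times> real \<Rightarrow> (real \<Rightarrow> real) set" where
  "calA rho \<xi> = {\<psi>. Hk 2 \<psi> \<and>
      (LINT x|lborel. rho x * ((norm \<xi>)\<^sup>2 * (\<psi> x)\<^sup>2 + (wderiv \<psi> x)\<^sup>2)) = 1}"

text \<open>Right-hand sides (B1,B2,B3) at x_3 = x, for smooth \<phi>, \<theta>, \<psi>\<close>
definition B1 :: "field_dir \<Rightarrow> real \<times> real \<Rightarrow> (real \<Rightarrow> real) \<Rightarrow> (real \<Rightarrow> real) \<Rightarrow> (real \<Rightarrow> real) \<Rightarrow> real \<Rightarrow> real" where
  "B1 d \<xi> \<phi> \<theta> \<psi> x = (case d of Horizontal \<Rightarrow> 0
     | Vertical \<Rightarrow> deriv (deriv \<phi>) x + fst \<xi> * deriv \<psi> x)"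

definition B2 :: "field_dir \<Rightarrow> real \<times> real \<Rightarrow> (real \<Rightarrow> real) \<Rightarrow> (real \<Rightarrow> real) \<Rightarrow> (real \<Rightarrow> real) \<Rightarrow> real \<Rightarrow> real" where
  "B2 d \<xi> \<phi> \<theta> \<psi> x = (case d of Horizontal \<Rightarrow> fst \<xi> * snd \<xi> * \<phi> x - (fst \<xi>)\<^sup>2 * \<theta> x
     | Vertical \<Rightarrow> deriv (deriv \<theta>) x + snd \<xi> * deriv \<psi> x)"

definition B3 :: "field_dir \<Rightarrow> real \<times> real \<Rightarrow> (real \<Rightarrow> real) \<Rightarrow> (real \<Rightarrow> real) \<Rightarrow> (real \<Rightarrow> real) \<Rightarrow> real \<Rightarrow> real" where
  "B3 d \<xi> \<phi> \<theta> \<psi> x = (case d of Horizontal \<Rightarrow> - ((fst \<xi>)\<^sup>2 * \<psi> x + fst \<xi> * deriv \<phi> x)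
     | Vertical \<Rightarrow> 0)"

end

theory Submission
  imports Defs "HOL-Library.Diagonal_Subsequence"
begin

text \<open>Eliminating \<open>\<phi>\<close>, \<open>\<theta>\<close> and \<open>\<pi>\<close> (with \<open>\<phi> = - \<xi>\<^sub>1 \<psi>' / |\<xi>|\<^sup>2\<close> and \<open>\<theta> = - \<xi>\<^sub>2 \<psi>' / |\<xi>|\<^sup>2\<close>) leaves a single
  fourth-order equation for \<open>\<psi>\<close>, in which \<open>\<kappa> = |\<xi>|\<^sup>2\<close>, \<open>w = g \<kappa> \<rho>'\<close> and the constants \<open>a\<close>, \<open>b\<close>, \<open>c\<close> carry
  the magnetic field; it is the Euler--Lagrange equation of
  \<open>\<integral> \<lambda>\<^sup>2 \<rho> (\<kappa> \<psi>\<^sup>2 + \<psi>'\<^sup>2) + \<lambda> \<mu> (\<kappa>\<^sup>2 \<psi>\<^sup>2 + 2 \<kappa> \<psi>'\<^sup>2 + \<psi>''\<^sup>2) + a \<psi>''\<^sup>2 + b \<psi>'\<^sup>2 + c \<psi>\<^sup>2 - w \<psi>\<^sup>2\<close>.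
  Membership of \<open>\<xi>\<close> in the growth set implies that this energy is negative at \<open>\<lambda> = 0\<close> for some trial
  function. It is nonnegative for large \<open>\<lambda>\<close>, so there is a largest \<open>\<lambda> > 0\<close> up to which it can be negative.
  At that \<open>\<lambda>\<close> near-minimizers, normalized by \<open>\<integral> w \<psi>\<^sup>2 = 1\<close>, have a pointwise convergent subsequence
  (\<open>w\<close> has compact support, so the normalization survives), and by the Cauchy--Schwarz inequality for the
  nonnegative energy the limit is a weak solution. The du Bois-Reymond lemma makes it smooth, and
  Fatou's lemma for difference quotients puts its derivatives in \<open>L\<^sup>2\<close>.\<close>

section \<open>Smooth functions and test functions\<close>

text \<open>The growth rate enters the energy linearly (viscosity) and quadratically (inertia), so
  it is not an eigenvalue of one fixed quadratic form; this is why it is sought as a threshold in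
  \<lambda>. The obstacle is the unbounded line: mass of a minimizing sequence may escape to
  infinity, so a constraint such as the one in \<open>calA\<close> need not survive a limit. The
  limit is therefore taken under a constraint that sees only the buoyancy term, and
  \<open>calA\<close> is reached afterwards by rescaling, since the equation is linear. Control of
  second derivatives comes from viscosity: at \<lambda> > 0 the coefficient \<lambda> \<mu> + a of
  \<psi>''^2 is positive, even for a horizontal field, where a = 0. Taking (\<phi>, \<theta>)
  parallel to \<xi> turns both horizontal momentum equations into multiples of one equation, which
  defines \<pi>; incompressibility then fixes the factor. All quadratic terms carry an extra factor
  \<kappa>, which clears denominators: \<kappa> (\<phi>^2 + \<theta>^2 + \<psi>^2) = \<kappa>
  \<psi>^2 + \<psi>'^2.\<close>

primrec smooth_upto :: "((real \<Rightarrow> real) \<Rightarrow> bool) \<Rightarrow> nat \<Rightarrow> (real \<Rightarrow> real) \<Rightarrow> bool" where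
  "smooth_upto Q 0 f \<longleftrightarrow> True"
| "smooth_upto Q (Suc k) f \<longleftrightarrow> (\<forall>x. f differentiable (at x)) \<and> Q f \<and> smooth_upto Q k (deriv f)"

lemma deriv_eqI: "(\<And>x. (f has_real_derivative f' x) (at x)) \<Longrightarrow> deriv f = f'" for f :: "real \<Rightarrow> real"
  by (auto simp: fun_eq_iff intro: DERIV_imp_deriv)

lemma differentiable_DERIV_deriv:
  "f differentiable (at x) \<Longrightarrow> (f has_real_derivative deriv f x) (at x)" for f :: "real \<Rightarrow> real"
  using DERIV_deriv_iff_real_differentiable by blast

lemma smooth_upto_SucI:
  assumes "\<And>x. (f has_real_derivative f' x) (at x)" "Q f" "smooth_upto Q k f'"
  shows "smooth_upto Q (Suc k) f"
  using assms deriv_eqI[OF assms(1)] by (auto simp: real_differentiable_def)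

lemma smooth_upto_Suc_imp: "smooth_upto Q (Suc k) f \<Longrightarrow> smooth_upto Q k f"
  by (induction k arbitrary: f) auto

lemma smooth_upto_mono:
  "smooth_upto Q k f \<Longrightarrow> (\<And>f. Q f \<Longrightarrow> Q' f) \<Longrightarrow> smooth_upto Q' k f"
  by (induction k arbitrary: f) auto

lemma smooth_upto_iff:
  "(\<forall>k. smooth_upto Q k f) \<longleftrightarrow>
     (\<forall>n. Q ((deriv ^^ n) f) \<and> (\<forall>x. ((deriv ^^ n) f) differentiable (at x)))" (is "?L \<longleftrightarrow> ?R")
proof
  assume L: ?L
  have "\<forall>k. smooth_upto Q k ((deriv ^^ n) f)" for n
  proof (induction n)
    case (Suc n)
    then have "smooth_upto Q (Suc k) ((deriv ^^ n) f)" for k by blast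
    then show ?case by simp
  qed (use L in simp)
  then have "smooth_upto Q (Suc 0) ((deriv ^^ n) f)" for n by blast
  then show ?R by simp
next
  assume R: ?R
  have "smooth_upto Q k ((deriv ^^ n) f)" for k n
  proof (induction k arbitrary: n)
    case (Suc k)
    from Suc[of "Suc n"] R show ?case by simp
  qed simp
  from this[of _ 0] show ?L by simp
qed

lemma C_inf_iff_smooth_upto: "C_inf f \<longleftrightarrow> (\<forall>k. smooth_upto (\<lambda>_. True) k f)"
  unfolding smooth_upto_iff C_inf_def by simp

lemma C_inf_deriv:
  assumes "C_inf f" shows "C_inf (deriv f)"
proof -
  have "smooth_upto (\<lambda>_. True) (Suc k) f" for k
    using assms unfolding C_inf_iff_smooth_upto by blast
  then show ?thesis unfolding C_inf_iff_smooth_upto by simp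
qed

lemma C_inf_differentiable:
  assumes "C_inf f" shows "f differentiable (at x)"
proof -
  have "smooth_upto (\<lambda>_. True) (Suc 0) f"
    using assms unfolding C_inf_iff_smooth_upto by blast
  then show ?thesis by simp
qed

lemma C_inf_DERIV: "C_inf f \<Longrightarrow> (f has_real_derivative deriv f x) (at x)"
  by (simp add: C_inf_differentiable differentiable_DERIV_deriv)

lemma C_inf_isCont: "C_inf f \<Longrightarrow> isCont f x"
  by (rule DERIV_isCont[OF C_inf_DERIV])

lemma C_inf_continuous_on: "C_inf f \<Longrightarrow> continuous_on S f"
  by (simp add: C_inf_isCont continuous_at_imp_continuous_on)

lemma C_infI_DERIV:
  assumes "\<And>x. (f has_real_derivative f' x) (at x)" "C_inf f'"
  shows "C_inf f"
  unfolding C_inf_iff_smooth_upto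
proof
  fix k show "smooth_upto (\<lambda>_. True) k f"
  proof (cases k)
    case (Suc n)
    have "smooth_upto (\<lambda>_. True) n f'"
      using assms(2) unfolding C_inf_iff_smooth_upto by blast
    then show ?thesis
      unfolding Suc by (intro smooth_upto_SucI[where f' = f'] assms(1)) auto
  qed simp
qed

lemma smooth_upto_add:
  assumes "\<And>f g. Q f \<Longrightarrow> Q g \<Longrightarrow> Q (\<lambda>x. f x + g x)"
  shows "smooth_upto Q k f \<Longrightarrow> smooth_upto Q k g \<Longrightarrow> smooth_upto Q k (\<lambda>x. f x + g x)"
proof (induction k arbitrary: f g)
  case (Suc k)
  show ?case
  proof (rule smooth_upto_SucI)
    show "((\<lambda>x. f x + g x) has_real_derivative (deriv f x + deriv g x)) (at x)" for x
      using Suc.prems by (auto intro!: derivative_eq_intros differentiable_DERIV_deriv)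
  qed (use Suc assms in auto)
qed simp

text \<open>Three separate predicates let one Leibniz induction serve three purposes: products of
  smooth functions, the algebra of functions with all derivatives bounded, and bounded times
  \<open>L2\<close>, which lands in \<open>L2\<close>.\<close>

lemma smooth_upto_mult:
  assumes Q: "\<And>f g. Q1 f \<Longrightarrow> Q2 g \<Longrightarrow> Q (\<lambda>x. f x * g x)"
    and add: "\<And>f g. Q f \<Longrightarrow> Q g \<Longrightarrow> Q (\<lambda>x. f x + g x)"
  shows "smooth_upto Q1 k f \<Longrightarrow> smooth_upto Q2 k g \<Longrightarrow> smooth_upto Q k (\<lambda>x. f x * g x)"
proof (induction k arbitrary: f g)
  case (Suc k)
  have f: "smooth_upto Q1 k f" and g: "smooth_upto Q2 k g"
    using Suc.prems smooth_upto_Suc_imp by blast+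
  show ?case
  proof (rule smooth_upto_SucI)
    show "((\<lambda>x. f x * g x) has_real_derivative (deriv f x * g x + f x * deriv g x)) (at x)" for x
      using Suc.prems
      by (auto intro!: derivative_eq_intros differentiable_DERIV_deriv simp: algebra_simps)
    show "smooth_upto Q k (\<lambda>x. deriv f x * g x + f x * deriv g x)"
      using Suc f g by (intro smooth_upto_add[where Q = Q] add) auto
  qed (use Suc Q in auto)
qed simp

lemma smooth_upto_const: "(\<And>c. Q (\<lambda>_. c)) \<Longrightarrow> smooth_upto Q k (\<lambda>_. c)"
proof (induction k arbitrary: c)
  case (Suc k)
  then show ?case by (intro smooth_upto_SucI[where f' = "\<lambda>_. 0"]) auto
qed simp

lemma C_inf_const [simp]: "C_inf (\<lambda>_. c)"
  by (simp add: C_inf_iff_smooth_upto smooth_upto_const)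

lemma C_inf_add: "C_inf f \<Longrightarrow> C_inf g \<Longrightarrow> C_inf (\<lambda>x. f x + g x)"
  by (simp add: C_inf_iff_smooth_upto smooth_upto_add)

lemma C_inf_mult: "C_inf f \<Longrightarrow> C_inf g \<Longrightarrow> C_inf (\<lambda>x. f x * g x)"
  unfolding C_inf_iff_smooth_upto
  by (auto intro: smooth_upto_mult[where ?Q1.0="\<lambda>_. True" and ?Q2.0="\<lambda>_. True"])

lemma C_inf_affine: "C_inf f \<Longrightarrow> C_inf (\<lambda>x. f (a * x + b))"
  unfolding C_inf_iff_smooth_upto
proof
  fix k assume "\<forall>k. smooth_upto (\<lambda>_. True) k f"
  then have "smooth_upto (\<lambda>_. True) k f" by simp
  then show "smooth_upto (\<lambda>_. True) k (\<lambda>x. f (a * x + b))"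
  proof (induction k arbitrary: f)
    case (Suc k)
    have "((\<lambda>x. f (a * x + b)) has_real_derivative (a * deriv f (a * x + b))) (at x)" for x
    proof -
      have "(f has_real_derivative deriv f (a * x + b)) (at (a * x + b))"
        using Suc.prems by (auto intro!: differentiable_DERIV_deriv)
      have "((\<lambda>x. f (a * x + b)) has_real_derivative deriv f (a * x + b) * a) (at x)"
        by (rule DERIV_chain2[where f = f], fact) (auto intro!: derivative_eq_intros)
      then show ?thesis by (simp add: mult.commute)
    qed
    moreover have "smooth_upto (\<lambda>_. True) k (\<lambda>x. a * deriv f (a * x + b))"
      using Suc by (intro smooth_upto_mult[where ?Q1.0="\<lambda>_. True" and ?Q2.0="\<lambda>_. True"] smooth_upto_const) auto
    ultimately show ?case by (intro smooth_upto_SucI) auto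
  qed simp
qed

section \<open>A smooth function that is flat at the origin\<close>

definition flat_exp :: "real poly \<Rightarrow> real \<Rightarrow> real" where
  "flat_exp p x = (if x \<le> 0 then 0 else poly p (1 / x) * exp (- (1 / x)))"

lemma poly_exp_minus_tendsto_0: "((\<lambda>t. poly p t * exp (- t)) \<longlongrightarrow> 0) at_top" for p :: "real poly"
proof -
  have "((\<lambda>t. \<Sum>i\<le>degree p. coeff p i * (t ^ i / exp t)) \<longlongrightarrow> (\<Sum>i\<le>degree p. coeff p i * 0)) at_top"
    by (intro tendsto_intros tendsto_power_div_exp_0)
  then show ?thesis
    by (simp add: poly_altdef sum_distrib_right exp_minus divide_inverse mult.assoc)
qed

text \<open>With t = 1/x, the derivative of p(t) exp(-t) in x is t^2 (p(t) - p'(t)) exp(-t). The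
  arbitrary polynomial factor thus makes the family closed under differentiation, and smoothness
  follows by induction.\<close>

lemma flat_exp_DERIV:
  "(flat_exp p has_real_derivative flat_exp ([:0, 0, 1:] * (p - pderiv p)) x) (at x)"
proof (cases x "0 :: real" rule: linorder_cases)
  case less
  have "((\<lambda>_. 0) has_real_derivative 0) (at x)" by simp
  moreover have "\<forall>\<^sub>F y in nhds x. (\<lambda>_. 0) y = flat_exp p y"
    using eventually_nhds_in_open[of "{..<0}" x] less
    by (auto simp: flat_exp_def elim!: eventually_mono)
  ultimately show ?thesis
    using less by (simp add: flat_exp_def DERIV_cong_ev)
next
  case greater
  have "((\<lambda>x. poly p (1 / x) * exp (- (1 / x))) has_real_derivative
      (poly (pderiv p) (1 / x) * (- 1 / x\<^sup>2)) * exp (- (1 / x)) + (exp (- (1 / x)) * (1 / x\<^sup>2)) * poly p (1 / x)) (at x)"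
  proof (rule DERIV_mult)
    have "((\<lambda>x. 1 / x) has_real_derivative (- 1 / x\<^sup>2)) (at x)"
      using greater by (auto intro!: derivative_eq_intros simp: power2_eq_square)
    from DERIV_chain2[OF poly_DERIV this, of p]
    show "((\<lambda>x. poly p (1 / x)) has_real_derivative poly (pderiv p) (1 / x) * (- 1 / x\<^sup>2)) (at x)" .
    show "((\<lambda>x. exp (- (1 / x))) has_real_derivative exp (- (1 / x)) * (1 / x\<^sup>2)) (at x)"
      using greater by (auto intro!: derivative_eq_intros simp: power2_eq_square)
  qed
  moreover have "\<forall>\<^sub>F y in nhds x. poly p (1 / y) * exp (- (1 / y)) = flat_exp p y"
    using eventually_nhds_in_open[of "{0<..}" x] greater
    by (auto simp: flat_exp_def elim!: eventually_mono)
  moreover have "(poly (pderiv p) (1 / x) * (- 1 / x\<^sup>2)) * exp (- (1 / x)) + (exp (- (1 / x)) * (1 / x\<^sup>2)) * poly p (1 / x)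
     = flat_exp ([:0, 0, 1:] * (p - pderiv p)) x"
    using greater by (simp add: flat_exp_def power2_eq_square field_simps)
  ultimately show ?thesis
    by (simp add: DERIV_cong_ev)
next
  case equal
  \<comment> \<open>Dividing by h multiplies by t = 1/h, hence the extra factor
    \<open>[:0, 1:]\<close>; the exponential still wins as t tends to infinity.\<close>
  have "((\<lambda>h. flat_exp p h / h) \<longlongrightarrow> 0) (at_right 0)"
  proof (rule Lim_transform_eventually)
    show "((\<lambda>h. poly ([:0, 1:] * p) (1 / h) * exp (- (1 / h))) \<longlongrightarrow> 0) (at_right 0)"
      by (rule filterlim_compose[OF poly_exp_minus_tendsto_0])
         (simp add: filterlim_inverse_at_top_right flip: inverse_eq_divide)
    show "\<forall>\<^sub>F h in at_right 0. poly ([:0, 1:] * p) (1 / h) * exp (- (1 / h)) = flat_exp p h / h"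
      by (auto simp: flat_exp_def eventually_at_right_field intro!: exI[of _ 1])
  qed
  moreover have "((\<lambda>h. flat_exp p h / h) \<longlongrightarrow> 0) (at_left 0)"
    by (rule Lim_transform_eventually[where f = "\<lambda>_. 0"])
       (auto simp: flat_exp_def eventually_at_left_field intro!: exI[of _ "-1"])
  ultimately have "((\<lambda>h. flat_exp p h / h) \<longlongrightarrow> 0) (at 0)"
    by (rule filterlim_split_at_real[rotated])
  then show ?thesis
    using equal by (simp add: DERIV_def flat_exp_def)
qed

lemma C_inf_flat_exp: "C_inf (flat_exp p)"
  unfolding C_inf_iff_smooth_upto
proof
  fix k show "smooth_upto (\<lambda>_. True) k (flat_exp p)"
  proof (induction k arbitrary: p)
    case (Suc k)
    show ?case by (rule smooth_upto_SucI[OF flat_exp_DERIV _ Suc]) simp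
  qed simp
qed

section \<open>Test functions and their supports\<close>

lemma test_funI:
  assumes "C_inf f" "\<And>x. x \<notin> {a..b} \<Longrightarrow> f x = 0"
  shows "test_fun f"
proof -
  have "{x. f x \<noteq> 0} \<subseteq> {a..b}" using assms(2) by blast
  then have "bounded {x. f x \<noteq> 0}" using bounded_closed_interval bounded_subset by blast
  then show ?thesis using assms(1) by (simp add: test_fun_def compact_closure)
qed

text \<open>The interval is open so that the function also vanishes at -m and m; this kills the
  boundary terms of later integrations over \<open>{-m..m}\<close>.\<close>

lemma test_funE:
  assumes "test_fun f"
  obtains m where "m > 0" "C_inf f" "\<And>x. x \<notin> {-m<..<m} \<Longrightarrow> f x = 0"
proof -
  have "bounded {x. f x \<noteq> 0}"
    using assms by (simp add: test_fun_def compact_closure)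
  then obtain m where m: "\<And>x. f x \<noteq> 0 \<Longrightarrow> \<bar>x\<bar> \<le> m"
    by (auto simp: bounded_iff)
  show ?thesis
  proof
    show "\<bar>m\<bar> + 1 > 0" by simp
    show "C_inf f" using assms test_fun_def by blast
    show "f x = 0" if "x \<notin> {- (\<bar>m\<bar> + 1)<..<\<bar>m\<bar> + 1}" for x
      using that m[of x] by (cases "f x = 0") (auto simp: abs_if split: if_splits)
  qed
qed

lemma deriv_zero_outside:
  assumes "\<And>x. x \<notin> {a..b} \<Longrightarrow> f x = (0 :: real)" "x \<notin> {a..b}"
  shows "deriv f x = 0"
proof -
  have "open (- {a..b})" by (intro open_Compl closed_real_atLeastAtMost)
  then have "\<forall>\<^sub>F y in nhds x. f y = 0"
    using eventually_nhds_in_open[of "- {a..b}" x] assms by (auto elim!: eventually_mono)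
  then have "((\<lambda>_. 0) has_real_derivative 0) (at x) \<longleftrightarrow> (f has_real_derivative 0) (at x)"
    by (intro DERIV_cong_ev) (auto elim: eventually_mono)
  then show ?thesis by (simp add: DERIV_imp_deriv)
qed

lemma test_fun_deriv: "test_fun f \<Longrightarrow> test_fun (deriv f)"
proof (elim test_funE)
  fix m assume m: "C_inf f" "\<And>x. x \<notin> {-m<..<m} \<Longrightarrow> f x = 0"
  then have "x \<notin> {-m..m} \<Longrightarrow> deriv f x = 0" for x
    by (intro deriv_zero_outside[of "-m" m]) auto
  then show ?thesis using m C_inf_deriv test_funI by blast
qed

lemma test_fun_add: "test_fun f \<Longrightarrow> test_fun g \<Longrightarrow> test_fun (\<lambda>x. f x + g x)"
proof (elim test_funE)
  fix m n assume C: "C_inf f" "C_inf g" and z: "\<And>x. x \<notin> {-m<..<m} \<Longrightarrow> f x = 0" "\<And>x. x \<notin> {-n<..<n} \<Longrightarrow> g x = 0"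
  show ?thesis
  proof (rule test_funI[where a = "-max m n" and b = "max m n"])
    fix x assume "x \<notin> {-max m n..max m n}"
    then have "x \<notin> {-m<..<m}" "x \<notin> {-n<..<n}" by auto
    then show "f x + g x = 0" using z by simp
  qed (use C C_inf_add in auto)
qed

lemma test_fun_mult: "C_inf f \<Longrightarrow> test_fun g \<Longrightarrow> test_fun (\<lambda>x. f x * g x)"
proof (elim test_funE)
  fix n assume "C_inf f" "C_inf g" "\<And>x. x \<notin> {-n<..<n} \<Longrightarrow> g x = 0"
  then show ?thesis
    by (intro test_funI[where a = "-n" and b = "n"] C_inf_mult) auto
qed

lemma test_fun_cmult: "test_fun f \<Longrightarrow> test_fun (\<lambda>x. c * f x)"
  by (intro test_fun_mult) auto

lemma test_fun_integrable:
  assumes "test_fun f" shows "integrable lborel f"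
proof -
  obtain m where m: "m > 0" "C_inf f" "\<And>x. x \<notin> {-m<..<m} \<Longrightarrow> f x = 0"
    using assms test_funE by blast
  have "set_integrable lborel {-m..m} f"
    using m by (intro borel_integrable_atLeastAtMost') (auto intro: C_inf_continuous_on)
  moreover have "indicator {-m..m} x *\<^sub>R f x = f x" for x
    using m(3)[of x] by (cases "x \<in> {-m<..<m}") (auto simp: indicator_def)
  then have "(\<lambda>x. indicator {-m..m} x *\<^sub>R f x) = f" by (rule ext)
  ultimately show ?thesis unfolding set_integrable_def by argo
qed

lemma test_fun_bounded:
  assumes "test_fun f" obtains B where "\<And>x. \<bar>f x\<bar> \<le> B"
proof -
  obtain m where m: "m > 0" "C_inf f" "\<And>x. x \<notin> {-m<..<m} \<Longrightarrow> f x = 0"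
    using assms test_funE by blast
  have "bounded (f ` {-m..m})"
    using m by (intro compact_imp_bounded compact_continuous_image C_inf_continuous_on) auto
  then obtain B where "\<forall>y\<in>f ` {-m..m}. \<bar>y\<bar> \<le> B"
    unfolding bounded_iff real_norm_def by blast
  then have B: "\<bar>f x\<bar> \<le> B" if "x \<in> {-m..m}" for x using that by blast
  show ?thesis
  proof
    fix x show "\<bar>f x\<bar> \<le> max B 0"
    proof (cases "x \<in> {-m<..<m}")
      case True
      then have "x \<in> {-m..m}" by simp
      from B[OF this] show ?thesis by linarith
    next
      case False
      from m(3)[OF this] show ?thesis by simp
    qed
  qed
qed

text \<open>The parameter \<open>t\<close> sharpens the edges: along t = 1, 2, 3, ... the bumps stay
  below the indicator of the open interval and converge to it pointwise, which suits dominated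
  convergence.\<close>

definition bump :: "real \<Rightarrow> real \<Rightarrow> real \<Rightarrow> real \<Rightarrow> real" where
  "bump a b t x = flat_exp 1 (t * (x - a)) * flat_exp 1 (t * (b - x))"

lemma bump_eq:
  assumes "t > 0"
  shows "bump a b t x = (if a < x \<and> x < b then exp (- (1 / (t * (x - a)))) * exp (- (1 / (t * (b - x)))) else 0)"
  using assms by (auto simp: bump_def flat_exp_def not_le zero_less_mult_iff mult_le_0_iff)

lemma test_fun_bump:
  assumes "t > 0" shows "test_fun (bump a b t)"
proof (rule test_funI[where a = a and b = b])
  have "C_inf (\<lambda>x. flat_exp 1 (t * x + - t * a) * flat_exp 1 (- t * x + t * b))"
    by (intro C_inf_mult C_inf_affine C_inf_flat_exp)
  then show "C_inf (bump a b t)"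
    by (simp add: bump_def[abs_def] right_diff_distrib)
  show "bump a b t x = 0" if "x \<notin> {a..b}" for x
    using that assms by (auto simp: bump_eq)
qed

lemma bump_bounds: "t > 0 \<Longrightarrow> 0 \<le> bump a b t x" "t > 0 \<Longrightarrow> bump a b t x \<le> indicator {a<..<b} x"
  by (auto simp: bump_eq mult_le_one)

lemma bump_tendsto:
  "(\<lambda>n. bump a b (real (Suc n)) x) \<longlonglongrightarrow> indicator {a<..<b} x"
proof (cases "a < x \<and> x < b")
  case True
  have "(\<lambda>n. 1 / (real (Suc n) * c)) \<longlonglongrightarrow> 0" for c :: real
  proof -
    have "(\<lambda>n. (1 / c) * inverse (real (Suc n))) \<longlonglongrightarrow> (1 / c) * 0"
      by (intro tendsto_mult_left LIMSEQ_inverse_real_of_nat)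
    then show ?thesis by (simp add: divide_inverse mult.commute del: of_nat_Suc)
  qed
  then have "(\<lambda>n. exp (- (1 / (real (Suc n) * (x - a)))) * exp (- (1 / (real (Suc n) * (b - x))))) \<longlonglongrightarrow> exp (- 0) * exp (- 0)"
    by (intro tendsto_intros)
  moreover have "bump a b (real (Suc n)) x = exp (- (1 / (real (Suc n) * (x - a)))) * exp (- (1 / (real (Suc n) * (b - x))))" for n
    using True by (subst bump_eq) (simp_all del: of_nat_Suc)
  moreover have "indicator {a<..<b} x = exp (- 0) * exp (- 0 :: real)"
    using True by simp
  ultimately show ?thesis by simp
next
  case False
  then have "bump a b (real (Suc n)) x = 0" for n
    by (subst bump_eq) (simp_all del: of_nat_Suc)
  moreover have "indicator {a<..<b} x = (0 :: real)"
    using False by simp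
  ultimately show ?thesis by simp
qed

section \<open>Primitives and the fundamental lemma\<close>

definition locally_integrable :: "(real \<Rightarrow> real) \<Rightarrow> bool" where
  "locally_integrable f \<longleftrightarrow> f \<in> borel_measurable lborel \<and> (\<forall>a b. set_integrable lborel {a..b} f)"

text \<open>Absolute continuity in integral form. It makes sense for a merely integrable
  \<open>f\<close>, and restricting to x \<le> y avoids oriented integrals.\<close>

definition primitive :: "(real \<Rightarrow> real) \<Rightarrow> (real \<Rightarrow> real) \<Rightarrow> bool" where
  "primitive F f \<longleftrightarrow> (\<forall>x y. x \<le> y \<longrightarrow> F y - F x = (LINT t:{x..y}|lborel. f t))"

lemma locally_integrableD:
  assumes "locally_integrable f"
  shows "f \<in> borel_measurable borel" "set_integrable lborel {a..b} f"
    "integrable lborel (\<lambda>x. f x * indicator {a..b} x)"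
  using assms by (auto simp: locally_integrable_def set_integrable_def mult.commute)

lemma locally_integrable_continuous:
  assumes "continuous_on UNIV f" shows "locally_integrable f"
  unfolding locally_integrable_def
proof safe
  show "f \<in> borel_measurable lborel"
    using assms by (simp add: borel_measurable_continuous_onI)
  show "set_integrable lborel {a..b} f" for a b
    by (intro borel_integrable_atLeastAtMost' continuous_on_subset[OF assms]) auto
qed

lemma locally_integrable_mult_bounded:
  assumes f: "locally_integrable f" and g: "g \<in> borel_measurable borel"
    and B: "\<And>x. \<bar>g x\<bar> \<le> B"
  shows "locally_integrable (\<lambda>x. f x * g x)"
  unfolding locally_integrable_def
proof safe
  note [measurable] = locally_integrableD(1)[OF f] g
  show "(\<lambda>x. f x * g x) \<in> borel_measurable lborel" by measurable
  fix a b
  have "integrable lborel (\<lambda>x. B * (f x * indicator {a..b} x))"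
    using locally_integrableD(3)[OF f] by simp
  then show "set_integrable lborel {a..b} (\<lambda>x. f x * g x)"
    unfolding set_integrable_def
  proof (rule Bochner_Integration.integrable_bound)
    show "AE x in lborel. norm (indicator {a..b} x *\<^sub>R (f x * g x)) \<le> norm (B * (f x * indicator {a..b} x))"
    proof (rule AE_I2)
      fix x
      have "\<bar>f x\<bar> * \<bar>g x\<bar> \<le> \<bar>f x\<bar> * \<bar>B\<bar>"
        using B[of x] by (intro mult_left_mono) auto
      then show "norm (indicator {a..b} x *\<^sub>R (f x * g x)) \<le> norm (B * (f x * indicator {a..b} x))"
        by (auto simp: indicator_def abs_mult mult.commute)
    qed
  qed auto
qed

lemma locally_integrable_diff:
  assumes "locally_integrable f" "locally_integrable g"
  shows "locally_integrable (\<lambda>x. f x - g x)"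
  using assms unfolding locally_integrable_def by auto

lemma integrable_mult_test_fun:
  assumes f: "locally_integrable f" and p: "test_fun p"
  shows "integrable lborel (\<lambda>x. f x * p x)"
proof -
  obtain m where m: "m > 0" "C_inf p" "\<And>x. x \<notin> {-m<..<m} \<Longrightarrow> p x = 0"
    using p test_funE by blast
  obtain B where B: "\<And>x. \<bar>p x\<bar> \<le> B" using test_fun_bounded[OF p] by blast
  have "p \<in> borel_measurable borel"
    using m(2) by (intro borel_measurable_continuous_onI C_inf_continuous_on)
  from locally_integrable_mult_bounded[OF f this B]
  have "integrable lborel (\<lambda>x. f x * p x * indicator {-m..m} x)"
    by (rule locally_integrableD)
  moreover have "f x * p x * indicator {-m..m} x = f x * p x" for x
    using m(3)[of x] by (cases "x \<in> {-m<..<m}") (auto simp: indicator_def)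
  ultimately show ?thesis by simp
qed

text \<open>Closed intervals generate the Borel sets, so the integral vanishes over every Borel set;
  cutting off to \<open>{-N..N}\<close> supplies the global integrability required for complements
  and countable unions.\<close>

lemma integral_Icc_zero_imp_AE_zero:
  assumes f: "locally_integrable f" and z: "\<And>a b. a \<le> b \<Longrightarrow> (LINT x:{a..b}|lborel. f x) = 0"
  shows "AE x in lborel. f x = 0"
proof -
  have "AE x in lborel. f x * indicator {-real N..real N} x = 0" for N :: nat
  proof (rule sigma_finite_measure.density_zero[OF lborel.sigma_finite_measure_axioms])
    let ?g = "\<lambda>x. f x * indicator {-real N..real N} x"
    show g: "integrable lborel ?g" by (rule locally_integrableD[OF f])
    fix A :: "real set" assume "A \<in> sets lborel"
    then have "A \<in> sets borel" by simp
    then show "(LINT x:A|lborel. ?g x) = 0"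
    proof (induction rule: borel_set_induct)
      case (interval a b)
      have "(LINT x:{a..b}|lborel. ?g x) = (LINT x:{max a (-real N)..min b (real N)}|lborel. f x)"
        unfolding set_lebesgue_integral_def
        by (intro Bochner_Integration.integral_cong) (auto simp: indicator_def)
      also have "\<dots> = 0"
        by (cases "max a (-real N) \<le> min b (real N)") (use z in \<open>auto simp: set_lebesgue_integral_def\<close>)
      finally show ?case .
    next
      case (compl A)
      have all: "(LINT x|lborel. ?g x) = (LINT x:{-real N..real N}|lborel. f x)"
        by (simp add: set_lebesgue_integral_def mult.commute)
      have "(LINT x:-A|lborel. ?g x) + (LINT x:A|lborel. ?g x) = (LINT x:(-A) \<union> A|lborel. ?g x)"
        using compl(1) integrable_mult_indicator[OF _ g, of A] integrable_mult_indicator[OF _ g, of "-A"]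
        by (intro set_integral_Un[symmetric]) (auto simp: set_integrable_def)
      also have "\<dots> = 0"
        using all z[of "-real N" "real N"] by (simp add: set_lebesgue_integral_def Compl_partition2)
      finally show ?case using compl by simp
    next
      case (union A)
      have "(LINT x:(\<Union>i. A i)|lborel. ?g x) = (\<Sum>i. (LINT x:(A i)|lborel. ?g x))"
      proof (rule lebesgue_integral_countable_add)
        show "set_integrable lborel (\<Union>i. A i) ?g"
          unfolding set_integrable_def using union g by (intro integrable_mult_indicator) auto
      qed (use union in \<open>auto simp: disjoint_family_on_def\<close>)
      then show ?case using union by simp
    qed (simp add: set_lebesgue_integral_def)
  qed
  then have "AE x in lborel. \<forall>N :: nat. f x * indicator {-real N..real N} x = 0"
    unfolding AE_all_countable by blast
  then show ?thesis
  proof (rule AE_mp, intro AE_I2 impI)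
    fix x assume *: "\<forall>N :: nat. f x * indicator {-real N..real N} x = 0"
    obtain N :: nat where "\<bar>x\<bar> \<le> real N" using real_arch_simple by blast
    then show "f x = 0" using *[rule_format, of N] by (auto simp: indicator_def abs_le_iff split: if_splits)
  qed
qed

text \<open>Bumps reduce the claim to integrals over open intervals; the two end points are null, so
  closed intervals follow.\<close>

theorem fundamental_lemma_test_fun:
  assumes f: "locally_integrable f" and z: "\<And>p. test_fun p \<Longrightarrow> (LINT x|lborel. f x * p x) = 0"
  shows "AE x in lborel. f x = 0"
proof (rule integral_Icc_zero_imp_AE_zero[OF f])
  note [measurable] = locally_integrableD(1)[OF f]
  fix a b :: real assume "a \<le> b"
  have "(\<lambda>n. LINT x|lborel. f x * bump a b (real (Suc n)) x) \<longlonglongrightarrow> (LINT x|lborel. f x * indicator {a<..<b} x)"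
  proof (rule integral_dominated_convergence[where w = "\<lambda>x. \<bar>f x * indicator {a..b} x\<bar>"])
    show "AE x in lborel. (\<lambda>n. f x * bump a b (real (Suc n)) x) \<longlonglongrightarrow> f x * indicator {a<..<b} x"
      by (intro AE_I2 tendsto_mult_left bump_tendsto)
    show "integrable lborel (\<lambda>x. \<bar>f x * indicator {a..b} x\<bar>)"
      using locally_integrableD(3)[OF f] by (rule integrable_abs)
    show "AE x in lborel. norm (f x * bump a b (real (Suc n)) x) \<le> \<bar>f x * indicator {a..b} x\<bar>" for n
    proof (rule AE_I2)
      fix x
      have "\<bar>bump a b (real (Suc n)) x\<bar> \<le> indicator {a<..<b} x"
        using bump_bounds[of "real (Suc n)" a b x] by (simp del: of_nat_Suc)
      also have "\<dots> \<le> indicator {a..b} x" by (simp add: indicator_def)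
      finally have "\<bar>bump a b (real (Suc n)) x\<bar> \<le> indicator {a..b} x" .
      then have "\<bar>f x\<bar> * \<bar>bump a b (real (Suc n)) x\<bar> \<le> \<bar>f x\<bar> * indicator {a..b} x"
        by (rule mult_left_mono) simp
      then show "norm (f x * bump a b (real (Suc n)) x) \<le> \<bar>f x * indicator {a..b} x\<bar>"
        by (simp add: abs_mult)
    qed
    show "(\<lambda>x. f x * bump a b (real (Suc n)) x) \<in> borel_measurable lborel" for n
      using integrable_mult_test_fun[OF f test_fun_bump[of "real (Suc n)" a b]] by simp
  qed simp
  moreover have "(LINT x|lborel. f x * bump a b (real (Suc n)) x) = 0" for n
    by (intro z test_fun_bump) simp
  ultimately have "(LINT x|lborel. f x * indicator {a<..<b} x) = 0"
    by (simp add: LIMSEQ_const_iff)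
  moreover have "(LINT x|lborel. f x * indicator {a<..<b} x) = (LINT x:{a..b}|lborel. f x)"
    unfolding set_lebesgue_integral_def
  proof (rule integral_cong_AE)
    show "AE x in lborel. f x * indicator {a<..<b} x = indicator {a..b} x *\<^sub>R f x"
      using AE_lborel_singleton[of a] AE_lborel_singleton[of b]
      by eventually_elim (auto simp: indicator_def)
  qed auto
  ultimately show "(LINT x:{a..b}|lborel. f x) = 0" by simp
qed

section \<open>Primitives of locally integrable functions\<close>

lemma primitive_split:
  assumes "locally_integrable f" "a \<le> b" "b \<le> c"
  shows "(LINT t:{a..c}|lborel. f t) = (LINT t:{a..b}|lborel. f t) + (LINT t:{b..c}|lborel. f t)"
proof -
  have "{a..c} = {a..b} \<union> {b..c}" using assms by auto
  moreover have "(LINT t:{a..b} \<union> {b..c}|lborel. f t) = (LINT t:{a..b}|lborel. f t) + (LINT t:{b..c}|lborel. f t)"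
  proof (rule set_integral_Un_AE)
    show "AE x in lborel. \<not> (x \<in> {a..b} \<and> x \<in> {b..c})"
      using AE_lborel_singleton[of b] by eventually_elim auto
  qed (auto intro: locally_integrableD[OF assms(1)])
  ultimately show ?thesis by simp
qed

lemma primitive_exists:
  assumes f: "locally_integrable f"
  obtains F where "primitive F f"
proof
  \<comment> \<open>For each x one of the two integrals runs over an empty or one-point interval, so
    this is the signed integral from 0 to x.\<close>
  let ?F = "\<lambda>x. (LINT t:{0..x}|lborel. f t) - (LINT t:{x..0}|lborel. f t)"
  have emp: "(LINT t:{a..b}|lborel. f t) = 0" if "b \<le> a" for a b
  proof (cases "a = b")
    case True
    have "AE x in lborel. indicator {a..b} x *\<^sub>R f x = 0"
      using AE_lborel_singleton[of a]
    proof eventually_elim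
      case (elim x) then show ?case using True by auto
    qed
    then show ?thesis unfolding set_lebesgue_integral_def by (rule integral_eq_zero_AE)
  qed (use that in \<open>simp add: set_lebesgue_integral_def\<close>)
  show "primitive ?F f"
    unfolding primitive_def
  proof (intro allI impI)
    fix x y :: real assume xy: "x \<le> y"
    consider "0 \<le> x" | "x \<le> 0" "0 \<le> y" | "y \<le> 0" by linarith
    then show "?F y - ?F x = (LINT t:{x..y}|lborel. f t)"
    proof cases
      case 1 then show ?thesis using primitive_split[OF f 1 xy] emp[of 0 x] emp[of 0 y] xy by simp
    next
      case 2 then show ?thesis using primitive_split[OF f 2] emp[of x 0] emp[of 0 y] by simp
    next
      case 3 then show ?thesis using primitive_split[OF f xy 3] emp[of x 0] emp[of y 0] xy by simp
    qed
  qed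
qed

lemma primitive_DERIV:
  assumes "continuous_on UNIV f" "\<And>x. (F has_real_derivative f x) (at x)"
  shows "primitive F f"
  unfolding primitive_def
proof (intro allI impI)
  fix x y :: real assume "x \<le> y"
  then have "(LINT t|lborel. f t * indicator {x..y} t) = F y - F x"
    using assms by (intro integral_FTC_Icc_real) (auto simp: continuous_on_eq_continuous_at)
  then show "F y - F x = (LINT t:{x..y}|lborel. f t)"
    by (simp add: set_lebesgue_integral_def mult.commute)
qed

text \<open>A classical antiderivative of \<open>f\<close> is itself a primitive, so it differs from
  \<open>F\<close> by a constant only.\<close>

lemma DERIV_primitive:
  assumes "continuous_on UNIV f" "primitive F f"
  shows "(F has_real_derivative f x) (at x)"
proof -
  obtain G where G: "\<And>x. (G has_vector_derivative f x) (at x)"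
    using einterval_antiderivative[of "-\<infinity>" \<infinity> f] assms(1) by (auto simp: continuous_on_eq_continuous_at)
  then have G: "(G has_real_derivative f x) (at x)" for x
    by (simp add: has_real_derivative_iff_has_vector_derivative)
  then have "primitive G f" by (intro primitive_DERIV assms)
  then have "G y - G x = F y - F x" if "x \<le> y" for x y
    using assms(2) that unfolding primitive_def by simp
  note * = this[of 0] this[of _ 0]
  define c where "c = F 0 - G 0"
  have "F y = G y + c" for y
  proof (cases "0 \<le> y")
    case True
    from *(1)[OF this] show ?thesis by (simp add: c_def)
  next
    case False
    with *(2)[of y] show ?thesis by (simp add: c_def)
  qed
  then have "F = (\<lambda>y. G y + c)" by (rule ext)
  moreover have "((\<lambda>y. G y + c) has_real_derivative f x) (at x)"
    using G by (auto intro!: derivative_eq_intros)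
  ultimately show ?thesis by simp
qed

lemma antiderivative_exists:
  assumes "continuous_on UNIV (f :: real \<Rightarrow> real)"
  shows "\<exists>F. \<forall>x. (F has_real_derivative f x) (at x)"
proof -
  obtain F where "primitive F f"
    by (rule primitive_exists[OF locally_integrable_continuous[OF assms]])
  from DERIV_primitive[OF assms this] show ?thesis by (intro exI[of _ F] allI)
qed

lemma integral_deriv_test_fun:
  assumes "test_fun p" shows "(LINT x|lborel. deriv p x) = 0"
proof -
  obtain m where m: "m > 0" "C_inf p" "\<And>x. x \<notin> {-m<..<m} \<Longrightarrow> p x = 0"
    using assms test_funE by blast
  have "(LINT x|lborel. deriv p x * indicator {-m..m} x) = p m - p (-m)"
    using m by (intro integral_FTC_Icc_real) (simp_all add: C_inf_DERIV C_inf_isCont C_inf_deriv)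
  moreover have "deriv p x * indicator {-m..m} x = deriv p x" for x
  proof (cases "x \<in> {-m..m}")
    case False
    have "deriv p x = 0"
      using False m(3) by (rule deriv_zero_outside[of "-m" m p x, rotated]) auto
    then show ?thesis by simp
  qed simp
  ultimately show ?thesis using m by simp
qed

lemma primitive_continuous:
  assumes f: "locally_integrable f" and F: "primitive F f"
  shows "continuous_on UNIV F"
proof -
  have "isCont F x" for x
  proof -
    let ?I = "{x - 1..x + 1}"
    have si: "set_integrable lborel {a..b} f" for a b
      by (rule locally_integrableD[OF f])
    have eq: "F y = F (x - 1) + integral {x - 1..y} f" if "y \<in> ?I" for y
    proof -
      have "F y - F (x - 1) = (LINT t:{x - 1..y}|lborel. f t)"
        using F that unfolding primitive_def by auto
      then show ?thesis using set_borel_integral_eq_integral(2)[OF si] by simp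
    qed
    have "continuous_on ?I (\<lambda>y. F (x - 1) + integral {x - 1..y} f)"
      using set_borel_integral_eq_integral(1)[OF si]
      by (intro continuous_intros indefinite_integral_continuous_1)
    then have "continuous_on ?I F"
      by (rule continuous_on_eq) (rule eq[symmetric])
    then show ?thesis
      by (rule continuous_on_interior) (simp add: interior_atLeastAtMost_real)
  qed
  then show ?thesis by (simp add: continuous_at_imp_continuous_on)
qed

text \<open>Fubini on the triangle \<open>t \<le> x\<close>.\<close>

theorem primitive_integral_by_parts:
  assumes g: "locally_integrable g" and F: "primitive f g" and p: "test_fun p"
  shows "(LINT x|lborel. f x * deriv p x) = - (LINT x|lborel. g x * p x)"
proof -
  obtain m where m: "m > 0" "C_inf p" "\<And>x. x \<notin> {-m<..<m} \<Longrightarrow> p x = 0"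
    using p test_funE by blast
  note [measurable] = locally_integrableD(1)[OF g]
  have [measurable]: "deriv p \<in> borel_measurable borel"
    using m(2) by (intro borel_measurable_continuous_onI C_inf_continuous_on C_inf_deriv)
  have dz: "deriv p x = 0" if "x \<notin> {-m..m}" for x
    using that m(3) by (rule deriv_zero_outside[of "-m" m p x, rotated]) auto
  define G where "G = (\<lambda>t. g t * indicator {-m..m} t)"
  have G: "integrable lborel G" unfolding G_def by (rule locally_integrableD[OF g])
  have [measurable]: "G \<in> borel_measurable borel" using G by auto
  \<comment> \<open>Integrating out t turns this kernel into (f(x) - f(-m)) p'(x); integrating out x
    turns it into -g(t) p(t), because p(m) = 0.\<close>
  define D where "D = (\<lambda>x t. deriv p x * G t * of_bool (t \<le> x))"
  have int0: "integrable (lborel \<Otimes>\<^sub>M lborel) (\<lambda>(x, t). deriv p x * G t)"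
    by (rule lborel_pair.Fubini_integrable)
       (use G test_fun_integrable[OF test_fun_deriv[OF p]] in \<open>auto simp: abs_mult\<close>)
  have int: "integrable (lborel \<Otimes>\<^sub>M lborel) (case_prod D)"
    by (rule Bochner_Integration.integrable_bound[OF int0]) (auto simp: D_def)
  have inner1: "(LINT t|lborel. D x t) = (f x - f (-m)) * deriv p x" for x
  proof (cases "x \<in> {-m..m}")
    case True
    have "(LINT t|lborel. D x t) = (LINT t|lborel. deriv p x * (indicator {-m..x} t *\<^sub>R g t))"
      using True by (intro Bochner_Integration.integral_cong) (auto simp: D_def G_def indicator_def)
    also have "\<dots> = deriv p x * (f x - f (-m))"
      using F True unfolding primitive_def by (simp add: set_lebesgue_integral_def)
    finally show ?thesis by simp
  qed (simp add: D_def dz)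
  have inner2: "(LINT x|lborel. D x t) = - (g t * p t)" for t
  proof (cases "t \<in> {-m..m}")
    case True
    have "(LINT x|lborel. D x t) = (LINT x|lborel. g t * (deriv p x * indicator {t..m} x))"
      using True dz by (intro Bochner_Integration.integral_cong) (auto simp: D_def G_def indicator_def)
    also have "\<dots> = g t * (LINT x|lborel. deriv p x * indicator {t..m} x)" by simp
    also have "(LINT x|lborel. deriv p x * indicator {t..m} x) = p m - p t"
      using m True by (intro integral_FTC_Icc_real) (simp_all add: C_inf_DERIV C_inf_isCont C_inf_deriv)
    finally show ?thesis using m(3)[of m] by simp
  next
    case False
    then show ?thesis using m(3)[of t] by (auto simp: D_def G_def)
  qed
  have "(LINT x|lborel. (f x - f (-m)) * deriv p x) = - (LINT t|lborel. g t * p t)"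
    using lborel_pair.Fubini_integral[OF int] by (simp add: inner1 inner2)
  \<comment> \<open>The constant f(-m) disappears since the derivative of a test function has
    integral zero.\<close>
  moreover have "(LINT x|lborel. (f x - f (-m)) * deriv p x) = (LINT x|lborel. f x * deriv p x)"
  proof -
    have "integrable lborel (\<lambda>x. f x * deriv p x)"
      by (intro integrable_mult_test_fun test_fun_deriv p locally_integrable_continuous primitive_continuous[OF g F])
    moreover have "integrable lborel (\<lambda>x. f (-m) * deriv p x)"
      using test_fun_integrable[OF test_fun_deriv[OF p]] by simp
    ultimately show ?thesis
      using integral_deriv_test_fun[OF p] by (simp add: left_diff_distrib)
  qed
  ultimately show ?thesis by simp
qed

section \<open>Square-integrable functions and weak derivatives\<close>

lemma L2D:
  assumes "L2 f"
  shows "f \<in> borel_measurable borel" "integrable lborel (\<lambda>x. (f x)\<^sup>2)"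
  using assms by (auto simp: L2_def)

lemma L2_mult_integrable:
  assumes "L2 f" "L2 g" shows "integrable lborel (\<lambda>x. f x * g x)"
proof (rule Bochner_Integration.integrable_bound)
  show "integrable lborel (\<lambda>x. (f x)\<^sup>2 + (g x)\<^sup>2)"
    using assms by (intro Bochner_Integration.integrable_add L2D)
  show "(\<lambda>x. f x * g x) \<in> borel_measurable lborel"
    using assms[THEN L2D(1)] by simp
  show "AE x in lborel. norm (f x * g x) \<le> norm ((f x)\<^sup>2 + (g x)\<^sup>2)"
  proof (rule AE_I2)
    fix x
    have "2 * \<bar>f x\<bar> * \<bar>g x\<bar> \<le> \<bar>f x\<bar>\<^sup>2 + \<bar>g x\<bar>\<^sup>2" by (rule sum_squares_bound)
    moreover have "0 \<le> \<bar>f x\<bar> * \<bar>g x\<bar>" by simp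
    ultimately have "\<bar>f x\<bar> * \<bar>g x\<bar> \<le> (f x)\<^sup>2 + (g x)\<^sup>2"
      unfolding mult.assoc power2_abs by linarith
    then show "norm (f x * g x) \<le> norm ((f x)\<^sup>2 + (g x)\<^sup>2)"
      by (simp add: abs_mult)
  qed
qed

lemma L2_mult_bounded:
  assumes f: "L2 f" and g: "g \<in> borel_measurable borel" and B: "\<And>x. \<bar>g x\<bar> \<le> B"
  shows "L2 (\<lambda>x. g x * f x)"
  unfolding L2_def
proof
  note [measurable] = L2D(1)[OF f] g
  show "(\<lambda>x. g x * f x) \<in> borel_measurable lborel" by simp
  have "integrable lborel (\<lambda>x. B\<^sup>2 * (f x)\<^sup>2)" using L2D(2)[OF f] by simp
  then show "integrable lborel (\<lambda>x. (g x * f x)\<^sup>2)"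
  proof (rule Bochner_Integration.integrable_bound)
    show "AE x in lborel. norm ((g x * f x)\<^sup>2) \<le> norm (B\<^sup>2 * (f x)\<^sup>2)"
    proof (rule AE_I2)
      fix x
      have "(g x)\<^sup>2 \<le> B\<^sup>2" using B[of x] by (rule power2_le_iff_abs_le[THEN iffD2, rotated]) (use B[of x] in linarith)
      then have "(g x)\<^sup>2 * (f x)\<^sup>2 \<le> B\<^sup>2 * (f x)\<^sup>2" by (rule mult_right_mono) simp
      then show "norm ((g x * f x)\<^sup>2) \<le> norm (B\<^sup>2 * (f x)\<^sup>2)" by (simp add: power_mult_distrib)
    qed
  qed simp
qed

lemma L2_cmult: "L2 f \<Longrightarrow> L2 (\<lambda>x. c * f x)"
  by (rule L2_mult_bounded[where B = "\<bar>c\<bar>"]) auto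

lemma L2_add:
  assumes "L2 f" "L2 g" shows "L2 (\<lambda>x. f x + g x)"
  unfolding L2_def
proof
  show "(\<lambda>x. f x + g x) \<in> borel_measurable lborel" using assms[THEN L2D(1)] by simp
  have "integrable lborel (\<lambda>x. (f x)\<^sup>2 + (g x)\<^sup>2 + 2 * (f x * g x))"
    using assms by (intro Bochner_Integration.integrable_add integrable_mult_right L2D L2_mult_integrable)
  then show "integrable lborel (\<lambda>x. (f x + g x)\<^sup>2)"
    by (simp add: power2_sum mult.assoc)
qed

lemma L2_locally_integrable:
  assumes f: "L2 f" shows "locally_integrable f"
  unfolding locally_integrable_def
proof safe
  note [measurable] = L2D(1)[OF f]
  show "f \<in> borel_measurable lborel" by simp
  fix a b :: real
  have "L2 (indicator {a..b})"
    by (cases "a \<le> b") (auto simp: L2_def power2_eq_square simp flip: indicator_inter_arith)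
  from L2_mult_integrable[OF this f]
  show "set_integrable lborel {a..b} f"
    by (simp add: set_integrable_def)
qed

lemma L2_cong_AE:
  assumes "L2 f" "AE x in lborel. f x = g x" "g \<in> borel_measurable borel"
  shows "L2 g"
  unfolding L2_def
proof
  have "integrable lborel (\<lambda>x. (g x)\<^sup>2) \<longleftrightarrow> integrable lborel (\<lambda>x. (f x)\<^sup>2)"
    using assms L2D(1)[OF assms(1)] by (intro integrable_cong_AE) auto
  then show "integrable lborel (\<lambda>x. (g x)\<^sup>2)" using L2D(2)[OF assms(1)] by simp
qed (use assms in simp)

lemma L2_translate:
  assumes "L2 f" shows "L2 (\<lambda>x. f (x + h))"
  unfolding L2_def
proof
  note [measurable] = L2D(1)[OF assms]
  show "(\<lambda>x. f (x + h)) \<in> borel_measurable lborel" by simp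
  show "integrable lborel (\<lambda>x. (f (x + h))\<^sup>2)"
    using lborel_integrable_real_affine[OF L2D(2)[OF assms], of 1 h] by (simp add: add.commute)
qed

lemma integrable_bounded_mult_L2:
  assumes "L2 f" "L2 g" "c \<in> borel_measurable borel" "\<And>x. \<bar>c x\<bar> \<le> B"
  shows "integrable lborel (\<lambda>x. c x * f x * g x)"
  using L2_mult_integrable[OF L2_mult_bounded[OF assms(1,3,4)] assms(2)] .

lemma continuous_AE_zero_imp_zero:
  assumes "continuous_on UNIV (f :: real \<Rightarrow> real)" "AE x in lborel. f x = 0"
  shows "f x = 0"
proof (rule ccontr)
  assume "f x \<noteq> 0"
  have "open {x. f x \<noteq> 0}"
    using assms(1) by (intro open_Collect_neq) auto
  moreover have "negligible {x. f x \<noteq> 0}"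
  proof -
    have "AE x in lebesgue. f x = 0" using assms(2) by (rule AE_completion)
    then show ?thesis by (simp add: eventually_ae_filter_negligible) (metis (mono_tags, lifting) negligible_subset)
  qed
  ultimately show False using open_not_negligible \<open>f x \<noteq> 0\<close> by blast
qed

text \<open>The antiderivative that vanishes to the left of the support equals the full integral to
  the right of it, so mean zero is exactly what gives compact support.\<close>

lemma test_fun_antiderivative:
  assumes p: "test_fun p" and z: "(LINT x|lborel. p x) = 0"
  obtains q where "test_fun q" "deriv q = p"
proof -
  obtain m where m: "m > 0" "C_inf p" "\<And>x. x \<notin> {-m<..<m} \<Longrightarrow> p x = 0"
    using p test_funE by blast
  have c: "continuous_on UNIV p" using m(2) by (rule C_inf_continuous_on)
  obtain F where "\<forall>x. (F has_real_derivative p x) (at x)"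
    using antiderivative_exists[OF c] by (rule exE)
  then have F: "(F has_real_derivative p x) (at x)" for x by (rule spec)
  have P: "F y - F x = (LINT t:{x..y}|lborel. p t)" if "x \<le> y" for x y
    using primitive_DERIV[OF c F] that unfolding primitive_def by simp
  define q where "q = (\<lambda>x. F x - F (-m))"
  have q: "(q has_real_derivative p x) (at x)" for x
    unfolding q_def using F by (auto intro!: derivative_eq_intros)
  have "test_fun q"
  proof (rule test_funI[where a = "-m" and b = m])
    show "C_inf q" by (rule C_infI_DERIV[OF q m(2)])
    fix x assume x: "x \<notin> {-m..m}"
    show "q x = 0"
    proof (cases "x < -m")
      case True
      have "indicator {x..-m} t *\<^sub>R p t = 0" for t
        using m(3)[of t] by (auto simp: indicator_def)
      then have "(LINT t:{x..-m}|lborel. p t) = 0"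
        unfolding set_lebesgue_integral_def by (simp only: integral_zero)
      then show ?thesis using P[of x "-m"] True by (simp add: q_def)
    next
      case False
      then have "x > m" using x by auto
      have "(LINT t:{-m..x}|lborel. p t) = (LINT t|lborel. p t)"
        unfolding set_lebesgue_integral_def
      proof (intro Bochner_Integration.integral_cong refl)
        fix t show "indicator {-m..x} t *\<^sub>R p t = p t"
          using m(3)[of t] \<open>x > m\<close> by (cases "t \<in> {-m<..<m}") (auto simp: indicator_def)
      qed
      then show ?thesis using P[of "-m" x] z \<open>x > m\<close> \<open>m > 0\<close> by (simp add: q_def)
    qed
  qed
  then show ?thesis using that deriv_eqI[OF q] by simp
qed

lemma test_fun_normalized:
  obtains p where "test_fun p" "(LINT x|lborel. p x) = 1"
proof -
  have t: "test_fun (bump 0 1 1)" by (rule test_fun_bump) simp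
  have "(LINT x|lborel. bump 0 1 1 x) \<noteq> 0"
  proof
    assume "(LINT x|lborel. bump 0 1 1 x) = 0"
    then have "AE x in lborel. bump 0 1 1 x = 0"
      using test_fun_integrable[OF t] by (subst (asm) integral_nonneg_eq_0_iff_AE) (auto simp: bump_bounds)
    moreover have "continuous_on UNIV (bump 0 1 1)"
      using t by (auto simp: test_fun_def C_inf_continuous_on)
    ultimately have "bump 0 1 1 (1/2) = 0" by (rule continuous_AE_zero_imp_zero[rotated])
    then show False by (simp add: bump_eq)
  qed
  then show ?thesis
    using that[OF test_fun_cmult[OF t, of "1 / (LINT x|lborel. bump 0 1 1 x)"]] by simp
qed

text \<open>The function \<open>p - (\<integral>p) p\<^sub>0\<close> is the derivative of a test function whenever \<open>\<integral>p\<^sub>0 = 1\<close>.\<close>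

lemma functional_vanishing_on_derivs:
  fixes J :: "(real \<Rightarrow> real) \<Rightarrow> real"
  assumes lin: "\<And>p q c. test_fun p \<Longrightarrow> test_fun q \<Longrightarrow> J (\<lambda>x. p x + c * q x) = J p + c * J q"
    and z: "\<And>p. test_fun p \<Longrightarrow> J (deriv p) = 0"
  shows "\<exists>c. \<forall>p. test_fun p \<longrightarrow> J p = c * (LINT x|lborel. p x)"
proof -
  obtain p0 where p0: "test_fun p0" "(LINT x|lborel. p0 x) = 1" by (rule test_fun_normalized)
  show ?thesis
  proof (intro exI[of _ "J p0"] allI impI)
    fix p assume p: "test_fun p"
    let ?c = "- (LINT x|lborel. p x)"
    have t: "test_fun (\<lambda>x. p x + ?c * p0 x)" by (intro test_fun_add test_fun_cmult p p0)
    have "(LINT x|lborel. p x + ?c * p0 x) = 0"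
      using test_fun_integrable[OF p] test_fun_integrable[OF p0(1)] p0(2) by simp
    then obtain q where "test_fun q" "deriv q = (\<lambda>x. p x + ?c * p0 x)"
      by (rule test_fun_antiderivative[OF t])
    then have "J (\<lambda>x. p x + ?c * p0 x) = 0" using z by metis
    then show "J p = J p0 * (LINT x|lborel. p x)" using lin[OF p p0(1), of ?c] by (simp add: mult.commute)
  qed
qed

text \<open>Integration against \<open>f\<close> annihilates derivatives and is therefore a multiple
  of the plain integral; the fundamental lemma applies to \<open>f\<close> minus that
  multiple.\<close>

lemma du_Bois_Reymond:
  assumes f: "locally_integrable f" and z: "\<And>p. test_fun p \<Longrightarrow> (LINT x|lborel. f x * deriv p x) = 0"
  obtains c where "AE x in lborel. f x = c"
proof -
  have lin: "(LINT x|lborel. f x * (p x + c * q x)) = (LINT x|lborel. f x * p x) + c * (LINT x|lborel. f x * q x)"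
    if "test_fun p" "test_fun q" for p q c
    using that[THEN integrable_mult_test_fun[OF f]] by (simp add: distrib_left mult.left_commute)
  obtain c where c: "\<forall>p. test_fun p \<longrightarrow> (LINT x|lborel. f x * p x) = c * (LINT x|lborel. p x)"
    using functional_vanishing_on_derivs[of "\<lambda>p. LINT x|lborel. f x * p x", OF lin z] by (rule exE)
  have "AE x in lborel. f x - c = 0"
  proof (rule fundamental_lemma_test_fun)
    show "locally_integrable (\<lambda>x. f x - c)"
      by (intro locally_integrable_diff f locally_integrable_continuous) auto
    fix p assume p: "test_fun p"
    show "(LINT x|lborel. (f x - c) * p x) = 0"
      using c[rule_format, OF p] integrable_mult_test_fun[OF f p] test_fun_integrable[OF p]
      by (simp add: left_diff_distrib)
  qed
  then show ?thesis using that[of c] by simp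
qed

text \<open>Produces the absolutely continuous representative of a weakly differentiable function:
  subtracting any primitive of \<open>g\<close> leaves weak derivative zero, hence a constant, which
  the primitive absorbs.\<close>

lemma weak_deriv_primitive:
  assumes f: "locally_integrable f" and g: "locally_integrable g" and w: "weak_deriv f g"
  obtains F where "primitive F g" "AE x in lborel. f x = F x"
proof -
  obtain F where F: "primitive F g" by (rule primitive_exists[OF g])
  have lF: "locally_integrable F"
    by (rule locally_integrable_continuous[OF primitive_continuous[OF g F]])
  obtain c where "AE x in lborel. f x - F x = c"
  proof (rule du_Bois_Reymond)
    show "locally_integrable (\<lambda>x. f x - F x)" by (rule locally_integrable_diff[OF f lF])
    fix p assume p: "test_fun p"
    then show "(LINT x|lborel. (f x - F x) * deriv p x) = 0"
      using w primitive_integral_by_parts[OF g F p]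
        integrable_mult_test_fun[OF f test_fun_deriv[OF p]] integrable_mult_test_fun[OF lF test_fun_deriv[OF p]]
      by (simp add: left_diff_distrib weak_deriv_def)
  qed
  then have "AE x in lborel. f x = F x + c" by (auto simp: algebra_simps)
  moreover have "primitive (\<lambda>x. F x + c) g" using F by (simp add: primitive_def)
  ultimately show ?thesis by (intro that)
qed

lemma weak_deriv_unique:
  assumes g: "locally_integrable g" "locally_integrable h" and w: "weak_deriv f g" "weak_deriv f h"
  shows "AE x in lborel. g x = h x"
proof -
  have "AE x in lborel. g x - h x = 0"
  proof (rule fundamental_lemma_test_fun)
    show "locally_integrable (\<lambda>x. g x - h x)" by (rule locally_integrable_diff[OF g])
    fix p assume p: "test_fun p"
    then show "(LINT x|lborel. (g x - h x) * p x) = 0"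
      using w g[THEN integrable_mult_test_fun, OF p]
      by (simp add: left_diff_distrib weak_deriv_def)
  qed
  then show ?thesis by simp
qed

text \<open>\<open>wderiv\<close> is a choice among almost everywhere equal functions, so it may be
  replaced by a concrete weak derivative only under an integral or an almost everywhere
  statement.\<close>

lemma wderiv_AE_eq:
  assumes "L2 g" "weak_deriv f g"
  shows "L2 (wderiv f)" "weak_deriv f (wderiv f)" "AE x in lborel. wderiv f x = g x"
proof -
  have "L2 (wderiv f) \<and> weak_deriv f (wderiv f)"
    unfolding wderiv_def by (rule someI[of "\<lambda>h. L2 h \<and> weak_deriv f h" g]) (simp add: assms)
  then show *: "L2 (wderiv f)" "weak_deriv f (wderiv f)" by auto
  show "AE x in lborel. wderiv f x = g x"
    by (rule weak_deriv_unique[of _ _ f]) (simp_all add: assms * L2_locally_integrable)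
qed

lemma weak_deriv_DERIV:
  assumes "continuous_on UNIV g" "\<And>x. (f has_real_derivative g x) (at x)"
  shows "weak_deriv f g"
  unfolding weak_deriv_def
  using primitive_integral_by_parts[OF locally_integrable_continuous[OF assms(1)] primitive_DERIV[OF assms]]
  by simp

lemma weak_deriv_cong_AE:
  assumes "weak_deriv f g" "AE x in lborel. f x = f' x" "AE x in lborel. g x = g' x"
    "f \<in> borel_measurable borel" "f' \<in> borel_measurable borel" "g \<in> borel_measurable borel" "g' \<in> borel_measurable borel"
  shows "weak_deriv f' g'"
  unfolding weak_deriv_def
proof (intro allI impI)
  fix p assume p: "test_fun p"
  have [measurable]: "p \<in> borel_measurable borel" "deriv p \<in> borel_measurable borel"
    using p by (auto simp: test_fun_def intro!: borel_measurable_continuous_onI C_inf_continuous_on C_inf_deriv)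
  note [measurable] = assms(4-)
  have "(LINT x|lborel. f' x * deriv p x) = (LINT x|lborel. f x * deriv p x)"
    using assms(2) by (intro integral_cong_AE) auto
  moreover have "(LINT x|lborel. g' x * p x) = (LINT x|lborel. g x * p x)"
    using assms(3) by (intro integral_cong_AE) auto
  ultimately show "(LINT x|lborel. f' x * deriv p x) = - (LINT x|lborel. g' x * p x)"
    using assms(1) p by (simp add: weak_deriv_def)
qed

text \<open>Each of three rounds peels one derivative off the test function: a functional that kills
  derivatives is a constant times the integral, and subtracting the matching monomial makes it
  vanish again. Continuity of \<open>H\<close> turns the final almost everywhere equality into
  equality everywhere.\<close>

lemma third_order_du_Bois_Reymond:
  assumes H: "continuous_on UNIV (H :: real \<Rightarrow> real)"
    and z: "\<And>p. test_fun p \<Longrightarrow> (LINT x|lborel. H x * deriv (deriv (deriv p)) x) = 0"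
  shows "\<exists>c0 c1 c2. \<forall>x. H x = c0 + c1 * x + c2 * x\<^sup>2"
proof -
  have add: "deriv (\<lambda>x. p x + c * q x) = (\<lambda>x. deriv p x + c * deriv q x)"
    if "test_fun p" "test_fun q" for p q c
    using that by (intro deriv_eqI)
      (auto simp: test_fun_def intro!: derivative_eq_intros C_inf_DERIV)
  have li: "integrable lborel (\<lambda>x. G x * p x)" if "continuous_on UNIV G" "test_fun p" for G p
    using that by (intro integrable_mult_test_fun locally_integrable_continuous)
  have "\<exists>c. \<forall>p. test_fun p \<longrightarrow> (LINT x|lborel. H x * deriv (deriv p) x) = c * (LINT x|lborel. p x)"
  proof (rule functional_vanishing_on_derivs[of "\<lambda>p. LINT x|lborel. H x * deriv (deriv p) x"])
    fix p q c assume t: "test_fun p" "test_fun q"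
    have "integrable lborel (\<lambda>x. H x * deriv (deriv p) x)" "integrable lborel (\<lambda>x. H x * deriv (deriv q) x)"
      using t by (auto intro!: li H test_fun_deriv)
    then show "(LINT x|lborel. H x * deriv (deriv (\<lambda>x. p x + c * q x)) x)
        = (LINT x|lborel. H x * deriv (deriv p) x) + c * (LINT x|lborel. H x * deriv (deriv q) x)"
      by (simp add: add t test_fun_deriv distrib_left mult.left_commute)
  qed (use z in auto)
  then obtain c2 where c2: "\<forall>p. test_fun p \<longrightarrow> (LINT x|lborel. H x * deriv (deriv p) x) = c2 * (LINT x|lborel. p x)"
    by (rule exE)
  \<comment> \<open>Two integrations by parts of (c2/2) x^2 against p'' give c2 times the integral
    of p, which cancels the constant found.\<close>
  define H2 where "H2 = (\<lambda>x. H x - c2 / 2 * x\<^sup>2)"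
  have H2: "continuous_on UNIV H2" unfolding H2_def by (intro continuous_intros H)
  have z2: "(LINT x|lborel. H2 x * deriv (deriv p) x) = 0" if p: "test_fun p" for p
  proof -
    have "weak_deriv (\<lambda>x. c2 / 2 * x\<^sup>2) (\<lambda>x. c2 * x)"
      by (intro weak_deriv_DERIV) (auto intro!: derivative_eq_intros continuous_intros)
    then have "(LINT x|lborel. c2 / 2 * x\<^sup>2 * deriv (deriv p) x) = - (LINT x|lborel. c2 * x * deriv p x)"
      using test_fun_deriv[OF p] unfolding weak_deriv_def by blast
    moreover have "weak_deriv (\<lambda>x. c2 * x) (\<lambda>x. c2)"
      by (intro weak_deriv_DERIV) (auto intro!: derivative_eq_intros continuous_intros)
    then have "(LINT x|lborel. c2 * x * deriv p x) = - (LINT x|lborel. c2 * p x)"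
      using p unfolding weak_deriv_def by blast
    ultimately have "(LINT x|lborel. c2 / 2 * x\<^sup>2 * deriv (deriv p) x) = c2 * (LINT x|lborel. p x)"
      by simp
    moreover have "integrable lborel (\<lambda>x. c2 / 2 * x\<^sup>2 * deriv (deriv p) x)" "integrable lborel (\<lambda>x. H x * deriv (deriv p) x)"
      using p by (auto intro!: li H test_fun_deriv continuous_intros)
    ultimately show ?thesis using c2[rule_format, OF p] by (simp add: H2_def left_diff_distrib)
  qed
  have "\<exists>c. \<forall>p. test_fun p \<longrightarrow> (LINT x|lborel. H2 x * deriv p x) = c * (LINT x|lborel. p x)"
  proof (rule functional_vanishing_on_derivs[of "\<lambda>p. LINT x|lborel. H2 x * deriv p x"])
    fix p q c assume t: "test_fun p" "test_fun q"
    have "integrable lborel (\<lambda>x. H2 x * deriv p x)" "integrable lborel (\<lambda>x. H2 x * deriv q x)"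
      using t by (auto intro!: li H2 test_fun_deriv)
    then show "(LINT x|lborel. H2 x * deriv (\<lambda>x. p x + c * q x) x)
        = (LINT x|lborel. H2 x * deriv p x) + c * (LINT x|lborel. H2 x * deriv q x)"
      by (simp add: add t test_fun_deriv distrib_left mult.left_commute)
  qed (use z2 in auto)
  then obtain c1 where c1: "\<forall>p. test_fun p \<longrightarrow> (LINT x|lborel. H2 x * deriv p x) = c1 * (LINT x|lborel. p x)"
    by (rule exE)
  \<comment> \<open>The sign is now plus, because a single integration by parts of c1 x against p'
    gives minus c1 times the integral of p.\<close>
  define H1 where "H1 = (\<lambda>x. H2 x + c1 * x)"
  have H1: "continuous_on UNIV H1" unfolding H1_def by (intro continuous_intros H2)
  have z1: "(LINT x|lborel. H1 x * deriv p x) = 0" if p: "test_fun p" for p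
  proof -
    have "weak_deriv (\<lambda>x. c1 * x) (\<lambda>x. c1)"
      by (intro weak_deriv_DERIV) (auto intro!: derivative_eq_intros continuous_intros)
    then have "(LINT x|lborel. c1 * x * deriv p x) = - (LINT x|lborel. c1 * p x)"
      using p unfolding weak_deriv_def by blast
    moreover have "integrable lborel (\<lambda>x. c1 * x * deriv p x)" "integrable lborel (\<lambda>x. H2 x * deriv p x)"
      using p by (auto intro!: li H2 test_fun_deriv continuous_intros)
    ultimately show ?thesis using c1[rule_format, OF p] by (simp add: H1_def distrib_right)
  qed
  obtain c0 where "AE x in lborel. H1 x = c0"
    by (rule du_Bois_Reymond[OF locally_integrable_continuous[OF H1] z1])
  then have "AE x in lborel. H1 x - c0 = 0" by simp
  then have e: "H1 x - c0 = 0" for x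
    by (rule continuous_AE_zero_imp_zero[rotated]) (intro continuous_intros H1)
  have "H x = c0 + (- c1) * x + c2 / 2 * x\<^sup>2" for x
    using e[of x] unfolding H1_def H2_def by linarith
  then show ?thesis by blast
qed

section \<open>One-dimensional Sobolev inequalities\<close>

lemma set_integrable_const_Icc: "set_integrable lborel {a..b} (\<lambda>_. c :: real)" for a b :: real
  by (rule locally_integrableD(2)[OF locally_integrable_continuous]) simp

text \<open>Fubini: a point t lies in the window [x, x+h] precisely for x in [t-h, t], a set of
  length h.\<close>

lemma window_integrable:
  fixes k :: "real \<Rightarrow> real"
  assumes k: "integrable lborel k" and h: "h \<ge> 0"
  shows "integrable lborel (\<lambda>x. LINT t:{x..x + h}|lborel. k t)"
    and "(LINT x|lborel. (LINT t:{x..x + h}|lborel. k t)) = h * (LINT t|lborel. k t)"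
proof -
  have [measurable]: "k \<in> borel_measurable borel" using k by auto
  define D where "D = (\<lambda>t x. k t * of_bool (x \<le> t \<and> t \<le> x + h) :: real)"
  have D1: "D t = (\<lambda>x. k t * indicator {t - h..t} x)" for t
    by (auto simp: D_def fun_eq_iff indicator_def)
  have i1: "(LINT x|lborel. D t x) = h * k t" "(LINT x|lborel. \<bar>D t x\<bar>) = h * \<bar>k t\<bar>" for t
    using h by (simp_all add: D1 abs_mult)
  have D2: "(LINT t|lborel. D t x) = (LINT t:{x..x + h}|lborel. k t)" for x
    unfolding set_lebesgue_integral_def
    by (intro Bochner_Integration.integral_cong) (auto simp: D_def indicator_def)
  have int: "integrable (lborel \<Otimes>\<^sub>M lborel) (case_prod D)"
  proof (rule lborel_pair.Fubini_integrable)
    show "case_prod D \<in> borel_measurable (lborel \<Otimes>\<^sub>M lborel)"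
      unfolding D_def by measurable
    show "integrable lborel (\<lambda>x. LINT y|lborel. norm (case (x, y) of (x, xa) \<Rightarrow> D x xa))"
      using k by (simp add: i1)
    show "AE x in lborel. integrable lborel (\<lambda>y. case (x, y) of (x, xa) \<Rightarrow> D x xa)"
      using set_integrable_const_Icc[of "_ - h" _ 1]
      by (simp add: D1 set_integrable_def)
  qed
  show "integrable lborel (\<lambda>x. LINT t:{x..x + h}|lborel. k t)"
    using lborel_pair.integrable_snd[OF int] by (simp add: D2)
  show "(LINT x|lborel. (LINT t:{x..x + h}|lborel. k t)) = h * (LINT t|lborel. k t)"
    using lborel_pair.Fubini_integral[OF int] by (simp add: D2 i1)
qed

lemma L2_set_integrable:
  assumes "L2 f" "A \<in> sets borel"
  shows "set_integrable lborel A (\<lambda>x. (f x)\<^sup>2)"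
  using integrable_mult_indicator[of A lborel "\<lambda>x. (f x)\<^sup>2"] assms(2) L2D(2)[OF assms(1)]
  by (simp add: set_integrable_def)

text \<open>Cauchy--Schwarz in its variance form: the integral of (g - c)^2 is nonnegative, where c
  is the mean of g over the interval.\<close>

lemma set_integral_square_le:
  assumes g: "L2 g" and h: "x \<le> y"
  shows "(LINT t:{x..y}|lborel. g t)\<^sup>2 \<le> (y - x) * (LINT t:{x..y}|lborel. (g t)\<^sup>2)"
proof (cases "x = y")
  case True
  have "AE t in lborel. indicator {x..y} t *\<^sub>R g t = 0"
    using AE_lborel_singleton[of x] by eventually_elim (use True in auto)
  then have "(LINT t:{x..y}|lborel. g t) = 0"
    unfolding set_lebesgue_integral_def by (rule integral_eq_zero_AE)
  then show ?thesis using True by simp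
next
  case False
  define I where "I = (LINT t:{x..y}|lborel. g t)"
  define c where "c = I / (y - x)"
  have pos: "y - x > 0" using False h by simp
  have s1: "set_integrable lborel {x..y} g"
    by (rule locally_integrableD(2)[OF L2_locally_integrable[OF g]])
  have s2: "set_integrable lborel {x..y} (\<lambda>t. (g t)\<^sup>2)" by (rule L2_set_integrable[OF g]) simp
  have s3: "set_integrable lborel {x..y} (\<lambda>t. c\<^sup>2 :: real)"
    by (rule set_integrable_const_Icc)
  have s4: "set_integrable lborel {x..y} (\<lambda>t. 2 * c * g t)" using s1 by simp
  have "0 \<le> (LINT t:{x..y}|lborel. (g t - c)\<^sup>2)"
    unfolding set_lebesgue_integral_def by (rule Bochner_Integration.integral_nonneg) simp
  also have "(LINT t:{x..y}|lborel. (g t - c)\<^sup>2) = (LINT t:{x..y}|lborel. (g t)\<^sup>2 - 2 * c * g t + c\<^sup>2)"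
    by (simp add: power2_diff algebra_simps)
  also have "\<dots> = (LINT t:{x..y}|lborel. (g t)\<^sup>2) - 2 * c * I + (LINT t:{x..y}|lborel. c\<^sup>2)"
    using s1 s2 s3 s4 by (simp add: set_integral_add set_integral_diff I_def)
  also have "(LINT t:{x..y}|lborel. c\<^sup>2) = c\<^sup>2 * (y - x)"
    using h by (simp add: set_lebesgue_integral_def)
  finally have "0 \<le> (y - x) * ((LINT t:{x..y}|lborel. (g t)\<^sup>2) - 2 * c * I + c\<^sup>2 * (y - x))"
    using pos by simp
  also have "\<dots> = (y - x) * (LINT t:{x..y}|lborel. (g t)\<^sup>2) - I\<^sup>2"
  proof -
    have cI: "c * (y - x) = I" using pos by (simp add: c_def)
    have "(y - x) * (G - 2 * c * I + c\<^sup>2 * (y - x)) = (y - x) * G - 2 * (c * (y - x)) * I + (c * (y - x))\<^sup>2" for G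
      by (simp add: power2_eq_square algebra_simps)
    then show ?thesis unfolding cI by (simp add: power2_eq_square)
  qed
  finally show ?thesis by (simp add: I_def)
qed

lemma primitive_measurable:
  "locally_integrable f \<Longrightarrow> primitive F f \<Longrightarrow> F \<in> borel_measurable borel"
  by (intro borel_measurable_continuous_onI primitive_continuous)

text \<open>Difference quotients are averages of the derivative, so Jensen's inequality applies.\<close>

lemma difference_quotient_L2:
  assumes g: "L2 g" and F: "primitive F g" and h: "h > 0"
  shows "L2 (\<lambda>x. (F (x + h) - F x) / h)"
    and "(LINT x|lborel. ((F (x + h) - F x) / h)\<^sup>2) \<le> (LINT x|lborel. (g x)\<^sup>2)"
proof -
  let ?Q = "\<lambda>x. (F (x + h) - F x) / h"
  note [measurable] = primitive_measurable[OF L2_locally_integrable[OF g] F]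
  have le: "(?Q x)\<^sup>2 \<le> (LINT t:{x..x + h}|lborel. (g t)\<^sup>2) / h" for x
  proof -
    have "F (x + h) - F x = (LINT t:{x..x + h}|lborel. g t)"
      using F h unfolding primitive_def by simp
    then have "(F (x + h) - F x)\<^sup>2 \<le> h * (LINT t:{x..x + h}|lborel. (g t)\<^sup>2)"
      using set_integral_square_le[OF g, of x "x + h"] h by simp
    then have "(F (x + h) - F x)\<^sup>2 / h\<^sup>2 \<le> h * (LINT t:{x..x + h}|lborel. (g t)\<^sup>2) / h\<^sup>2"
      by (rule divide_right_mono) simp
    then show ?thesis using h by (simp add: power_divide power2_eq_square)
  qed
  note W = window_integrable[OF L2D(2)[OF g], of h]
  have Wi: "integrable lborel (\<lambda>x. (LINT t:{x..x + h}|lborel. (g t)\<^sup>2) / h)" using W h by simp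
  have i: "integrable lborel (\<lambda>x. (?Q x)\<^sup>2)"
  proof (rule Bochner_Integration.integrable_bound[OF Wi])
    show "AE x in lborel. norm ((?Q x)\<^sup>2) \<le> norm ((LINT t:{x..x + h}|lborel. (g t)\<^sup>2) / h)"
    proof (rule AE_I2)
      fix x show "norm ((?Q x)\<^sup>2) \<le> norm ((LINT t:{x..x + h}|lborel. (g t)\<^sup>2) / h)"
        using order_trans[OF le abs_ge_self] by simp
    qed
  qed simp
  then show "L2 ?Q" by (simp add: L2_def)
  have "(LINT x|lborel. (?Q x)\<^sup>2) \<le> (LINT x|lborel. (LINT t:{x..x + h}|lborel. (g t)\<^sup>2) / h)"
    by (rule integral_mono[OF i Wi le])
  then show "(LINT x|lborel. (?Q x)\<^sup>2) \<le> (LINT x|lborel. (g x)\<^sup>2)"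
    using W h by simp
qed

text \<open>The first component is the continuous representative, so its point values are
  meaningful; the second is only a square-integrable function. Carrying both avoids the choice
  hidden in \<open>wderiv\<close>.\<close>

definition H1_pair :: "(real \<Rightarrow> real) \<Rightarrow> (real \<Rightarrow> real) \<Rightarrow> bool" where
  "H1_pair f g \<longleftrightarrow> L2 f \<and> L2 g \<and> primitive f g"

lemma H1_pairD:
  assumes "H1_pair f g"
  shows "L2 f" "L2 g" "primitive f g" "continuous_on UNIV f" "weak_deriv f g"
proof -
  show 1: "L2 f" "L2 g" "primitive f g" using assms by (auto simp: H1_pair_def)
  show "continuous_on UNIV f"
    by (rule primitive_continuous[OF L2_locally_integrable]) (fact 1)+
  show "weak_deriv f g"
    unfolding weak_deriv_def
    by (intro allI impI primitive_integral_by_parts[OF L2_locally_integrable[OF 1(2)] 1(3)])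
qed

lemma H1_pair_DERIV:
  assumes "L2 f" "L2 g" "continuous_on UNIV g" "\<And>x. (f has_real_derivative g x) (at x)"
  shows "H1_pair f g"
  unfolding H1_pair_def using assms primitive_DERIV by blast

lemma H1_pair_square_increment:
  assumes "H1_pair f g" "x \<le> y"
  shows "(f y - f x)\<^sup>2 \<le> (y - x) * (LINT t:{x..y}|lborel. (g t)\<^sup>2)"
  using set_integral_square_le[OF H1_pairD(2)[OF assms(1)] assms(2)] H1_pairD(3)[OF assms(1)] assms(2)
  by (simp add: primitive_def)

lemma set_integral_square_mono:
  assumes "L2 g" "A \<subseteq> B" "A \<in> sets borel" "B \<in> sets borel"
  shows "(LINT t:A|lborel. (g t)\<^sup>2) \<le> (LINT t:B|lborel. (g t)\<^sup>2)"
  unfolding set_lebesgue_integral_def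
proof (rule integral_mono)
  show "integrable lborel (\<lambda>t. indicator A t *\<^sub>R (g t)\<^sup>2)" "integrable lborel (\<lambda>t. indicator B t *\<^sub>R (g t)\<^sup>2)"
    using L2_set_integrable[OF assms(1)] assms(3,4) by (simp_all add: set_integrable_def)
  show "indicator A t *\<^sub>R (g t)\<^sup>2 \<le> indicator B t *\<^sub>R (g t)\<^sup>2" for t
    using assms(2) by (auto simp: indicator_def)
qed

text \<open>The modulus of continuity depends on \<open>f\<close> only through the norm of its
  derivative; this is the equicontinuity fed to the compactness argument.\<close>

lemma H1_pair_Holder:
  assumes "H1_pair f g"
  shows "(f y - f x)\<^sup>2 \<le> \<bar>y - x\<bar> * (LINT t|lborel. (g t)\<^sup>2)"
proof -
  have *: "(f y - f x)\<^sup>2 \<le> \<bar>y - x\<bar> * (LINT t|lborel. (g t)\<^sup>2)" if "x \<le> y" for x y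
  proof -
    have "(LINT t:{x..y}|lborel. (g t)\<^sup>2) \<le> (LINT t:UNIV|lborel. (g t)\<^sup>2)"
      by (rule set_integral_square_mono[OF H1_pairD(2)[OF assms]]) auto
    then have "(y - x) * (LINT t:{x..y}|lborel. (g t)\<^sup>2) \<le> (y - x) * (LINT t|lborel. (g t)\<^sup>2)"
      using that by (intro mult_left_mono) (auto simp: set_lebesgue_integral_def)
    then show ?thesis using H1_pair_square_increment[OF assms that] that by simp
  qed
  show ?thesis
    using *[of x y] *[of y x] by (cases "x \<le> y") (auto simp: power2_commute abs_minus_commute)
qed

text \<open>The elementary bound f(x)^2 \<le> 2 f(y)^2 + 2 (f(y) - f(x))^2 is averaged over y in
  [x, x+1]. Keeping the integrals on this window yields both the global sup bound and, as the window
  moves off to infinity, decay of f.\<close>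

lemma H1_pair_pointwise_bound:
  assumes H: "H1_pair f g"
  shows "(f x)\<^sup>2 \<le> 2 * (LINT t:{x..x + 1}|lborel. (f t)\<^sup>2) + 2 * (LINT t:{x..x + 1}|lborel. (g t)\<^sup>2)"
proof -
  define G where "G = (LINT t:{x..x + 1}|lborel. (g t)\<^sup>2)"
  have "(f x)\<^sup>2 \<le> 2 * (f y)\<^sup>2 + 2 * G" if "y \<in> {x..x + 1}" for y
  proof -
    have "(LINT t:{x..y}|lborel. (g t)\<^sup>2) \<le> G"
      unfolding G_def using that by (intro set_integral_square_mono H1_pairD(2)[OF H]) auto
    moreover have "0 \<le> (LINT t:{x..y}|lborel. (g t)\<^sup>2)"
      unfolding set_lebesgue_integral_def by (rule Bochner_Integration.integral_nonneg) simp
    ultimately have "(y - x) * (LINT t:{x..y}|lborel. (g t)\<^sup>2) \<le> 1 * G"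
      using that by (intro mult_mono) auto
    then have "(f y - f x)\<^sup>2 \<le> G"
      using H1_pair_square_increment[OF H, of x y] that by auto
    moreover have "(f x)\<^sup>2 \<le> 2 * (f y)\<^sup>2 + 2 * (f y - f x)\<^sup>2"
    proof -
      have "2 * (f y)\<^sup>2 + 2 * (f y - f x)\<^sup>2 - (f x)\<^sup>2 = (2 * f y - f x)\<^sup>2"
        by (simp add: power2_eq_square algebra_simps)
      moreover have "0 \<le> (2 * f y - f x)\<^sup>2" by simp
      ultimately show ?thesis by linarith
    qed
    ultimately show ?thesis by linarith
  qed
  then have "(LINT t:{x..x + 1}|lborel. (f x)\<^sup>2) \<le> (LINT t:{x..x + 1}|lborel. 2 * (f t)\<^sup>2 + 2 * G)"
    using L2_set_integrable[OF H1_pairD(1)[OF H], of "{x..x + 1}"]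
    by (intro set_integral_mono set_integral_add(1) set_integrable_const_Icc set_integrable_mult_right) auto
  also have "\<dots> = (LINT t:{x..x + 1}|lborel. 2 * (f t)\<^sup>2) + (LINT t:{x..x + 1}|lborel. 2 * G)"
    using L2_set_integrable[OF H1_pairD(1)[OF H], of "{x..x + 1}"]
    by (intro set_integral_add set_integrable_const_Icc set_integrable_mult_right) auto
  finally show ?thesis
    by (simp add: set_lebesgue_integral_def G_def)
qed

lemma H1_pair_sup_bound:
  assumes H: "H1_pair f g"
  shows "(f x)\<^sup>2 \<le> 2 * (LINT t|lborel. (f t)\<^sup>2) + 2 * (LINT t|lborel. (g t)\<^sup>2)"
proof -
  have "(LINT t:{x..x + 1}|lborel. (f t)\<^sup>2) \<le> (LINT t:UNIV|lborel. (f t)\<^sup>2)"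
    "(LINT t:{x..x + 1}|lborel. (g t)\<^sup>2) \<le> (LINT t:UNIV|lborel. (g t)\<^sup>2)"
    by (intro set_integral_square_mono H1_pairD[OF H]; simp)+
  then show ?thesis using H1_pair_pointwise_bound[OF H, of x]
    by (simp add: set_lebesgue_integral_def)
qed

text \<open>The map \<open>a\<close> that positions the window lets one dominated convergence
  argument serve both ends of the line.\<close>

lemma window_tendsto_0:
  assumes k: "integrable lborel (k :: real \<Rightarrow> real)" and l: "(LIM x at_top. (a :: real \<Rightarrow> real) x :> at_top) \<or> (LIM x at_top. a x :> at_bot)"
  shows "((\<lambda>x. LINT t:{a x..a x + 1}|lborel. k t) \<longlongrightarrow> 0) at_top"
proof -
  have [measurable]: "k \<in> borel_measurable borel" using k by auto
  have "((\<lambda>x. LINT t|lborel. indicator {a x..a x + 1} t *\<^sub>R k t) \<longlongrightarrow> (LINT t|(lborel :: real measure). (0 :: real))) at_top"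
  proof (rule integral_dominated_convergence_at_top[where w = "\<lambda>t. \<bar>k t\<bar>"])
    show "AE t in lborel. ((\<lambda>x. indicator {a x..a x + 1} t *\<^sub>R k t) \<longlongrightarrow> 0) at_top"
    proof (rule AE_I2, rule tendsto_eventually)
      fix t :: real
      have "eventually (\<lambda>x. t \<notin> {a x..a x + 1}) at_top"
        using l
      proof
        assume "LIM x at_top. a x :> at_top"
        then have "eventually (\<lambda>x. a x > t) at_top" by (simp add: filterlim_at_top_dense)
        then show ?thesis by eventually_elim auto
      next
        assume "LIM x at_top. a x :> at_bot"
        then have "eventually (\<lambda>x. a x < t - 1) at_top" by (simp add: filterlim_at_bot_dense)
        then show ?thesis by eventually_elim auto
      qed
      then show "eventually (\<lambda>x. indicator {a x..a x + 1} t *\<^sub>R k t = 0) at_top"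
        by eventually_elim auto
    qed
    show "integrable lborel (\<lambda>t. \<bar>k t\<bar>)" using k by (rule integrable_abs)
    show "\<forall>\<^sub>F i in at_top. AE x in lborel. norm (indicator {a i..a i + 1} x *\<^sub>R k x) \<le> \<bar>k x\<bar>"
      by (intro always_eventually allI AE_I2) (auto simp: indicator_def)
  qed auto
  then show ?thesis by (simp add: set_lebesgue_integral_def)
qed

lemma H1_pair_tendsto_0:
  assumes H: "H1_pair f g"
  shows "(f \<longlongrightarrow> 0) at_top" "(f \<longlongrightarrow> 0) at_bot"
proof -
  have *: "((\<lambda>x. f (a x)) \<longlongrightarrow> 0) at_top"
    if l: "(LIM x at_top. a x :> at_top) \<or> (LIM x at_top. a x :> at_bot)" for a :: "real \<Rightarrow> real"
  proof -
    let ?b = "\<lambda>x. 2 * (LINT t:{a x..a x + 1}|lborel. (f t)\<^sup>2) + 2 * (LINT t:{a x..a x + 1}|lborel. (g t)\<^sup>2)"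
    have "(?b \<longlongrightarrow> 2 * 0 + 2 * 0) at_top"
      by (intro tendsto_intros window_tendsto_0 L2D H1_pairD[OF H] l)
    then have b: "(?b \<longlongrightarrow> 0) at_top" by (simp only: mult_zero_right add_0)
    have "((\<lambda>x. (f (a x))\<^sup>2) \<longlongrightarrow> 0) at_top"
    proof (rule tendsto_sandwich[OF _ _ tendsto_const b])
      show "\<forall>\<^sub>F x in at_top. 0 \<le> (f (a x))\<^sup>2" by simp
      show "\<forall>\<^sub>F x in at_top. (f (a x))\<^sup>2 \<le> ?b x"
        by (intro always_eventually allI H1_pair_pointwise_bound[OF H])
    qed
    then have "((\<lambda>x. sqrt ((f (a x))\<^sup>2)) \<longlongrightarrow> sqrt 0) at_top" by (rule tendsto_real_sqrt)
    then show ?thesis by (simp add: tendsto_rabs_zero_iff)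
  qed
  show "(f \<longlongrightarrow> 0) at_top" using *[of "\<lambda>x. x"] by (simp add: filterlim_ident)
  show "(f \<longlongrightarrow> 0) at_bot"
    using *[of uminus] by (simp add: filterlim_at_bot_mirror[of f] filterlim_uminus_at_bot_at_top)
qed

text \<open>Fatou's lemma. Only an inequality can survive the limit, because part of the mass may
  drift to infinity.\<close>

lemma L2_liminf:
  assumes f: "\<And>n. L2 (f n)" and g: "continuous_on UNIV g" and lim: "\<And>x. (\<lambda>n. f n x) \<longlonglongrightarrow> g x"
    and b: "\<And>n. (LINT x|lborel. (f n x)\<^sup>2) \<le> C"
  shows "L2 g" "(LINT x|lborel. (g x)\<^sup>2) \<le> C"
proof -
  have [measurable]: "g \<in> borel_measurable borel" "f n \<in> borel_measurable borel" for n
    using g L2D(1)[OF f] by (auto intro: borel_measurable_continuous_onI)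
  have "(\<integral>\<^sup>+x. ennreal ((g x)\<^sup>2) \<partial>lborel) = (\<integral>\<^sup>+x. liminf (\<lambda>n. ennreal ((f n x)\<^sup>2)) \<partial>lborel)"
  proof (rule nn_integral_cong)
    fix x
    have "(\<lambda>n. ennreal ((f n x)\<^sup>2)) \<longlonglongrightarrow> ennreal ((g x)\<^sup>2)"
      by (intro tendsto_ennrealI tendsto_power lim)
    then show "ennreal ((g x)\<^sup>2) = liminf (\<lambda>n. ennreal ((f n x)\<^sup>2))"
      by (rule lim_imp_Liminf[OF sequentially_bot, symmetric])
  qed
  also have "\<dots> \<le> liminf (\<lambda>n. \<integral>\<^sup>+x. ennreal ((f n x)\<^sup>2) \<partial>lborel)"
    by (rule nn_integral_liminf) simp
  also have "\<dots> \<le> liminf (\<lambda>n. ennreal C)"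
  proof (rule Liminf_mono, rule always_eventually, rule allI)
    fix n
    have "(\<integral>\<^sup>+x. ennreal ((f n x)\<^sup>2) \<partial>lborel) = ennreal (LINT x|lborel. (f n x)\<^sup>2)"
      by (rule nn_integral_eq_integral) (auto simp: L2D(2)[OF f])
    also have "\<dots> \<le> ennreal C" using b by (rule ennreal_leI)
    finally show "(\<integral>\<^sup>+x. ennreal ((f n x)\<^sup>2) \<partial>lborel) \<le> ennreal C" .
  qed
  finally have le: "(\<integral>\<^sup>+x. ennreal ((g x)\<^sup>2) \<partial>lborel) \<le> ennreal C" by (simp add: Liminf_const)
  have int: "integrable lborel (\<lambda>x. (g x)\<^sup>2)"
    by (rule integrableI_bounded) (use le in \<open>auto simp: order_le_less_trans\<close>)
  then show "L2 g" by (simp add: L2_def)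
  have "C \<ge> 0"
    using b[of 0] by (rule order_trans[rotated]) simp
  then show "(LINT x|lborel. (g x)\<^sup>2) \<le> C"
    using le nn_integral_eq_integral[OF int] by simp
qed

text \<open>The derivatives \<open>g n\<close> need not converge pointwise, so Fatou cannot be
  applied to them directly. Difference quotients of \<open>f n\<close> do converge, with a bound
  uniform in both n and h: first n tends to infinity, then h to zero.\<close>

lemma derivative_L2_of_difference_quotients:
  assumes F: "\<And>n. L2 (g n)" "\<And>n. primitive (f n) (g n)" "\<And>n. (LINT x|lborel. (g n x)\<^sup>2) \<le> C"
    and lim: "\<And>x. (\<lambda>n. f n x) \<longlonglongrightarrow> u x"
    and u: "continuous_on UNIV u" "\<And>x. (u has_real_derivative u' x) (at x)" "continuous_on UNIV u'"
  shows "L2 u'"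
proof -
  have q: "L2 (\<lambda>x. (u (x + h) - u x) / h) \<and> (LINT x|lborel. ((u (x + h) - u x) / h)\<^sup>2) \<le> C" if h: "h > 0" for h
  proof -
    let ?f = "\<lambda>n x. (f n (x + h) - f n x) / h"
    have 1: "L2 (?f n)" "(LINT x|lborel. (?f n x)\<^sup>2) \<le> C" for n
      using difference_quotient_L2[OF F(1,2) h, of n] F(3)[of n] by auto
    have 2: "continuous_on UNIV (\<lambda>x. (u (x + h) - u x) / h)"
      using h by (intro continuous_intros continuous_on_compose2[OF u(1)]) auto
    have 3: "(\<lambda>n. ?f n x) \<longlonglongrightarrow> (u (x + h) - u x) / h" for x
      using h by (intro tendsto_intros lim) auto
    show ?thesis using L2_liminf[of ?f, OF 1(1) 2 3 1(2)] by simp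
  qed
  define h where "h = (\<lambda>n. inverse (real (Suc n)))"
  show ?thesis
  proof (rule L2_liminf(1)[of "\<lambda>n x. (u (x + h n) - u x) / h n" u' C])
    show "L2 (\<lambda>x. (u (x + h n) - u x) / h n)" "(LINT x|lborel. ((u (x + h n) - u x) / h n)\<^sup>2) \<le> C" for n
      using q[of "h n"] by (simp_all add: h_def)
    show "(\<lambda>n. (u (x + h n) - u x) / h n) \<longlonglongrightarrow> u' x" for x
    proof -
      have "((\<lambda>h. (u (x + h) - u x) / h) \<longlongrightarrow> u' x) (at 0)"
        using u(2)[of x] by (simp add: DERIV_def)
      moreover have "filterlim h (at 0) sequentially"
        unfolding filterlim_at h_def using LIMSEQ_inverse_real_of_nat by auto
      ultimately show ?thesis by (rule filterlim_compose)
    qed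
  qed (fact u(3))
qed

text \<open>By the mean value theorem \<open>u1\<close> equals u(x+1) - u(x) at some z in the unit
  window, and the change of \<open>u1\<close> from z to x is controlled by \<open>u2\<close> on that
  window. Squaring and integrating in x finishes the proof.\<close>

lemma L2_interpolation:
  assumes u: "L2 u" "L2 u2" "continuous_on UNIV u2"
    and d: "\<And>x. (u has_real_derivative u1 x) (at x)" "\<And>x. (u1 has_real_derivative u2 x) (at x)"
  shows "L2 u1"
proof -
  have m[measurable]: "u1 \<in> borel_measurable borel"
    using d(2) by (intro borel_measurable_continuous_onI) (auto intro!: DERIV_isCont simp: continuous_on_eq_continuous_at)
  define W where "W = (\<lambda>x. LINT t:{x..x + 1}|lborel. (u2 t)\<^sup>2)"
  have P: "primitive u1 u2" by (rule primitive_DERIV[OF u(3) d(2)])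
  have le: "(u1 x)\<^sup>2 \<le> 3 * (u (x + 1))\<^sup>2 + 3 * (u x)\<^sup>2 + 3 * W x" for x
  proof -
    obtain z where z: "z > x" "z < x + 1" "u (x + 1) - u x = (x + 1 - x) * u1 z"
      using MVT2[of x "x + 1" u u1] d(1) by auto
    have "(LINT t:{x..z}|lborel. (u2 t)\<^sup>2) \<le> W x"
      unfolding W_def using z by (intro set_integral_square_mono u) auto
    moreover have "0 \<le> (LINT t:{x..z}|lborel. (u2 t)\<^sup>2)"
      unfolding set_lebesgue_integral_def by (rule Bochner_Integration.integral_nonneg) simp
    ultimately have "(z - x) * (LINT t:{x..z}|lborel. (u2 t)\<^sup>2) \<le> 1 * W x"
      using z by (intro mult_mono) auto
    moreover have "(u1 z - u1 x)\<^sup>2 \<le> (z - x) * (LINT t:{x..z}|lborel. (u2 t)\<^sup>2)"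
      using set_integral_square_le[OF u(2), of x z] P z by (simp add: primitive_def)
    ultimately have "(u1 z - u1 x)\<^sup>2 \<le> W x" by simp
    moreover have "(u1 x)\<^sup>2 \<le> 3 * (u (x + 1))\<^sup>2 + 3 * (u x)\<^sup>2 + 3 * (u1 z - u1 x)\<^sup>2"
    proof -
      have e: "u1 x = u (x + 1) - u x - (u1 z - u1 x)" using z(3) by simp
      have "(a - b - c)\<^sup>2 \<le> 3 * a\<^sup>2 + 3 * b\<^sup>2 + 3 * c\<^sup>2" for a b c :: real
      proof -
        have "3 * a\<^sup>2 + 3 * b\<^sup>2 + 3 * c\<^sup>2 - (a - b - c)\<^sup>2 = (a + b)\<^sup>2 + (a + c)\<^sup>2 + (b - c)\<^sup>2"
          by (simp add: power2_eq_square algebra_simps)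
        moreover have "0 \<le> (a + b)\<^sup>2 + (a + c)\<^sup>2 + (b - c)\<^sup>2" by simp
        ultimately show ?thesis by linarith
      qed
      from this[of "u (x + 1)" "u x" "u1 z - u1 x"] show ?thesis using e by metis
    qed
    ultimately show ?thesis by linarith
  qed
  have "integrable lborel (\<lambda>x. 3 * (u (x + 1))\<^sup>2 + 3 * (u x)\<^sup>2 + 3 * W x)"
    unfolding W_def
    by (intro Bochner_Integration.integrable_add integrable_mult_right L2D(2)[OF L2_translate] L2D(2) window_integrable u) simp
  then have "integrable lborel (\<lambda>x. (u1 x)\<^sup>2)"
    by (rule Bochner_Integration.integrable_bound)
       (auto simp: le intro!: AE_I2 order_trans[OF le abs_ge_self])
  then show ?thesis by (simp add: L2_def)
qed

section \<open>Growth-rate threshold and compactness\<close>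

text \<open>The growth rate is the largest \<open>s\<close> up to which the energy \<open>s\<^sup>2 X + s Y + Z - B\<close> can be negative.\<close>

lemma threshold_exists:
  fixes X Y Z B :: "'v \<Rightarrow> real"
  assumes scale: "\<And>v t. v \<in> V \<Longrightarrow> \<exists>v'\<in>V. X v' = t\<^sup>2 * X v \<and> Y v' = t\<^sup>2 * Y v \<and> Z v' = t\<^sup>2 * Z v \<and> B v' = t\<^sup>2 * B v"
    and nonneg: "\<And>v. v \<in> V \<Longrightarrow> 0 \<le> X v" "\<And>v. v \<in> V \<Longrightarrow> 0 \<le> Y v" "\<And>v. v \<in> V \<Longrightarrow> 0 \<le> Z v"
    and bound: "\<And>v. v \<in> V \<Longrightarrow> B v \<le> K * Y v"
    and v0: "v0 \<in> V" "Z v0 < B v0"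
  shows "\<exists>s>0. \<exists>C. \<exists>u :: nat \<Rightarrow> 'v. (\<forall>v\<in>V. B v \<le> s\<^sup>2 * X v + s * Y v + Z v) \<and>
    (\<forall>n. u n \<in> V \<and> B (u n) = 1 \<and> X (u n) \<le> C \<and> Y (u n) \<le> C) \<and>
    (\<lambda>n. s\<^sup>2 * X (u n) + s * Y (u n) + Z (u n)) \<longlonglongrightarrow> 1"
proof -
  define P where "P = (\<lambda>s v. s\<^sup>2 * X v + s * Y v + Z v)"
  define T where "T = {s. s > 0 \<and> (\<exists>v\<in>V. P s v < B v)}"
  have "T \<noteq> {}"
  proof -
    \<comment> \<open>\<open>d\<close> is the gap available at s = 0. The choice of \<open>s\<close>
      spends at most half of it, and s \<le> 1 allows s^2 to be replaced by s.\<close>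
    define d where "d = B v0 - Z v0"
    define s where "s = min 1 (d / (2 * (X v0 + Y v0 + 1)))"
    have pos: "X v0 + Y v0 + 1 > 0" "d > 0"
      using nonneg[OF v0(1)] v0 by (auto simp: d_def)
    then have s: "s > 0" "s \<le> 1" by (auto simp: s_def)
    have "s\<^sup>2 * X v0 \<le> s * X v0"
      using s nonneg(1)[OF v0(1)] by (intro mult_right_mono) (auto simp: power2_eq_square mult_left_le)
    then have "s\<^sup>2 * X v0 + s * Y v0 \<le> s * (X v0 + Y v0 + 1)"
      using s by (simp add: distrib_left)
    also have "\<dots> \<le> d / (2 * (X v0 + Y v0 + 1)) * (X v0 + Y v0 + 1)"
      using pos by (intro mult_right_mono) (auto simp: s_def)
    also have "\<dots> = d / 2"
    proof -
      have "d / (2 * N) * N = d / 2" if "N > 0" for N using that by simp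
      then show ?thesis using pos(1) .
    qed
    also have "\<dots> < d" using pos by simp
    finally have "P s v0 < B v0" by (simp add: P_def d_def)
    then show ?thesis using s v0 by (auto simp: T_def)
  qed
  \<comment> \<open>Negativity at s gives s Y < B \<le> K Y, so large values of s are
    excluded.\<close>
  have TK: "s \<le> K" if sT: "s \<in> T" for s
  proof -
    obtain v where v: "v \<in> V" "P s v < B v" "s > 0" using sT by (auto simp: T_def)
    have "0 \<le> s\<^sup>2 * X v" "0 \<le> s * Y v" using nonneg[OF v(1)] v(3) by auto
    then have "s * Y v < K * Y v"
      using v(2) bound[OF v(1)] nonneg(3)[OF v(1)] unfolding P_def by linarith
    then show ?thesis using nonneg(2)[OF v(1)] by (auto simp: mult_less_cancel_right)
  qed
  then have bdd: "bdd_above T" by (auto simp: bdd_above_def)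
  define S where "S = Sup T"
  have le_S: "s \<le> S" if "s \<in> T" for s
    unfolding S_def using that bdd by (rule cSup_upper)
  have S: "S > 0"
  proof -
    obtain s where "s \<in> T" using \<open>T \<noteq> {}\<close> by blast
    then show ?thesis using le_S[of s] by (auto simp: T_def)
  qed
  \<comment> \<open>Negativity at the supremum would persist slightly to its right, by continuity in
    s.\<close>
  have A: "B v \<le> P S v" if "v \<in> V" for v
  proof (rule ccontr)
    assume "\<not> B v \<le> P S v"
    then have "P S v < B v" by simp
    moreover have "((\<lambda>s. P s v) \<longlongrightarrow> P S v) (at_right S)"
      unfolding P_def by (intro tendsto_intros)
    ultimately have "eventually (\<lambda>s. P s v < B v) (at_right S)"
      by (rule order_tendstoD(2)[rotated])
    moreover have "eventually (\<lambda>s. s > S) (at_right S)"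
      by (rule eventually_at_right_less)
    ultimately have "eventually (\<lambda>s. P s v < B v \<and> s > S) (at_right S)"
      by eventually_elim auto
    then obtain s where "P s v < B v" "s > S"
      using eventually_happens trivial_limit_at_right_real by blast
    then have "s \<in> T" using that S by (auto simp: T_def)
    then show False using le_S \<open>s > S\<close> by fastforce
  qed
  \<comment> \<open>At \<open>S\<close> no element has negative energy, so near-minimizers are taken
    from parameters s in \<open>T\<close> just below \<open>S\<close> and rescaled to
    \<open>B\<close> = 1.\<close>
  have "\<exists>v. v \<in> V \<and> B v = 1 \<and> X v \<le> 4 / S\<^sup>2 \<and> Y v \<le> 2 / S \<and> P S v \<le> 1 + 10 * inverse (real (Suc n))" for n :: nat
  proof -
    define e where "e = inverse (real (Suc n)) / 2"
    have e: "0 < e" "e \<le> 1 / 2" "2 * e = inverse (real (Suc n))" by (auto simp: e_def divide_simps)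
    have "S - S * e < S" using S e by simp
    then obtain s where s: "s \<in> T" "S - S * e < s"
      using less_cSup_iff[OF \<open>T \<noteq> {}\<close> bdd] unfolding S_def by blast
    have "S * e \<le> S * (1 / 2)" using S e by (intro mult_left_mono) auto
    then have "S / 2 \<le> s" using s(2) by linarith
    then have s2: "S / 2 \<le> s" "s \<le> S" "s > 0" using S le_S[OF s(1)] by auto
    obtain v where v: "v \<in> V" "P s v < B v" using s by (auto simp: T_def)
    have "0 \<le> P s v" using nonneg[OF v(1)] s2 by (simp add: P_def)
    then have Bpos: "B v > 0" using v by simp
    obtain u where u: "u \<in> V" "X u = (1 / sqrt (B v))\<^sup>2 * X v" "Y u = (1 / sqrt (B v))\<^sup>2 * Y v"
      "Z u = (1 / sqrt (B v))\<^sup>2 * Z v" "B u = (1 / sqrt (B v))\<^sup>2 * B v"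
      using scale[OF v(1)] by blast
    have u': "X u = X v / B v" "Y u = Y v / B v" "Z u = Z v / B v" "B u = 1"
      using u Bpos by (auto simp: power_divide)
    have "P s u = P s v / B v" by (simp add: P_def u' add_divide_distrib)
    then have Ps: "P s u < 1" using v Bpos by simp
    note nn = nonneg[OF u(1)]
    have nn': "0 \<le> s\<^sup>2 * X u" "0 \<le> s * Y u" using nn s2 by auto
    have "s\<^sup>2 * X u \<le> 1" "s * Y u \<le> 1" using Ps nn' nn(3) unfolding P_def by linarith+
    moreover have "(S / 2)\<^sup>2 * X u \<le> s\<^sup>2 * X u" "S / 2 * Y u \<le> s * Y u"
      using s2 S by (intro mult_right_mono power_mono nn(1,2); simp)+
    ultimately have "(S / 2)\<^sup>2 * X u \<le> 1" "S / 2 * Y u \<le> 1" by linarith+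
    then have XY: "X u \<le> 4 / S\<^sup>2" "Y u \<le> 2 / S"
      using S by (auto simp: field_simps power_divide)
    \<comment> \<open>Since S/2 \<le> s, the terms s^2 X and s Y, each at most 1, give X \<le> 4/S^2
      and Y \<le> 2/S. Passing from s to S therefore costs at most S e (8/S + 2/S) = 10 e.\<close>
    have "P S u - P s u = (S - s) * ((S + s) * X u + Y u)"
      by (simp add: P_def power2_eq_square algebra_simps)
    also have "\<dots> \<le> (S * e) * ((2 * S) * (4 / S\<^sup>2) + 2 / S)"
      using s s2 S nn XY by (intro mult_mono add_mono) auto
    also have "\<dots> = 10 * e" using S by (simp add: field_simps power2_eq_square)
    finally have "P S u \<le> 1 + 10 * inverse (real (Suc n))" using Ps e by linarith
    then show ?thesis using u(1) u'(4) XY by blast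
  qed
  then obtain u where u: "\<forall>n. u n \<in> V \<and> B (u n) = 1 \<and> X (u n) \<le> 4 / S\<^sup>2 \<and> Y (u n) \<le> 2 / S \<and>
      P S (u n) \<le> 1 + 10 * inverse (real (Suc n))"
    by metis
  have "(\<lambda>n. P S (u n)) \<longlonglongrightarrow> 1"
  proof (rule tendsto_sandwich)
    show "\<forall>\<^sub>F n in sequentially. 1 \<le> P S (u n)"
      using A u by (intro always_eventually allI) metis
    show "\<forall>\<^sub>F n in sequentially. P S (u n) \<le> 1 + 10 * inverse (real (Suc n))"
      using u by (intro always_eventually allI) metis
    have "(\<lambda>n. 1 + 10 * inverse (real (Suc n))) \<longlonglongrightarrow> 1 + 10 * 0"
      by (intro tendsto_intros LIMSEQ_inverse_real_of_nat)
    then show "(\<lambda>n. 1 + 10 * inverse (real (Suc n))) \<longlonglongrightarrow> 1" by simp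
  qed simp
  then show ?thesis
    using S A u unfolding P_def
    by (intro exI[of _ S] exI[of _ "max (4 / S\<^sup>2) (2 / S)"] exI[of _ u] conjI) (auto simp: le_max_iff_disj)
qed

text \<open>Arzela--Ascoli on the whole line: a diagonal sequence converges at every rational, and
  the common Hoelder bound carries convergence to all reals and continuity to the limit.\<close>

lemma pointwise_convergent_subsequence:
  fixes f :: "nat \<Rightarrow> real \<Rightarrow> real"
  assumes bdd: "\<And>n x. \<bar>f n x\<bar> \<le> M" and eq: "\<And>n x y. (f n x - f n y)\<^sup>2 \<le> \<bar>x - y\<bar> * C"
  shows "\<exists>r F. strict_mono r \<and> continuous_on UNIV F \<and> (\<forall>x. (\<lambda>n. f (r n) x) \<longlonglongrightarrow> F x)"
proof -
  define q where "q = (\<lambda>n. real_of_rat (from_nat_into (UNIV :: rat set) n))"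
  let ?P = "\<lambda>n. \<lambda>s. convergent (\<lambda>k. f (s k) (q n))"
  interpret nat: subseqs ?P
  proof
    fix n :: nat and s :: "nat \<Rightarrow> nat" assume s: "strict_mono s"
    have "\<And>k. f (s k) (q n) \<in> {-M..M}"
      using bdd by (simp add: abs_le_iff minus_le_iff)
    then have "\<exists>l s'. strict_mono s' \<and> ((\<lambda>k. f (s k) (q n)) \<circ> s') \<longlonglongrightarrow> l"
      using compact_Icc[of "-M" M] compact_imp_seq_compact seq_compactE by metis
    then show "\<exists>r'. strict_mono r' \<and> convergent (\<lambda>k. f ((s \<circ> r') k) (q n))"
      by (auto simp: comp_def convergent_def)
  qed
  define d where "d = nat.diagseq"
  have sub: "strict_mono d" unfolding d_def by (rule nat.subseq_diagseq)
  have cq: "convergent (\<lambda>k. f (d k) (q n))" for n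
  proof -
    \<comment> \<open>The diagonal sequence is a subsequence of the n-th one only from index n + 1
      on; dropping finitely many terms does not affect convergence.\<close>
    have "?P n (d \<circ> ((+) (Suc n)))"
      unfolding d_def
    proof (rule nat.diagseq_holds)
      fix r s :: "nat \<Rightarrow> nat" and m assume "strict_mono r" "convergent (\<lambda>k. f (s k) (q m))"
      then have "convergent ((\<lambda>k. f (s k) (q m)) \<circ> r)" by (rule convergent_subseq_convergent[rotated])
      then show "convergent (\<lambda>k. f ((s \<circ> r) k) (q m))" by (simp add: comp_def)
    qed
    then have "convergent (\<lambda>k. f (d (k + Suc n)) (q n))" by (simp add: comp_def add.commute)
    then show ?thesis by (rule convergent_ignore_initial_segment[of _ "Suc n", THEN iffD1])
  qed
  have C: "C \<ge> 0" using eq[of 0 1 0] by (auto intro: order_trans[OF zero_le_power2])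
  have "convergent (\<lambda>k. f (d k) x)" for x
  proof (rule Cauchy_convergent, rule metric_CauchyI)
    fix e :: real assume e: "e > 0"
    \<comment> \<open>A rational so close to x that the Hoelder bound is below e/3; dividing by C +
      1 instead of C covers C = 0.\<close>
    obtain y where y: "y \<in> \<rat>" "\<bar>x - y\<bar> * (C + 1) < (e / 3)\<^sup>2"
    proof -
      have "(e / 3)\<^sup>2 / (C + 1) > 0" using e C by simp
      then have "x - (e / 3)\<^sup>2 / (C + 1) < x" by simp
      then obtain y where "y \<in> \<rat>" "x - (e / 3)\<^sup>2 / (C + 1) < y" "y < x"
        using Rats_dense_in_real by blast
      moreover from this have "\<bar>x - y\<bar> < (e / 3)\<^sup>2 / (C + 1)" by auto
      ultimately show ?thesis using C that by (auto simp: field_simps)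
    qed
    obtain n where n: "y = q n"
    proof -
      obtain z where "y = of_rat z" using y(1) by (auto simp: Rats_def)
      then have "y = q (to_nat_on UNIV z)" by (simp add: q_def)
      then show ?thesis by (rule that)
    qed
    have near: "\<bar>f k x - f k y\<bar> < e / 3" for k
    proof -
      have "\<bar>x - y\<bar> * C \<le> \<bar>x - y\<bar> * (C + 1)" by (intro mult_left_mono) auto
      then have "(f k x - f k y)\<^sup>2 < (e / 3)\<^sup>2" using eq[of k x y] y(2) by linarith
      then have "\<bar>f k x - f k y\<bar>\<^sup>2 < (e / 3)\<^sup>2" by simp
      then show ?thesis by (rule power2_less_imp_less) (use e in simp)
    qed
    have "Cauchy (\<lambda>k. f (d k) y)" unfolding n using cq by (rule convergent_Cauchy)
    then obtain N where N: "\<And>i j. i \<ge> N \<Longrightarrow> j \<ge> N \<Longrightarrow> \<bar>f (d i) y - f (d j) y\<bar> < e / 3"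
      using metric_CauchyD[of "\<lambda>k. f (d k) y" "e / 3"] e by (auto simp: dist_real_def)
    have "dist (f (d i) x) (f (d j) x) < e" if "i \<ge> N" "j \<ge> N" for i j
      using N[OF that] near[of "d i"] near[of "d j"] unfolding dist_real_def by linarith
    then show "\<exists>N. \<forall>i\<ge>N. \<forall>j\<ge>N. dist (f (d i) x) (f (d j) x) < e" by blast
  qed
  then obtain F where F: "\<And>x. (\<lambda>k. f (d k) x) \<longlonglongrightarrow> F x"
    unfolding convergent_def by metis
  have "isCont F x" for x
  proof -
    have "(F y - F x)\<^sup>2 \<le> \<bar>y - x\<bar> * C" for y
      by (rule LIMSEQ_le_const2[OF tendsto_power[OF tendsto_diff[OF F F]]]) (use eq in auto)
    then have le: "\<bar>F y - F x\<bar> \<le> sqrt (\<bar>y - x\<bar> * C)" for y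
      by (rule real_le_rsqrt[of "\<bar>F y - F x\<bar>", simplified])
    have "((\<lambda>y. sqrt (\<bar>y - x\<bar> * C)) \<longlongrightarrow> sqrt (\<bar>x - x\<bar> * C)) (at x)"
      by (intro tendsto_intros)
    then have z: "((\<lambda>y. sqrt (\<bar>y - x\<bar> * C)) \<longlongrightarrow> 0) (at x)" by simp
    have "((\<lambda>y. F y - F x) \<longlongrightarrow> 0) (at x)"
      by (rule Lim_null_comparison[OF _ z]) (use le in \<open>auto intro!: always_eventually\<close>)
    then show ?thesis by (simp add: isCont_def Lim_null[of F])
  qed
  then have "continuous_on UNIV F" by (simp add: continuous_at_imp_continuous_on)
  then show ?thesis using sub F by blast
qed

section \<open>The quadratic form on \<open>H\<^sup>2\<close> jets\<close>

text \<open>Elements of \<open>H\<^sup>2\<close> are encoded as jets: \<open>u 0\<close> is the function, \<open>u 1\<close> and \<open>u 2\<close> its derivatives.\<close>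

definition jet :: "(nat \<Rightarrow> real \<Rightarrow> real) \<Rightarrow> bool" where
  "jet u \<longleftrightarrow> H1_pair (u 0) (u 1) \<and> H1_pair (u 1) (u 2)"

definition bounded_weight :: "(nat \<Rightarrow> real \<Rightarrow> real) \<Rightarrow> bool" where
  "bounded_weight c \<longleftrightarrow> (\<forall>i<3. c i \<in> borel_measurable borel \<and> (\<exists>B. \<forall>x. \<bar>c i x\<bar> \<le> B))"

text \<open>A diagonal bilinear form. Inertia, viscosity, magnetic tension and buoyancy are
  instances with different weights, so homogeneity, polarization and Cauchy--Schwarz are proved once
  for all of them.\<close>

definition jet_form :: "(nat \<Rightarrow> real \<Rightarrow> real) \<Rightarrow> (nat \<Rightarrow> real \<Rightarrow> real) \<Rightarrow> (nat \<Rightarrow> real \<Rightarrow> real) \<Rightarrow> real" where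
  "jet_form c u v = (\<Sum>i<3. LINT x|lborel. c i x * u i x * v i x)"

lemma less_3_cases: "i < (3 :: nat) \<Longrightarrow> i = 0 \<or> i = 1 \<or> i = 2"
  by auto

lemma sum_less_3: "(\<Sum>i<3. f i) = f 0 + f 1 + f (2 :: nat)" for f :: "nat \<Rightarrow> real"
  by (simp add: eval_nat_numeral)

lemma jet_L2: "jet u \<Longrightarrow> i < 3 \<Longrightarrow> L2 (u i)"
  using less_3_cases[of i] H1_pairD unfolding jet_def by metis

lemma jet_form_integrable:
  assumes "bounded_weight c" "jet u" "jet v" "i < 3"
  shows "integrable lborel (\<lambda>x. c i x * u i x * v i x)"
proof -
  obtain B where "c i \<in> borel_measurable borel" "\<And>x. \<bar>c i x\<bar> \<le> B"
    using assms(1,4) unfolding bounded_weight_def by blast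
  then show ?thesis using assms by (intro integrable_bounded_mult_L2 jet_L2)
qed

lemma primitive_lincomb:
  assumes "locally_integrable f" "locally_integrable g" "primitive F f" "primitive G g"
  shows "primitive (\<lambda>x. F x + t * G x) (\<lambda>x. f x + t * g x)"
  unfolding primitive_def
proof (intro allI impI)
  fix x y :: real assume "x \<le> y"
  then have "F y = F x + (LINT s:{x..y}|lborel. f s)" "G y = G x + (LINT s:{x..y}|lborel. g s)"
    using assms(3,4) by (auto simp: primitive_def algebra_simps)
  moreover have "(LINT s:{x..y}|lborel. f s + t * g s) = (LINT s:{x..y}|lborel. f s) + t * (LINT s:{x..y}|lborel. g s)"
    using locally_integrableD(2)[OF assms(1)] locally_integrableD(2)[OF assms(2)]
    by (subst set_integral_add) auto
  ultimately show "F y + t * G y - (F x + t * G x) = (LINT s:{x..y}|lborel. f s + t * g s)"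
    by (simp add: algebra_simps)
qed

lemma H1_pair_lincomb:
  assumes "H1_pair f g" "H1_pair f' g'"
  shows "H1_pair (\<lambda>x. f x + t * f' x) (\<lambda>x. g x + t * g' x)"
  unfolding H1_pair_def
  using H1_pairD[OF assms(1)] H1_pairD[OF assms(2)]
  by (auto intro!: L2_add L2_cmult primitive_lincomb L2_locally_integrable)

lemma jet_lincomb: "jet u \<Longrightarrow> jet v \<Longrightarrow> jet (\<lambda>i x. u i x + t * v i x)"
  unfolding jet_def by (auto intro: H1_pair_lincomb)

lemma jet_zero: "jet (\<lambda>i x. 0)"
  unfolding jet_def H1_pair_def by (auto simp: L2_def primitive_def set_lebesgue_integral_def)

lemma jet_cmult: "jet u \<Longrightarrow> jet (\<lambda>i x. t * u i x)"
  using jet_lincomb[OF jet_zero, of u t] by simp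

lemma jet_form_cmult: "jet_form c (\<lambda>i x. t * u i x) (\<lambda>i x. t * u i x) = t\<^sup>2 * jet_form c u u"
proof -
  have "(LINT x|lborel. c i x * (t * u i x) * (t * u i x)) = t\<^sup>2 * (LINT x|lborel. c i x * u i x * u i x)" for i
  proof -
    have eq: "c i x * (t * u i x) * (t * u i x) = t\<^sup>2 * (c i x * u i x * u i x)" for x
      by (simp add: power2_eq_square algebra_simps)
    show ?thesis unfolding eq by simp
  qed
  then show ?thesis by (simp add: jet_form_def sum_distrib_left)
qed

lemma jet_form_lincomb:
  assumes c: "bounded_weight c" and u: "jet u" and v: "jet v"
  shows "jet_form c (\<lambda>i x. u i x + t * v i x) (\<lambda>i x. u i x + t * v i x)
    = jet_form c u u + 2 * t * jet_form c u v + t\<^sup>2 * jet_form c v v"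
proof -
  have "(LINT x|lborel. c i x * (u i x + t * v i x) * (u i x + t * v i x))
      = (LINT x|lborel. c i x * u i x * u i x) + 2 * t * (LINT x|lborel. c i x * u i x * v i x)
        + t\<^sup>2 * (LINT x|lborel. c i x * v i x * v i x)" if "i < 3" for i
  proof -
    note int = jet_form_integrable[OF c _ _ that]
    have "c i x * (u i x + t * v i x) * (u i x + t * v i x) = c i x * u i x * u i x
        + 2 * t * (c i x * u i x * v i x) + t\<^sup>2 * (c i x * v i x * v i x)" for x
      by (simp add: power2_eq_square algebra_simps)
    then show ?thesis using int[OF u u] int[OF u v] int[OF v v] by simp
  qed
  then show ?thesis
    by (simp add: jet_form_def sum.distrib sum_distrib_left)
qed

lemma jet_form_weight_lincomb:
  assumes "bounded_weight c" "bounded_weight d" "jet u" "jet v"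
  shows "jet_form (\<lambda>i x. c i x + t * d i x) u v = jet_form c u v + t * jet_form d u v"
proof -
  have "(LINT x|lborel. (c i x + t * d i x) * u i x * v i x)
      = (LINT x|lborel. c i x * u i x * v i x) + t * (LINT x|lborel. d i x * u i x * v i x)" if "i < 3" for i
  proof -
    have "(c i x + t * d i x) * u i x * v i x = c i x * u i x * v i x + t * (d i x * u i x * v i x)" for x
      by (simp add: algebra_simps)
    then show ?thesis
      using jet_form_integrable[OF assms(1,3,4) that] jet_form_integrable[OF assms(2,3,4) that] by simp
  qed
  then show ?thesis by (simp add: jet_form_def sum.distrib sum_distrib_left)
qed

lemma bounded_weight_lincomb:
  assumes "bounded_weight c" "bounded_weight d"
  shows "bounded_weight (\<lambda>i x. c i x + t * d i x)"
  unfolding bounded_weight_def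
proof (intro allI impI conjI)
  fix i :: nat assume i: "i < 3"
  then have [measurable]: "c i \<in> borel_measurable borel" "d i \<in> borel_measurable borel"
    using assms by (auto simp: bounded_weight_def)
  show "(\<lambda>x. c i x + t * d i x) \<in> borel_measurable borel" by measurable
  obtain B where B: "\<forall>x. \<bar>c i x\<bar> \<le> B" using assms(1) i by (auto simp: bounded_weight_def)
  obtain D where D: "\<forall>x. \<bar>d i x\<bar> \<le> D" using assms(2) i by (auto simp: bounded_weight_def)
  have "\<bar>c i x + t * d i x\<bar> \<le> B + \<bar>t\<bar> * D" for x
  proof -
    have "\<bar>c i x + t * d i x\<bar> \<le> \<bar>c i x\<bar> + \<bar>t\<bar> * \<bar>d i x\<bar>"
      using abs_triangle_ineq[of "c i x" "t * d i x"] by (simp add: abs_mult)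
    also have "\<dots> \<le> B + \<bar>t\<bar> * D" using B D by (intro add_mono mult_left_mono) auto
    finally show ?thesis .
  qed
  then show "\<exists>B. \<forall>x. \<bar>c i x + t * d i x\<bar> \<le> B" by blast
qed

lemma jet_form_nonneg:
  assumes "\<And>i x. i < 3 \<Longrightarrow> 0 \<le> c i x"
  shows "0 \<le> jet_form c u u"
  unfolding jet_form_def
  using assms by (intro sum_nonneg Bochner_Integration.integral_nonneg) (simp add: mult.assoc)

text \<open>Minimizing over t the form at u + t v would suggest t = -g/b, but a merely semidefinite
  form may have b = 0; b + 1 avoids the case distinction. The loss is harmless where only the first
  factor has to tend to zero.\<close>

lemma jet_form_Cauchy_Schwarz:
  assumes c: "bounded_weight c" and pos: "\<And>u. jet u \<Longrightarrow> 0 \<le> jet_form c u u" and u: "jet u" and v: "jet v"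
  shows "(jet_form c u v)\<^sup>2 \<le> jet_form c u u * (jet_form c v v + 1)"
proof -
  define a b g where "a = jet_form c u u" and "b = jet_form c v v" and "g = jet_form c u v"
  have b: "b \<ge> 0" using pos[OF v] by (simp add: b_def)
  let ?t = "- g / (b + 1)"
  have "0 \<le> a + 2 * ?t * g + ?t\<^sup>2 * b"
    using pos[OF jet_lincomb[OF u v, of ?t]] jet_form_lincomb[OF c u v, of ?t]
    by (simp add: a_def b_def g_def)
  also have "\<dots> \<le> a + 2 * ?t * g + ?t\<^sup>2 * (b + 1)"
    by (simp add: mult_left_mono)
  also have "\<dots> = a - g\<^sup>2 / (b + 1)"
    using b by (simp add: power2_eq_square divide_simps)
  finally have "g\<^sup>2 / (b + 1) \<le> a" by simp
  then show ?thesis using b by (simp add: a_def b_def g_def divide_le_eq)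
qed

lemma test_fun_L2: assumes "test_fun p" shows "L2 p"
proof -
  have C: "C_inf p" using assms by (simp add: test_fun_def)
  then have "p \<in> borel_measurable borel"
    by (intro borel_measurable_continuous_onI C_inf_continuous_on)
  moreover have "integrable lborel (\<lambda>x. p x * p x)"
    using test_fun_integrable[OF test_fun_mult[OF C assms]] .
  ultimately show ?thesis by (simp add: L2_def power2_eq_square)
qed

lemma jet_test_fun:
  assumes "test_fun p" shows "jet (\<lambda>i. (deriv ^^ i) p)"
proof -
  have "H1_pair q (deriv q)" if "test_fun q" for q
    using that test_fun_deriv[OF that]
    by (intro H1_pair_DERIV test_fun_L2) (auto simp: test_fun_def C_inf_DERIV C_inf_continuous_on)
  from this[OF assms] this[OF test_fun_deriv[OF assms]] show ?thesis
    by (simp add: jet_def numeral_2_eq_2)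
qed

text \<open>The fixed integrable factor confines the mass, so bounded pointwise convergence
  suffices; every limit against test functions or against \<open>w\<close> is of this type.\<close>

lemma integral_tendsto_bounded:
  fixes f :: "nat \<Rightarrow> real \<Rightarrow> real"
  assumes k: "integrable lborel k" and f: "\<And>n. f n \<in> borel_measurable borel" "\<And>n x. \<bar>f n x\<bar> \<le> B"
    and lim: "\<And>x. (\<lambda>n. f n x) \<longlonglongrightarrow> F x"
  shows "(\<lambda>n. LINT x|lborel. k x * f n x) \<longlonglongrightarrow> (LINT x|lborel. k x * F x)"
proof (rule integral_dominated_convergence[where w = "\<lambda>x. B * \<bar>k x\<bar>"])
  note [measurable] = f(1) borel_measurable_integrable[OF k]
  show "(\<lambda>x. k x * F x) \<in> borel_measurable lborel"
    using borel_measurable_LIMSEQ_real[of borel f F] lim f(1) by simp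
  show "(\<lambda>x. k x * f n x) \<in> borel_measurable lborel" for n by simp
  show "integrable lborel (\<lambda>x. B * \<bar>k x\<bar>)" using k by simp
  show "AE x in lborel. (\<lambda>n. k x * f n x) \<longlonglongrightarrow> k x * F x"
    by (intro AE_I2 tendsto_mult_left lim)
  show "AE x in lborel. norm (k x * f n x) \<le> B * \<bar>k x\<bar>" for n
  proof (rule AE_I2)
    fix x
    have "\<bar>k x\<bar> * \<bar>f n x\<bar> \<le> \<bar>k x\<bar> * B" by (rule mult_left_mono[OF f(2)]) simp
    then show "norm (k x * f n x) \<le> B * \<bar>k x\<bar>" by (simp add: abs_mult mult.commute)
  qed
qed

text \<open>The sequences of functions and of first derivatives converge pointwise; the second
  derivatives are merely bounded in the square mean. Hence the weak equation carries three
  derivatives on the test function, and square integrability of a second derivative is stated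
  conditionally, to be used once regularity has produced a classical one.\<close>

lemma near_minimizers_limit:
  assumes G: "bounded_weight G" "G 2 = (\<lambda>_. A)" "continuous_on UNIV (G 1)" "continuous_on UNIV (G 0)"
    and pos: "\<And>u. jet u \<Longrightarrow> 0 \<le> jet_form G u u"
    and U: "\<And>n. jet (U n)" and bnd: "\<And>n i. i < 3 \<Longrightarrow> (LINT x|lborel. (U n i x)\<^sup>2) \<le> C"
    and lim: "(\<lambda>n. jet_form G (U n) (U n)) \<longlonglongrightarrow> 0"
    and w: "integrable lborel w" "\<And>n. (LINT x|lborel. w x * (U n 0 x)\<^sup>2) = 1"
  shows "\<exists>\<psi> \<psi>1. H1_pair \<psi> \<psi>1 \<and> continuous_on UNIV \<psi>1 \<and> (LINT x|lborel. w x * (\<psi> x)\<^sup>2) = 1 \<and>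
    (\<forall>p. test_fun p \<longrightarrow> - A * (LINT x|lborel. \<psi>1 x * deriv (deriv (deriv p)) x) +
       (LINT x|lborel. G 1 x * \<psi>1 x * deriv p x) + (LINT x|lborel. G 0 x * \<psi> x * p x) = 0) \<and>
    (\<forall>\<psi>2. continuous_on UNIV \<psi>2 \<longrightarrow> (\<forall>x. (\<psi>1 has_real_derivative \<psi>2 x) (at x)) \<longrightarrow> L2 \<psi>2)"
proof -
  have C: "C \<ge> 0" using bnd[of 0 0] by (rule order_trans[rotated]) auto
  have H: "H1_pair (U n 0) (U n 1)" "H1_pair (U n 1) (U n 2)" for n
    using U[of n] by (auto simp: jet_def)
  \<comment> \<open>The sup bound is 2C for the function plus 2C for its derivative.\<close>
  define M where "M = sqrt (4 * C)"
  have sup: "\<bar>U n i x\<bar> \<le> M" if "i = 0 \<or> i = 1" for n i x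
  proof -
    have "H1_pair (U n i) (U n (Suc i))" using H[of n] that by (auto simp: numeral_2_eq_2)
    from H1_pair_sup_bound[OF this, of x] have "(U n i x)\<^sup>2 \<le> 4 * C"
      using bnd[of i n] bnd[of "Suc i" n] that by auto
    then show ?thesis unfolding M_def by (intro real_le_rsqrt) simp
  qed
  have hol: "(U n i x - U n i y)\<^sup>2 \<le> \<bar>x - y\<bar> * C" if "i = 0 \<or> i = 1" for n i x y
  proof -
    have "H1_pair (U n i) (U n (Suc i))" using H[of n] that by (auto simp: numeral_2_eq_2)
    from H1_pair_Holder[OF this, of x y]
    have "(U n i x - U n i y)\<^sup>2 \<le> \<bar>x - y\<bar> * (LINT t|lborel. (U n (Suc i) t)\<^sup>2)" .
    also have "\<dots> \<le> \<bar>x - y\<bar> * C" using that by (intro mult_left_mono bnd) auto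
    finally show ?thesis .
  qed
  have "\<exists>r F. strict_mono r \<and> continuous_on UNIV F \<and> (\<forall>x. (\<lambda>n. U (r n) 0 x) \<longlonglongrightarrow> F x)"
    by (rule pointwise_convergent_subsequence[of "\<lambda>n. U n 0" M C]) (use sup hol in auto)
  then obtain r0 \<psi> where r0: "strict_mono r0" "continuous_on UNIV \<psi>" "\<forall>x. (\<lambda>n. U (r0 n) 0 x) \<longlonglongrightarrow> \<psi> x"
    by (elim exE conjE)
  have "\<exists>r F. strict_mono r \<and> continuous_on UNIV F \<and> (\<forall>x. (\<lambda>n. U (r0 (r n)) 1 x) \<longlonglongrightarrow> F x)"
    by (rule pointwise_convergent_subsequence[of "\<lambda>n. U (r0 n) 1" M C]) (use sup hol in auto)
  then obtain r1 \<psi>1 where r1: "strict_mono r1" "continuous_on UNIV \<psi>1" "\<forall>x. (\<lambda>n. U (r0 (r1 n)) 1 x) \<longlonglongrightarrow> \<psi>1 x"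
    by (elim exE conjE)
  define r where "r = (\<lambda>n. r0 (r1 n))"
  have r: "strict_mono r" using r0(1) r1(1) by (simp add: r_def strict_mono_def)
  have l0: "(\<lambda>n. U (r n) 0 x) \<longlonglongrightarrow> \<psi> x" for x
    using LIMSEQ_subseq_LIMSEQ[OF r0(3)[rule_format] r1(1)] by (simp add: r_def comp_def)
  have l1: "(\<lambda>n. U (r n) 1 x) \<longlonglongrightarrow> \<psi>1 x" for x using r1(3) by (simp add: r_def)
  have mU: "U n i \<in> borel_measurable borel" if "i < 3" for n i
    using jet_L2[OF U that] by (rule L2D)
  \<comment> \<open>The two limits were extracted separately; passing to the limit in the primitive
    relation identifies the second as the derivative of the first.\<close>
  have P: "primitive \<psi> \<psi>1"
    unfolding primitive_def
  proof (intro allI impI)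
    fix x y :: real assume xy: "x \<le> y"
    have "(\<lambda>n. LINT t|lborel. indicator {x..y} t * U (r n) 1 t) \<longlonglongrightarrow> (LINT t|lborel. indicator {x..y} t * \<psi>1 t)"
      by (rule integral_tendsto_bounded[where B = M])
         (use sup l1 mU set_integrable_const_Icc[of x y 1] in \<open>auto simp: set_integrable_def\<close>)
    moreover have "(LINT t|lborel. indicator {x..y} t * U (r n) 1 t) = U (r n) 0 y - U (r n) 0 x" for n
      using H1_pairD(3)[OF H(1)] xy by (simp add: primitive_def set_lebesgue_integral_def)
    ultimately have "(\<lambda>n. U (r n) 0 y - U (r n) 0 x) \<longlonglongrightarrow> (LINT t:{x..y}|lborel. \<psi>1 t)"
      by (simp add: set_lebesgue_integral_def)
    moreover have "(\<lambda>n. U (r n) 0 y - U (r n) 0 x) \<longlonglongrightarrow> \<psi> y - \<psi> x"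
      by (intro tendsto_diff l0)
    ultimately show "\<psi> y - \<psi> x = (LINT t:{x..y}|lborel. \<psi>1 t)"
      by (rule LIMSEQ_unique[rotated])
  qed
  have L: "L2 \<psi>"
    by (rule L2_liminf(1)[of "\<lambda>n. U (r n) 0" \<psi> C]) (use jet_L2[OF U] r0(2) l0 bnd in auto)
  have L1: "L2 \<psi>1"
    by (rule L2_liminf(1)[of "\<lambda>n. U (r n) 1" \<psi>1 C]) (use jet_L2[OF U] r1(2) l1 bnd in auto)
  have norm: "(LINT x|lborel. w x * (\<psi> x)\<^sup>2) = 1"
  proof -
    have "(\<lambda>n. LINT x|lborel. w x * (U (r n) 0 x)\<^sup>2) \<longlonglongrightarrow> (LINT x|lborel. w x * (\<psi> x)\<^sup>2)"
    proof (rule integral_tendsto_bounded[where B = "M\<^sup>2"])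
      show "(\<lambda>x. (U (r n) 0 x)\<^sup>2) \<in> borel_measurable borel" for n
        using mU[of 0 "r n"] by simp
      show "\<bar>(U (r n) 0 x)\<^sup>2\<bar> \<le> M\<^sup>2" for n x
        using power_mono[OF sup[of 0 "r n" x], of 2] by simp
      show "(\<lambda>n. (U (r n) 0 x)\<^sup>2) \<longlonglongrightarrow> (\<psi> x)\<^sup>2" for x by (intro tendsto_power l0)
    qed (rule w)
    then show ?thesis using w(2) by (simp add: LIMSEQ_const_iff)
  qed
  have weak: "- A * (LINT x|lborel. \<psi>1 x * deriv (deriv (deriv p)) x) +
       (LINT x|lborel. G 1 x * \<psi>1 x * deriv p x) + (LINT x|lborel. G 0 x * \<psi> x * p x) = 0"
    if p: "test_fun p" for p
  proof -
    let ?v = "\<lambda>i. (deriv ^^ i) p"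
    have v: "jet ?v" using p by (rule jet_test_fun)
    \<comment> \<open>One integration by parts moves a derivative away from \<open>U n 2\<close>,
      the only entry without a pointwise limit; this is possible because the top weight is the
      constant \<open>A\<close>.\<close>
    have form: "jet_form G (U n) ?v = - A * (LINT x|lborel. deriv (deriv (deriv p)) x * U n 1 x) +
       (LINT x|lborel. G 1 x * deriv p x * U n 1 x) + (LINT x|lborel. G 0 x * p x * U n 0 x)" for n
    proof -
      have "(LINT x|lborel. U n 1 x * deriv (deriv (deriv p)) x) = - (LINT x|lborel. U n 2 x * deriv (deriv p) x)"
        using H1_pairD(5)[OF H(2)] test_fun_deriv[OF test_fun_deriv[OF p]] by (simp add: weak_deriv_def)
      then show ?thesis
        unfolding jet_form_def sum_less_3 G(2) by (simp add: numeral_2_eq_2 mult.assoc) (simp add: mult.commute)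
    qed
    have "(\<lambda>n. jet_form G (U (r n)) ?v) \<longlonglongrightarrow> - A * (LINT x|lborel. deriv (deriv (deriv p)) x * \<psi>1 x) +
       (LINT x|lborel. G 1 x * deriv p x * \<psi>1 x) + (LINT x|lborel. G 0 x * p x * \<psi> x)"
      unfolding form
    proof (intro tendsto_intros)
      show "(\<lambda>n. LINT x|lborel. deriv (deriv (deriv p)) x * U (r n) 1 x) \<longlonglongrightarrow> (LINT x|lborel. deriv (deriv (deriv p)) x * \<psi>1 x)"
        by (rule integral_tendsto_bounded[where B = M])
          (use sup l1 mU in \<open>auto intro!: test_fun_integrable test_fun_deriv p\<close>)
      show "(\<lambda>n. LINT x|lborel. G 1 x * deriv p x * U (r n) 1 x) \<longlonglongrightarrow> (LINT x|lborel. G 1 x * deriv p x * \<psi>1 x)"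
        by (rule integral_tendsto_bounded[where B = M])
          (use sup l1 mU in \<open>auto intro!: integrable_mult_test_fun locally_integrable_continuous G(3)[unfolded One_nat_def] test_fun_deriv p\<close>)
      show "(\<lambda>n. LINT x|lborel. G 0 x * p x * U (r n) 0 x) \<longlonglongrightarrow> (LINT x|lborel. G 0 x * p x * \<psi> x)"
        by (rule integral_tendsto_bounded[where B = M])
          (use sup l0 mU in \<open>auto intro!: integrable_mult_test_fun locally_integrable_continuous G p\<close>)
    qed
    moreover have "(\<lambda>n. jet_form G (U (r n)) ?v) \<longlonglongrightarrow> 0"
    proof -
      have "(\<lambda>n. jet_form G (U (r n)) (U (r n))) \<longlonglongrightarrow> 0"
        using LIMSEQ_subseq_LIMSEQ[OF lim r] by (simp add: comp_def)
      then have "(\<lambda>n. jet_form G (U (r n)) (U (r n)) * (jet_form G ?v ?v + 1)) \<longlonglongrightarrow> 0"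
        by (rule tendsto_mult_left_zero)
      then have "(\<lambda>n. (jet_form G (U (r n)) ?v)\<^sup>2) \<longlonglongrightarrow> 0"
        by (rule tendsto_sandwich[OF _ _ tendsto_const, rotated 2])
           (auto intro!: always_eventually jet_form_Cauchy_Schwarz G pos U v)
      then show ?thesis by simp
    qed
    ultimately show ?thesis
      using LIMSEQ_unique by (fastforce simp: mult.commute mult.left_commute mult.assoc)
  qed
  have "L2 \<psi>2" if "continuous_on UNIV \<psi>2" "\<forall>x. (\<psi>1 has_real_derivative \<psi>2 x) (at x)" for \<psi>2
  proof (rule derivative_L2_of_difference_quotients[where g = "\<lambda>n. U (r n) 2" and f = "\<lambda>n. U (r n) 1" and C = C and u = \<psi>1])
    show "L2 (U (r n) 2)" for n by (rule jet_L2[OF U]) simp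
    show "primitive (U (r n) 1) (U (r n) 2)" for n by (rule H1_pairD(3)[OF H(2)])
    show "(LINT x|lborel. (U (r n) 2 x)\<^sup>2) \<le> C" for n by (rule bnd) simp
  qed (use that l1 r1(2) in \<open>simp_all\<close>)
  then show ?thesis
    using L L1 P r1(2) norm weak by (intro exI[of _ \<psi>] exI[of _ \<psi>1]) (auto simp: H1_pair_def)
qed

section \<open>Existence and regularity of growing modes\<close>

definition bounded_fun :: "(real \<Rightarrow> real) \<Rightarrow> bool" where
  "bounded_fun f \<longleftrightarrow> f \<in> borel_measurable borel \<and> (\<exists>B. \<forall>x. \<bar>f x\<bar> \<le> B)"

abbreviation "smooth_bounded f \<equiv> \<forall>k. smooth_upto bounded_fun k f"
abbreviation "smooth_L2 f \<equiv> \<forall>k. smooth_upto L2 k f"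

lemma bounded_fun_add: "bounded_fun f \<Longrightarrow> bounded_fun g \<Longrightarrow> bounded_fun (\<lambda>x. f x + g x)"
  unfolding bounded_fun_def
proof (elim conjE exE, intro conjI)
  fix B C assume "\<forall>x. \<bar>f x\<bar> \<le> B" "\<forall>x. \<bar>g x\<bar> \<le> C"
  then have "\<bar>f x + g x\<bar> \<le> B + C" for x
    using abs_triangle_ineq[of "f x" "g x"] by (meson add_mono order_trans)
  then show "\<exists>B. \<forall>x. \<bar>f x + g x\<bar> \<le> B" by blast
qed simp

lemma bounded_fun_mult: "bounded_fun f \<Longrightarrow> bounded_fun g \<Longrightarrow> bounded_fun (\<lambda>x. f x * g x)"
  unfolding bounded_fun_def
proof (elim conjE exE, intro conjI)
  fix B C assume B: "\<forall>x. \<bar>f x\<bar> \<le> B" and C: "\<forall>x. \<bar>g x\<bar> \<le> C"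
  have "\<bar>f x * g x\<bar> \<le> B * C" for x
    unfolding abs_mult using B C by (intro mult_mono) (auto intro: order_trans[OF abs_ge_zero])
  then show "\<exists>B. \<forall>x. \<bar>f x * g x\<bar> \<le> B" by blast
qed simp

lemma bounded_fun_const: "bounded_fun (\<lambda>_. c)"
  unfolding bounded_fun_def by auto

lemma bounded_fun_mult_L2: "bounded_fun f \<Longrightarrow> L2 g \<Longrightarrow> L2 (\<lambda>x. f x * g x)"
  unfolding bounded_fun_def by (auto intro: L2_mult_bounded)

lemma smooth_bounded_const: "smooth_bounded (\<lambda>_. c)"
  by (intro allI smooth_upto_const bounded_fun_const)

lemma smooth_bounded_add: "smooth_bounded f \<Longrightarrow> smooth_bounded g \<Longrightarrow> smooth_bounded (\<lambda>x. f x + g x)"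
  by (intro allI smooth_upto_add[where Q = bounded_fun] bounded_fun_add) simp_all

lemma smooth_bounded_mult: "smooth_bounded f \<Longrightarrow> smooth_bounded g \<Longrightarrow> smooth_bounded (\<lambda>x. f x * g x)"
  by (intro allI smooth_upto_mult[where Q = bounded_fun and ?Q1.0 = bounded_fun and ?Q2.0 = bounded_fun]
      bounded_fun_mult bounded_fun_add) simp_all

lemma smooth_bounded_cmult: "smooth_bounded f \<Longrightarrow> smooth_bounded (\<lambda>x. c * f x)"
  by (rule smooth_bounded_mult[OF smooth_bounded_const])

lemma smooth_L2_add: "smooth_L2 f \<Longrightarrow> smooth_L2 g \<Longrightarrow> smooth_L2 (\<lambda>x. f x + g x)"
  by (intro allI smooth_upto_add[where Q = L2] L2_add) simp_all

lemma smooth_upto_L2_mult: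
  "smooth_upto bounded_fun k f \<Longrightarrow> smooth_upto L2 k g \<Longrightarrow> smooth_upto L2 k (\<lambda>x. f x * g x)"
  by (intro smooth_upto_mult[where Q = L2 and ?Q1.0 = bounded_fun and ?Q2.0 = L2]
      bounded_fun_mult_L2 L2_add) simp_all

lemma smooth_L2_mult: "smooth_bounded f \<Longrightarrow> smooth_L2 g \<Longrightarrow> smooth_L2 (\<lambda>x. f x * g x)"
  by (simp add: smooth_upto_L2_mult)

lemma smooth_L2_cmult: "smooth_L2 f \<Longrightarrow> smooth_L2 (\<lambda>x. c * f x)"
  by (rule smooth_L2_mult[OF smooth_bounded_const])

lemma smooth_upto_all_C_inf:
  assumes "\<forall>k. smooth_upto Q k f" shows "C_inf f"
  unfolding C_inf_iff_smooth_upto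
proof
  fix k show "smooth_upto (\<lambda>_. True) k f"
    by (rule smooth_upto_mono[OF assms[rule_format]]) simp
qed

lemma smooth_upto_all_deriv:
  assumes "\<forall>k. smooth_upto Q k f" shows "\<forall>k. smooth_upto Q k (deriv f)"
proof
  fix k show "smooth_upto Q k (deriv f)"
    using assms[rule_format, of "Suc k"] by simp
qed

lemma smooth_upto_allD:
  assumes "\<forall>k. smooth_upto Q k f" shows "Q f"
  using assms[rule_format, of "Suc 0"] by simp

lemma smooth_L2_H1_pair:
  assumes "smooth_L2 f" shows "H1_pair f (deriv f)"
proof (rule H1_pair_DERIV)
  show "L2 f" by (rule smooth_upto_allD[OF assms])
  show "L2 (deriv f)" by (rule smooth_upto_allD[OF smooth_upto_all_deriv[OF assms]])
  show "continuous_on UNIV (deriv f)"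
    by (rule C_inf_continuous_on[OF smooth_upto_all_C_inf[OF smooth_upto_all_deriv[OF assms]]])
  show "(f has_real_derivative deriv f x) (at x)" for x
    by (rule C_inf_DERIV[OF smooth_upto_all_C_inf[OF assms]])
qed

lemma smooth_L2_Hinf:
  assumes "smooth_L2 f" shows "Hinf f"
  unfolding Hinf_def Hk_def
proof (intro allI exI conjI impI)
  have sm: "smooth_L2 ((deriv ^^ j) f)" for j
  proof (induction j)
    case (Suc j)
    from smooth_upto_all_deriv[OF this] show ?case by simp
  qed (use assms in simp)
  show "(deriv ^^ 0) f = f" by simp
  show "L2 ((deriv ^^ j) f)" for j by (rule smooth_upto_allD[OF sm])
  show "weak_deriv ((deriv ^^ j) f) ((deriv ^^ Suc j) f)" for j
    using H1_pairD(5)[OF smooth_L2_H1_pair[OF sm]] by simp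
qed

text \<open>Antiderivatives F0 of q \<psi>, K of p \<psi>1 - F0 and K2 of K move all derivatives
  onto the test function: K2 - A \<psi>1 integrates to zero against every \<phi>''' and so is a
  quadratic polynomial. This gives an explicit formula for \<psi>1, from which three further
  derivatives are read off.\<close>

lemma weak_solution_regular:
  assumes A: "A > 0" and H: "H1_pair \<psi> \<psi>1" and c1: "continuous_on UNIV \<psi>1"
    and p: "smooth_bounded p" and q: "smooth_bounded q"
    and weak: "\<And>\<phi>. test_fun \<phi> \<Longrightarrow> - A * (LINT x|lborel. \<psi>1 x * deriv (deriv (deriv \<phi>)) x) +
       (LINT x|lborel. p x * \<psi>1 x * deriv \<phi> x) + (LINT x|lborel. q x * \<psi> x * \<phi> x) = 0"
    and crit: "\<And>\<psi>2. continuous_on UNIV \<psi>2 \<Longrightarrow> (\<And>x. (\<psi>1 has_real_derivative \<psi>2 x) (at x)) \<Longrightarrow> L2 \<psi>2"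
  shows "smooth_L2 \<psi>"
    and "A * deriv (deriv (deriv (deriv \<psi>))) x = deriv p x * deriv \<psi> x + p x * deriv (deriv \<psi>) x - q x * \<psi> x"
proof -
  have c0: "continuous_on UNIV \<psi>" by (rule H1_pairD(4)[OF H])
  have cp: "continuous_on UNIV p" "continuous_on UNIV (deriv p)" and cq: "continuous_on UNIV q"
    and dp: "(p has_real_derivative deriv p x) (at x)" for x
    using smooth_upto_all_C_inf[OF p] smooth_upto_all_C_inf[OF q]
    by (simp_all add: C_inf_continuous_on C_inf_deriv C_inf_DERIV)
  have d0: "(\<psi> has_real_derivative \<psi>1 x) (at x)" for x
    by (rule DERIV_primitive[OF c1 H1_pairD(3)[OF H]])
  have cF0': "continuous_on UNIV (\<lambda>x. q x * \<psi> x)" by (intro continuous_intros cq c0)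
  obtain F0 where "\<forall>x. (F0 has_real_derivative q x * \<psi> x) (at x)"
    using antiderivative_exists[OF cF0'] by (rule exE)
  then have F0: "(F0 has_real_derivative q x * \<psi> x) (at x)" for x by (rule spec)
  have cF0: "continuous_on UNIV F0"
    by (auto intro!: continuous_at_imp_continuous_on DERIV_isCont F0)
  have cK': "continuous_on UNIV (\<lambda>x. p x * \<psi>1 x - F0 x)" by (intro continuous_intros cp c1 cF0)
  obtain K where "\<forall>x. (K has_real_derivative p x * \<psi>1 x - F0 x) (at x)"
    using antiderivative_exists[OF cK'] by (rule exE)
  then have K: "(K has_real_derivative p x * \<psi>1 x - F0 x) (at x)" for x by (rule spec)
  have cK: "continuous_on UNIV K"
    by (auto intro!: continuous_at_imp_continuous_on DERIV_isCont K)
  obtain K2 where "\<forall>x. (K2 has_real_derivative K x) (at x)"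
    using antiderivative_exists[OF cK] by (rule exE)
  then have K2: "(K2 has_real_derivative K x) (at x)" for x by (rule spec)
  have cK2: "continuous_on UNIV K2"
    by (auto intro!: continuous_at_imp_continuous_on DERIV_isCont K2)
  have "(LINT x|lborel. (K2 x - A * \<psi>1 x) * deriv (deriv (deriv \<phi>)) x) = 0" if \<phi>: "test_fun \<phi>" for \<phi>
  proof -
    note t = \<phi> test_fun_deriv[OF \<phi>] test_fun_deriv[OF test_fun_deriv[OF \<phi>]]
      test_fun_deriv[OF test_fun_deriv[OF test_fun_deriv[OF \<phi>]]]
    have li: "integrable lborel (\<lambda>x. G x * r x)" if "continuous_on UNIV G" "test_fun r" for G r
      using that by (intro integrable_mult_test_fun locally_integrable_continuous)
    have "(LINT x|lborel. F0 x * deriv \<phi> x) = - (LINT x|lborel. q x * \<psi> x * \<phi> x)"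
      using weak_deriv_DERIV[OF cF0' F0] t by (simp add: weak_deriv_def)
    moreover have "(LINT x|lborel. K x * deriv (deriv \<phi>) x) = - (LINT x|lborel. (p x * \<psi>1 x - F0 x) * deriv \<phi> x)"
      using weak_deriv_DERIV[OF cK' K] t by (simp add: weak_deriv_def)
    moreover have "(LINT x|lborel. (p x * \<psi>1 x - F0 x) * deriv \<phi> x)
        = (LINT x|lborel. p x * \<psi>1 x * deriv \<phi> x) - (LINT x|lborel. F0 x * deriv \<phi> x)"
      using li[OF _ t(2), of "\<lambda>x. p x * \<psi>1 x"] li[OF cF0 t(2)] cp c1
      by (simp add: left_diff_distrib continuous_on_mult)
    moreover have "(LINT x|lborel. K2 x * deriv (deriv (deriv \<phi>)) x) = - (LINT x|lborel. K x * deriv (deriv \<phi>) x)"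
      using weak_deriv_DERIV[OF cK K2] t by (simp add: weak_deriv_def)
    moreover have "(LINT x|lborel. (K2 x - A * \<psi>1 x) * deriv (deriv (deriv \<phi>)) x)
        = (LINT x|lborel. K2 x * deriv (deriv (deriv \<phi>)) x) - A * (LINT x|lborel. \<psi>1 x * deriv (deriv (deriv \<phi>)) x)"
      using li[OF cK2 t(4)] li[OF c1 t(4)] by (simp add: left_diff_distrib mult.assoc)
    ultimately show ?thesis using weak[OF \<phi>] by linarith
  qed
  then have "\<exists>e0 e1 e2. \<forall>x. K2 x - A * \<psi>1 x = e0 + e1 * x + e2 * x\<^sup>2"
    by (intro third_order_du_Bois_Reymond continuous_intros cK2 c1)
  then obtain e0 e1 e2 where e: "\<forall>x. K2 x - A * \<psi>1 x = e0 + e1 * x + e2 * x\<^sup>2"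
    by (elim exE)
  have \<psi>1: "\<psi>1 = (\<lambda>x. (K2 x - (e0 + e1 * x + e2 * x\<^sup>2)) / A)"
  proof
    fix x from e[rule_format, of x] show "\<psi>1 x = (K2 x - (e0 + e1 * x + e2 * x\<^sup>2)) / A"
      using A by (simp add: field_simps)
  qed
  define \<psi>2 where "\<psi>2 = (\<lambda>x. (K x - (e1 + 2 * e2 * x)) / A)"
  define \<psi>3 where "\<psi>3 = (\<lambda>x. (p x * \<psi>1 x - F0 x - 2 * e2) / A)"
  define \<psi>4 where "\<psi>4 = (\<lambda>x. (deriv p x * \<psi>1 x + p x * \<psi>2 x - q x * \<psi> x) / A)"
  have "((\<lambda>x. (K2 x - (e0 + e1 * x + e2 * x\<^sup>2)) / A) has_real_derivative \<psi>2 x) (at x)" for x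
    unfolding \<psi>2_def using A by (auto intro!: derivative_eq_intros K2)
  then have d1: "(\<psi>1 has_real_derivative \<psi>2 x) (at x)" for x
    by (simp only: \<psi>1[symmetric])
  have d2: "(\<psi>2 has_real_derivative \<psi>3 x) (at x)" for x
    unfolding \<psi>2_def \<psi>3_def using A by (auto intro!: derivative_eq_intros K)
  have d3: "(\<psi>3 has_real_derivative \<psi>4 x) (at x)" for x
    unfolding \<psi>3_def \<psi>4_def using A by (auto intro!: derivative_eq_intros F0 dp d1)
  have c2: "continuous_on UNIV \<psi>2"
    by (auto intro!: continuous_at_imp_continuous_on DERIV_isCont d2)
  have c4: "continuous_on UNIV \<psi>4"
    unfolding \<psi>4_def using A by (intro continuous_intros cp c1 c2 cq c0) auto
  have L0: "L2 \<psi>" and L1: "L2 \<psi>1" using H1_pairD[OF H] by auto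
  \<comment> \<open>The affine term left over from the quadratic polynomial could spoil
    integrability; the bound inherited from the approximating sequence rules this out.\<close>
  have L2: "L2 \<psi>2" by (rule crit[OF c2 d1])
  have \<psi>4: "\<psi>4 x = (1 / A * deriv p x) * \<psi>1 x + (1 / A * p x) * \<psi>2 x + (- 1 / A * q x) * \<psi> x" for x
    using A by (simp add: \<psi>4_def field_simps)
  have w: "smooth_bounded (\<lambda>x. 1 / A * deriv p x)" "smooth_bounded (\<lambda>x. 1 / A * p x)" "smooth_bounded (\<lambda>x. - 1 / A * q x)"
    by (rule smooth_bounded_cmult[OF smooth_upto_all_deriv[OF p]] smooth_bounded_cmult[OF p] smooth_bounded_cmult[OF q])+
  \<comment> \<open>The fourth derivative precedes the third: the equation expresses it by lower
    orders already under control, and interpolation between orders two and four fills the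
    gap.\<close>
  have L4: "L2 \<psi>4"
  proof -
    have "L2 (\<lambda>x. (1 / A * deriv p x) * \<psi>1 x + (1 / A * p x) * \<psi>2 x + (- 1 / A * q x) * \<psi> x)"
      by (rule L2_add[OF L2_add[OF bounded_fun_mult_L2[OF smooth_upto_allD[OF w(1)] L1]
            bounded_fun_mult_L2[OF smooth_upto_allD[OF w(2)] L2]] bounded_fun_mult_L2[OF smooth_upto_allD[OF w(3)] L0]])
    then show ?thesis by (simp only: \<psi>4[symmetric])
  qed
  have L3: "L2 \<psi>3" by (rule L2_interpolation[OF L2 L4 c4 d2 d3])
  have all: "smooth_upto L2 k \<psi> \<and> smooth_upto L2 k \<psi>1 \<and> smooth_upto L2 k \<psi>2 \<and> smooth_upto L2 k \<psi>3" for k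
  proof (induction k)
    case (Suc k)
    have IH: "smooth_upto L2 k \<psi>" "smooth_upto L2 k \<psi>1" "smooth_upto L2 k \<psi>2" "smooth_upto L2 k \<psi>3"
      using Suc by auto
    have m: "smooth_upto L2 k (\<lambda>x. (1 / A * deriv p x) * \<psi>1 x)" "smooth_upto L2 k (\<lambda>x. (1 / A * p x) * \<psi>2 x)"
      "smooth_upto L2 k (\<lambda>x. (- 1 / A * q x) * \<psi> x)"
      by (rule smooth_upto_L2_mult[OF w(1)[rule_format] IH(2)] smooth_upto_L2_mult[OF w(2)[rule_format] IH(3)]
          smooth_upto_L2_mult[OF w(3)[rule_format] IH(1)])+
    have "smooth_upto L2 k (\<lambda>x. (1 / A * deriv p x) * \<psi>1 x + (1 / A * p x) * \<psi>2 x + (- 1 / A * q x) * \<psi> x)"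
      by (rule smooth_upto_add[where Q = L2, OF _ smooth_upto_add[where Q = L2, OF _ m(1,2)] m(3)])
         (erule (1) L2_add)+
    then have "smooth_upto L2 k \<psi>4" by (simp only: \<psi>4[symmetric])
    then show ?case
      using smooth_upto_SucI[where Q = L2, OF d0 L0 IH(2)] smooth_upto_SucI[where Q = L2, OF d1 L1 IH(3)]
        smooth_upto_SucI[where Q = L2, OF d2 L2 IH(4)] smooth_upto_SucI[where Q = L2, OF d3 L3] by simp
  qed simp
  then show "smooth_L2 \<psi>" by simp
  have "deriv \<psi> = \<psi>1" "deriv \<psi>1 = \<psi>2" "deriv \<psi>2 = \<psi>3" "deriv \<psi>3 = \<psi>4"
    by (intro deriv_eqI d0 d1 d2 d3)+
  then show "A * deriv (deriv (deriv (deriv \<psi>))) x = deriv p x * deriv \<psi> x + p x * deriv (deriv \<psi>) x - q x * \<psi> x"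
    using A by (simp add: \<psi>4_def)
qed

theorem growing_mode_exists:
  fixes \<kappa> \<mu> a b c :: real
  assumes pos: "\<kappa> > 0" "\<mu> > 0" "a \<ge> 0" "b \<ge> 0" "c \<ge> 0"
    and \<rho>: "smooth_bounded \<rho>" "\<And>x. 0 \<le> \<rho> x"
    and w: "smooth_bounded w" "integrable lborel w"
    and v0: "jet v0" "(LINT x|lborel. c * (v0 0 x)\<^sup>2) + (LINT x|lborel. b * (v0 1 x)\<^sup>2) + (LINT x|lborel. a * (v0 2 x)\<^sup>2)
        < (LINT x|lborel. w x * (v0 0 x)\<^sup>2)"
  shows "\<exists>s>0. \<exists>\<psi>. smooth_L2 \<psi> \<and> (LINT x|lborel. w x * (\<psi> x)\<^sup>2) = 1 \<and>
    (\<forall>x. (s * \<mu> + a) * deriv (deriv (deriv (deriv \<psi>))) x =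
       s\<^sup>2 * deriv \<rho> x * deriv \<psi> x + (2 * s * \<mu> * \<kappa> + b + s\<^sup>2 * \<rho> x) * deriv (deriv \<psi>) x
       - (s * \<mu> * \<kappa>\<^sup>2 + c + s\<^sup>2 * \<kappa> * \<rho> x - w x) * \<psi> x)"
proof -
  \<comment> \<open>Weights of the energy: \<open>X\<close> inertia, \<open>Y\<close> viscous
    dissipation, \<open>Z\<close> magnetic tension, \<open>B\<close> buoyancy. The entries of
    \<open>Y\<close> are those of \<mu> (\<kappa>^2 \<psi>^2 + 2 \<kappa> \<psi>'^2 +
    \<psi>''^2).\<close>
  define X where "X = (\<lambda>i::nat. if i = 0 then (\<lambda>x. \<kappa> * \<rho> x) else if i = 1 then \<rho> else (\<lambda>_. 0))"
  define Y where "Y = (\<lambda>(i::nat) (x::real). if i = 0 then \<mu> * \<kappa>\<^sup>2 else if i = 1 then 2 * \<mu> * \<kappa> else \<mu>)"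
  define Z where "Z = (\<lambda>(i::nat) (x::real). if i = 0 then c else if i = 1 then b else a)"
  define B where "B = (\<lambda>i::nat. if i = 0 then w else (\<lambda>_. 0))"
  have bw: "bounded_weight X" "bounded_weight Y" "bounded_weight Z" "bounded_weight B"
  proof -
    have "bounded_fun \<rho>" "bounded_fun (\<lambda>x. \<kappa> * \<rho> x)" "bounded_fun w"
      using smooth_upto_allD[OF \<rho>(1)] smooth_upto_allD[OF smooth_bounded_cmult[OF \<rho>(1)]] smooth_upto_allD[OF w(1)] by auto
    then show "bounded_weight X" "bounded_weight Y" "bounded_weight Z" "bounded_weight B"
      using bounded_fun_const
      by (auto simp: bounded_weight_def bounded_fun_def X_def Y_def Z_def B_def)
  qed
  have Bform: "jet_form B v v = (LINT x|lborel. w x * (v 0 x)\<^sup>2)" for v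
    by (simp add: jet_form_def sum_less_3 B_def power2_eq_square mult.assoc)
  have nonneg: "0 \<le> jet_form X v v" "0 \<le> jet_form Y v v" "0 \<le> jet_form Z v v" for v
    using pos \<rho>(2) by (auto intro!: jet_form_nonneg simp: X_def Y_def Z_def)
  have Yform: "jet_form Y v v = \<mu> * \<kappa>\<^sup>2 * (LINT x|lborel. (v 0 x)\<^sup>2) + 2 * \<mu> * \<kappa> * (LINT x|lborel. (v 1 x)\<^sup>2) + \<mu> * (LINT x|lborel. (v 2 x)\<^sup>2)" for v
    by (simp add: jet_form_def sum_less_3 Y_def power2_eq_square mult.assoc)
  have Zform: "jet_form Z v v = (LINT x|lborel. c * (v 0 x)\<^sup>2) + (LINT x|lborel. b * (v 1 x)\<^sup>2) + (LINT x|lborel. a * (v 2 x)\<^sup>2)" for v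
    by (simp add: jet_form_def sum_less_3 Z_def power2_eq_square mult.assoc)
  obtain W where W: "\<And>x. \<bar>w x\<bar> \<le> W"
    using smooth_upto_allD[OF w(1)] by (auto simp: bounded_fun_def)
  have W0: "W \<ge> 0" using W[of 0] by linarith
  \<comment> \<open>Buoyancy is dominated by the zeroth-order part of the dissipation alone; this
    caps the growth rate by W / (\<mu> \<kappa>^2).\<close>
  have bound: "jet_form B v v \<le> W / (\<mu> * \<kappa>\<^sup>2) * jet_form Y v v" if v: "jet v" for v
  proof -
    have i: "integrable lborel (\<lambda>x. (v 0 x)\<^sup>2)" using jet_L2[OF v] by (intro L2D) simp
    have "jet_form B v v \<le> (LINT x|lborel. W * (v 0 x)\<^sup>2)"
      unfolding Bform
    proof (rule integral_mono)
      show "integrable lborel (\<lambda>x. w x * (v 0 x)\<^sup>2)"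
        using jet_form_integrable[OF bw(4) v v, of 0] by (simp add: B_def power2_eq_square mult.assoc)
      show "integrable lborel (\<lambda>x. W * (v 0 x)\<^sup>2)" using i by simp
      show "w x * (v 0 x)\<^sup>2 \<le> W * (v 0 x)\<^sup>2" for x
        using W[of x] by (intro mult_right_mono) auto
    qed
    also have "\<dots> = W / (\<mu> * \<kappa>\<^sup>2) * (\<mu> * \<kappa>\<^sup>2 * (LINT x|lborel. (v 0 x)\<^sup>2))"
      using pos by simp
    also have "\<dots> \<le> W / (\<mu> * \<kappa>\<^sup>2) * jet_form Y v v"
      unfolding Yform using pos W0 by (intro mult_left_mono) auto
    finally show ?thesis .
  qed
  have "\<exists>s>0. \<exists>C. \<exists>u :: nat \<Rightarrow> nat \<Rightarrow> real \<Rightarrow> real.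
    (\<forall>v\<in>Collect jet. jet_form B v v \<le> s\<^sup>2 * jet_form X v v + s * jet_form Y v v + jet_form Z v v) \<and>
    (\<forall>n. u n \<in> Collect jet \<and> jet_form B (u n) (u n) = 1 \<and> jet_form X (u n) (u n) \<le> C \<and> jet_form Y (u n) (u n) \<le> C) \<and>
    (\<lambda>n. s\<^sup>2 * jet_form X (u n) (u n) + s * jet_form Y (u n) (u n) + jet_form Z (u n) (u n)) \<longlonglongrightarrow> 1"
  proof (rule threshold_exists[where K = "W / (\<mu> * \<kappa>\<^sup>2)"])
    show "\<exists>v'\<in>Collect jet. jet_form X v' v' = t\<^sup>2 * jet_form X v v \<and> jet_form Y v' v' = t\<^sup>2 * jet_form Y v v \<and>
        jet_form Z v' v' = t\<^sup>2 * jet_form Z v v \<and> jet_form B v' v' = t\<^sup>2 * jet_form B v v"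
      if "v \<in> Collect jet" for v t
      using that by (intro bexI[of _ "\<lambda>i x. t * v i x"]) (auto simp: jet_form_cmult jet_cmult)
    show "v0 \<in> Collect jet" using v0 by simp
    show "jet_form Z v0 v0 < jet_form B v0 v0" using v0 by (simp add: Zform Bform)
  qed (use nonneg bound in auto)
  then obtain s C u where s: "s > 0"
    and min: "\<forall>v\<in>Collect jet. jet_form B v v \<le> s\<^sup>2 * jet_form X v v + s * jet_form Y v v + jet_form Z v v"
    and u: "\<forall>n. u n \<in> Collect jet \<and> jet_form B (u n) (u n) = 1 \<and> jet_form X (u n) (u n) \<le> C \<and> jet_form Y (u n) (u n) \<le> C"
    and lim: "(\<lambda>n. s\<^sup>2 * jet_form X (u n) (u n) + s * jet_form Y (u n) (u n) + jet_form Z (u n) (u n)) \<longlonglongrightarrow> 1"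
    by (elim exE conjE)
  \<comment> \<open>The full energy at the threshold: nonnegative on all jets, and tending to zero
    along \<open>u\<close>.\<close>
  define G where "G = (\<lambda>i x. ((Z i x + s * Y i x) + s\<^sup>2 * X i x) + (-1) * B i x)"
  have G: "bounded_weight G" unfolding G_def by (intro bounded_weight_lincomb bw)
  have Gform: "jet_form G v v = s\<^sup>2 * jet_form X v v + s * jet_form Y v v + jet_form Z v v - jet_form B v v" if "jet v" for v
    unfolding G_def using that
    by (subst jet_form_weight_lincomb | simp add: bw bounded_weight_lincomb)+
  have G2: "G 2 = (\<lambda>_. s * \<mu> + a)" and G1: "G 1 = (\<lambda>x. (2 * s * \<mu> * \<kappa> + b) + s\<^sup>2 * \<rho> x)"
    and G0: "G 0 = (\<lambda>x. (s * \<mu> * \<kappa>\<^sup>2 + c) + (s\<^sup>2 * \<kappa> * \<rho> x + (-1) * w x))"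
    by (auto simp: G_def X_def Y_def Z_def B_def fun_eq_iff algebra_simps)
  have sG1: "smooth_bounded (\<lambda>x. (2 * s * \<mu> * \<kappa> + b) + s\<^sup>2 * \<rho> x)"
    by (intro smooth_bounded_add smooth_bounded_const smooth_bounded_cmult \<rho>)
  have sG0: "smooth_bounded (\<lambda>x. (s * \<mu> * \<kappa>\<^sup>2 + c) + (s\<^sup>2 * \<kappa> * \<rho> x + (-1) * w x))"
    by (intro smooth_bounded_add smooth_bounded_const smooth_bounded_cmult \<rho> w)
  \<comment> \<open>The dissipation is a sum of three nonnegative terms, so its bound
    \<open>C\<close> controls each norm after division by the respective coefficient.\<close>
  define D where "D = max (C / (\<mu> * \<kappa>\<^sup>2)) (max (C / (2 * \<mu> * \<kappa>)) (C / \<mu>))"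
  have uj: "jet (u n)" for n using u by simp
  have bnd: "(LINT x|lborel. (u n i x)\<^sup>2) \<le> D" if i: "i < 3" for n i
  proof -
    have Y: "jet_form Y (u n) (u n) \<le> C" using u by simp
    have nn: "0 \<le> (LINT x|lborel. (u n i x)\<^sup>2)" for i by simp
    have "0 \<le> \<mu> * \<kappa>\<^sup>2 * (LINT x|lborel. (u n 0 x)\<^sup>2)" "0 \<le> 2 * \<mu> * \<kappa> * (LINT x|lborel. (u n 1 x)\<^sup>2)" "0 \<le> \<mu> * (LINT x|lborel. (u n 2 x)\<^sup>2)"
      using pos by (auto intro!: mult_nonneg_nonneg)
    then have "\<mu> * \<kappa>\<^sup>2 * (LINT x|lborel. (u n 0 x)\<^sup>2) \<le> C" "2 * \<mu> * \<kappa> * (LINT x|lborel. (u n 1 x)\<^sup>2) \<le> C" "\<mu> * (LINT x|lborel. (u n 2 x)\<^sup>2) \<le> C"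
      using Y unfolding Yform by linarith+
    then have "(LINT x|lborel. (u n 0 x)\<^sup>2) \<le> C / (\<mu> * \<kappa>\<^sup>2)" "(LINT x|lborel. (u n 1 x)\<^sup>2) \<le> C / (2 * \<mu> * \<kappa>)" "(LINT x|lborel. (u n 2 x)\<^sup>2) \<le> C / \<mu>"
      using pos by (simp_all add: pos_le_divide_eq mult.commute)
    then show ?thesis using less_3_cases[OF i] by (auto simp: D_def le_max_iff_disj)
  qed
  have "\<exists>\<psi> \<psi>1. H1_pair \<psi> \<psi>1 \<and> continuous_on UNIV \<psi>1 \<and> (LINT x|lborel. w x * (\<psi> x)\<^sup>2) = 1 \<and>
    (\<forall>p. test_fun p \<longrightarrow> - (s * \<mu> + a) * (LINT x|lborel. \<psi>1 x * deriv (deriv (deriv p)) x) +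
       (LINT x|lborel. G 1 x * \<psi>1 x * deriv p x) + (LINT x|lborel. G 0 x * \<psi> x * p x) = 0) \<and>
    (\<forall>\<psi>2. continuous_on UNIV \<psi>2 \<longrightarrow> (\<forall>x. (\<psi>1 has_real_derivative \<psi>2 x) (at x)) \<longrightarrow> L2 \<psi>2)"
  proof (rule near_minimizers_limit[OF G G2 _ _ _ uj bnd _ w(2)])
    show "continuous_on UNIV (G 1)" "continuous_on UNIV (G 0)"
      unfolding G1 G0 using sG1 sG0 by (intro C_inf_continuous_on smooth_upto_all_C_inf; simp)+
    show "0 \<le> jet_form G v v" if "jet v" for v
      using min that by (simp add: Gform[OF that])
    have "(\<lambda>n. s\<^sup>2 * jet_form X (u n) (u n) + s * jet_form Y (u n) (u n) + jet_form Z (u n) (u n) - 1) \<longlonglongrightarrow> 1 - 1"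
      by (intro tendsto_diff lim tendsto_const)
    then show "(\<lambda>n. jet_form G (u n) (u n)) \<longlonglongrightarrow> 0"
      using u by (simp add: Gform[OF uj])
    show "(LINT x|lborel. w x * (u n 0 x)\<^sup>2) = 1" for n
      using u Bform by simp
  qed
  then obtain \<psi> \<psi>1 where H: "H1_pair \<psi> \<psi>1" "continuous_on UNIV \<psi>1" and n1: "(LINT x|lborel. w x * (\<psi> x)\<^sup>2) = 1"
    and weak: "\<forall>p. test_fun p \<longrightarrow> - (s * \<mu> + a) * (LINT x|lborel. \<psi>1 x * deriv (deriv (deriv p)) x) +
       (LINT x|lborel. G 1 x * \<psi>1 x * deriv p x) + (LINT x|lborel. G 0 x * \<psi> x * p x) = 0"
    and crit: "\<forall>\<psi>2. continuous_on UNIV \<psi>2 \<longrightarrow> (\<forall>x. (\<psi>1 has_real_derivative \<psi>2 x) (at x)) \<longrightarrow> L2 \<psi>2"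
    by (elim exE conjE)
  have A: "s * \<mu> + a > 0" using s pos by (simp add: add_pos_nonneg)
  note R = weak_solution_regular[OF A H sG1[folded G1] sG0[folded G0] weak[rule_format] crit[rule_format]]
  have d: "deriv (G 1) x = s\<^sup>2 * deriv \<rho> x" for x
    unfolding G1 using C_inf_DERIV[OF smooth_upto_all_C_inf[OF \<rho>(1)]]
    by (intro DERIV_imp_deriv) (auto intro!: derivative_eq_intros)
  have "(s * \<mu> + a) * deriv (deriv (deriv (deriv \<psi>))) x =
       s\<^sup>2 * deriv \<rho> x * deriv \<psi> x + (2 * s * \<mu> * \<kappa> + b + s\<^sup>2 * \<rho> x) * deriv (deriv \<psi>) x
       - (s * \<mu> * \<kappa>\<^sup>2 + c + s\<^sup>2 * \<kappa> * \<rho> x - w x) * \<psi> x" for x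
  proof -
    have eq: "s * \<mu> * \<kappa>\<^sup>2 + c + s\<^sup>2 * \<kappa> * \<rho> x - w x = G 0 x" by (simp add: G0)
    have eq1: "2 * s * \<mu> * \<kappa> + b + s\<^sup>2 * \<rho> x = G 1 x" by (simp only: G1)
    show ?thesis unfolding eq eq1 d[symmetric] by (rule R(2))
  qed
  then have ode: "\<forall>x. (s * \<mu> + a) * deriv (deriv (deriv (deriv \<psi>))) x =
       s\<^sup>2 * deriv \<rho> x * deriv \<psi> x + (2 * s * \<mu> * \<kappa> + b + s\<^sup>2 * \<rho> x) * deriv (deriv \<psi>) x
       - (s * \<mu> * \<kappa>\<^sup>2 + c + s\<^sup>2 * \<kappa> * \<rho> x - w x) * \<psi> x"
    by (rule allI)
  have "smooth_L2 \<psi>" by (rule R(1))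
  then show ?thesis using s n1 ode by (intro exI[of _ s] exI[of _ \<psi>] conjI)
qed

section \<open>Trial functions\<close>

lemma set_integral_translate:
  "(LINT t:{x..y}|lborel. f (t + h)) = (LINT t:{x + h..y + h}|lborel. f t)" for f :: "real \<Rightarrow> real"
proof -
  have "(LINT t|lborel. indicator {x + h..y + h} t *\<^sub>R f t) = (LINT t|lborel. indicator {x + h..y + h} (h + t) *\<^sub>R f (h + t))"
    using lborel_integral_real_affine[of 1 "\<lambda>t. indicator {x + h..y + h} t *\<^sub>R f t" h] by simp
  also have "\<dots> = (LINT t|lborel. indicator {x..y} t *\<^sub>R f (t + h))"
    by (intro Bochner_Integration.integral_cong) (auto simp: indicator_def add.commute)
  finally show ?thesis by (simp add: set_lebesgue_integral_def)
qed

lemma H1_pair_translate: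
  assumes "H1_pair f g" shows "H1_pair (\<lambda>x. f (x + h)) (\<lambda>x. g (x + h))"
  unfolding H1_pair_def primitive_def
  using assms H1_pairD(3)[OF assms] by (auto simp: L2_translate H1_pairD set_integral_translate primitive_def)

lemma H1_pair_cmult:
  assumes "H1_pair f g" shows "H1_pair (\<lambda>x. t * f x) (\<lambda>x. t * g x)"
proof -
  have "H1_pair (\<lambda>_. 0) (\<lambda>_. 0)" using jet_zero by (simp add: jet_def)
  from H1_pair_lincomb[OF this assms] show ?thesis by simp
qed

text \<open>Steklov averages \<open>(1/h) \<integral>\<^bsub>[x,x+h]\<^esub> f\<close> lie in \<open>H\<^sup>2\<close> and do not increase the \<open>L\<^sup>2\<close> norms.\<close>

lemma H1_trial_smoothing:
  assumes f: "H1_pair f f1" and bc: "b \<ge> 0" "c \<ge> 0" and w: "integrable lborel w"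
    and lt: "c * (LINT x|lborel. (f x)\<^sup>2) + b * (LINT x|lborel. (f1 x)\<^sup>2) < (LINT x|lborel. w x * (f x)\<^sup>2)"
  shows "\<exists>v. jet v \<and> c * (LINT x|lborel. (v 0 x)\<^sup>2) + b * (LINT x|lborel. (v 1 x)\<^sup>2) < (LINT x|lborel. w x * (v 0 x)\<^sup>2)"
proof -
  note cf = H1_pairD(4)[OF f]
  obtain F where "\<forall>x. (F has_real_derivative f x) (at x)"
    using antiderivative_exists[OF cf] by (rule exE)
  then have F: "(F has_real_derivative f x) (at x)" for x by (rule spec)
  have P: "primitive F f" by (rule primitive_DERIV[OF cf F])
  define M where "M = sqrt (2 * (LINT t|lborel. (f t)\<^sup>2) + 2 * (LINT t|lborel. (f1 t)\<^sup>2))"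
  have M: "\<bar>f x\<bar> \<le> M" for x
    unfolding M_def using H1_pair_sup_bound[OF f, of x] by (intro real_le_rsqrt) simp
  define Q where "Q = (\<lambda>h x. (F (x + h) - F x) / h)"
  define h where "h = (\<lambda>n. inverse (real (Suc n)))"
  have hp: "h n > 0" for n by (simp add: h_def)
  have mQ: "L2 (Q (h n))" for n
    unfolding Q_def by (rule difference_quotient_L2(1)[OF H1_pairD(1)[OF f] P hp])
  have "(\<lambda>n. LINT x|lborel. w x * (Q (h n) x)\<^sup>2) \<longlonglongrightarrow> (LINT x|lborel. w x * (f x)\<^sup>2)"
  proof (rule integral_tendsto_bounded[OF w, where B = "M\<^sup>2"])
    show "(\<lambda>x. (Q (h n) x)\<^sup>2) \<in> borel_measurable borel" for n
      using L2D(1)[OF mQ[of n]] by simp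
    \<comment> \<open>An average of f over [x, x+h] is a value of f, by the mean value theorem for
      F, so it obeys the same sup bound.\<close>
    show "\<bar>(Q (h n) x)\<^sup>2\<bar> \<le> M\<^sup>2" for n x
    proof -
      obtain z where "F (x + h n) - F x = (x + h n - x) * f z"
        using MVT2[of x "x + h n" F f] F hp[of n] by auto
      then have "Q (h n) x = f z" using hp[of n] by (simp add: Q_def)
      then show ?thesis using power_mono[OF M[of z], of 2] by simp
    qed
    show "(\<lambda>n. (Q (h n) x)\<^sup>2) \<longlonglongrightarrow> (f x)\<^sup>2" for x
    proof (rule tendsto_power)
      have "((\<lambda>h. (F (x + h) - F x) / h) \<longlongrightarrow> f x) (at 0)"
        using F[of x] by (simp add: DERIV_def)
      moreover have "filterlim h (at 0) sequentially"
        unfolding filterlim_at h_def using LIMSEQ_inverse_real_of_nat by auto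
      ultimately show "(\<lambda>n. Q (h n) x) \<longlonglongrightarrow> f x"
        unfolding Q_def by (rule filterlim_compose)
    qed
  qed
  \<comment> \<open>The right side converges and the inequality is strict, so a small enough step
    keeps it above the unsmoothed left side; smoothing can only lower the latter.\<close>
  from order_tendstoD(1)[OF this lt] obtain n where
    n: "c * (LINT x|lborel. (f x)\<^sup>2) + b * (LINT x|lborel. (f1 x)\<^sup>2) < (LINT x|lborel. w x * (Q (h n) x)\<^sup>2)"
    unfolding eventually_sequentially by blast
  let ?h = "h n"
  define v where "v = (\<lambda>i::nat. if i = 0 then Q ?h else if i = 1 then (\<lambda>x. 1 / ?h * (f (x + ?h) + (-1) * f x))
      else (\<lambda>x. 1 / ?h * (f1 (x + ?h) + (-1) * f1 x)))"
  have v1: "v 1 = (\<lambda>x. (f (x + ?h) - f x) / ?h)" by (simp add: v_def)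
  have "H1_pair (v 1) (v 2)"
    using H1_pair_cmult[OF H1_pair_lincomb[OF H1_pair_translate[OF f] f], of "1 / ?h" ?h "-1"]
    by (simp add: v_def)
  moreover have "H1_pair (v 0) (v 1)"
  proof (rule H1_pair_DERIV)
    show "L2 (v 0)" using mQ by (simp add: v_def)
    show "L2 (v 1)" "continuous_on UNIV (v 1)" by (rule H1_pairD[OF calculation])+
    fix x
    have "(F has_real_derivative f (x + ?h)) (at (x + ?h))" by (rule F)
    then have "((\<lambda>x. F (x + ?h)) has_real_derivative f (x + ?h)) (at x)" by (simp add: DERIV_shift)
    then have "((\<lambda>x. (F (x + ?h) - F x) / ?h) has_real_derivative (f (x + ?h) - f x) / ?h) (at x)"
      by (intro DERIV_cdivide DERIV_diff F)
    then show "(v 0 has_real_derivative v 1 x) (at x)" unfolding v1 by (simp add: v_def Q_def[abs_def])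
  qed
  ultimately have "jet v" by (simp add: jet_def)
  moreover have "c * (LINT x|lborel. (v 0 x)\<^sup>2) + b * (LINT x|lborel. (v 1 x)\<^sup>2)
      \<le> c * (LINT x|lborel. (f x)\<^sup>2) + b * (LINT x|lborel. (f1 x)\<^sup>2)"
  proof (intro add_mono mult_left_mono bc)
    show "(LINT x|lborel. (v 0 x)\<^sup>2) \<le> (LINT x|lborel. (f x)\<^sup>2)"
      using difference_quotient_L2(2)[OF H1_pairD(1)[OF f] P hp] by (simp add: v_def Q_def)
    show "(LINT x|lborel. (v 1 x)\<^sup>2) \<le> (LINT x|lborel. (f1 x)\<^sup>2)"
      unfolding v1 by (rule difference_quotient_L2(2)[OF H1_pairD(2,3)[OF f] hp])
  qed
  moreover have "v 0 = Q ?h" by (simp add: v_def)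
  ultimately show ?thesis using n by (intro exI[of _ v] conjI) auto
qed

section \<open>From weak derivatives to absolutely continuous representatives\<close>

lemma Hk_1_wderiv:
  assumes "Hk 1 \<psi>" shows "L2 \<psi>" "L2 (wderiv \<psi>)" "weak_deriv \<psi> (wderiv \<psi>)"
proof -
  obtain D where D: "D 0 = \<psi>" "\<forall>j\<le>1. L2 (D j)" "\<forall>j<1. weak_deriv (D j) (D (Suc j))"
    using assms by (auto simp: Hk_def)
  then have "L2 (D 1)" "weak_deriv \<psi> (D 1)" "L2 (D 0)" by auto
  then show "L2 \<psi>" "L2 (wderiv \<psi>)" "weak_deriv \<psi> (wderiv \<psi>)"
    using wderiv_AE_eq D(1) by auto
qed

text \<open>The chosen \<open>wderiv \<psi>\<close> may differ on a null set from the witness in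
  \<open>Hk\<close>, so the second weak derivative has to be carried across almost everywhere
  equality.\<close>

lemma Hk_2_wderiv:
  assumes "Hk 2 \<psi>" shows "Hk 1 \<psi>" "Hk 1 (wderiv \<psi>)"
proof -
  obtain D where D: "D 0 = \<psi>" "\<forall>j\<le>2. L2 (D j)" "\<forall>j<2. weak_deriv (D j) (D (Suc j))"
    using assms by (auto simp: Hk_def)
  then show "Hk 1 \<psi>" unfolding Hk_def by (intro exI[of _ D]) auto
  have L: "L2 (D 1)" "L2 (D 2)" "weak_deriv \<psi> (D 1)" "weak_deriv (D 1) (D 2)"
    using D by (auto simp: numeral_2_eq_2)
  note W = wderiv_AE_eq[OF L(1,3)]
  have "AE x in lborel. D 1 x = wderiv \<psi> x" using W(3) by eventually_elim simp
  then have "weak_deriv (wderiv \<psi>) (D 2)"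
    by (rule weak_deriv_cong_AE[OF L(4)])
       (use L2D(1)[OF L(1)] L2D(1)[OF L(2)] L2D(1)[OF W(1)] in simp_all)
  then show "Hk 1 (wderiv \<psi>)"
    unfolding Hk_def using L W by (intro exI[of _ "\<lambda>j. if j = 0 then wderiv \<psi> else D 2"]) auto
qed

lemma Hk_1_H1_pair:
  assumes "Hk 1 \<psi>"
  obtains f where "H1_pair f (wderiv \<psi>)" "AE x in lborel. \<psi> x = f x"
proof -
  note W = Hk_1_wderiv[OF assms]
  obtain f where f: "primitive f (wderiv \<psi>)" "AE x in lborel. \<psi> x = f x"
    by (rule weak_deriv_primitive[OF L2_locally_integrable[OF W(1)] L2_locally_integrable[OF W(2)] W(3)])
  have "L2 f"
    by (rule L2_cong_AE[OF W(1) f(2) primitive_measurable[OF L2_locally_integrable[OF W(2)] f(1)]])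
  then show ?thesis using that f W by (simp add: H1_pair_def)
qed

lemma H1_pair_Hk_1: "H1_pair f g \<Longrightarrow> Hk 1 f"
  unfolding Hk_def by (intro exI[of _ "\<lambda>j. if j = 0 then f else g"]) (auto dest: H1_pairD)

lemma jet_Hk_2:
  assumes "jet v" shows "Hk 2 (v 0)"
proof -
  have "H1_pair (v 0) (v 1)" "H1_pair (v 1) (v 2)" using assms by (auto simp: jet_def)
  note W = H1_pairD(5)[OF this(1)] H1_pairD(5)[OF this(2)]
  show ?thesis
    unfolding Hk_def
  proof (intro exI[of _ v] conjI allI impI)
    fix j :: nat assume "j \<le> 2"
    then show "L2 (v j)" by (intro jet_L2[OF assms]) simp
  next
    fix j :: nat assume "j < 2"
    then have "j = 0 \<or> j = 1" by auto
    then show "weak_deriv (v j) (v (Suc j))" using W by (auto simp: numeral_2_eq_2)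
  qed simp
qed

lemma H1_pair_wderiv: "H1_pair f g \<Longrightarrow> AE x in lborel. wderiv f x = g x" "H1_pair f g \<Longrightarrow> L2 (wderiv f)"
  by (rule wderiv_AE_eq[OF H1_pairD(2,5)], assumption, assumption)+

text \<open>Function and first derivative are both replaced by continuous representatives; the
  primitive relation between them survives because integrals ignore null sets.\<close>

lemma Hk_2_jet:
  assumes "Hk 2 \<psi>"
  obtains v where "jet v" "AE x in lborel. \<psi> x = v 0 x" "AE x in lborel. wderiv \<psi> x = v 1 x"
    "v 2 = wderiv (wderiv \<psi>)"
proof -
  note H = Hk_2_wderiv[OF assms]
  obtain f where f: "H1_pair f (wderiv \<psi>)" "AE x in lborel. \<psi> x = f x" by (rule Hk_1_H1_pair[OF H(1)])
  obtain f1 where f1: "H1_pair f1 (wderiv (wderiv \<psi>))" "AE x in lborel. wderiv \<psi> x = f1 x"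
    by (rule Hk_1_H1_pair[OF H(2)])
  have "primitive f f1"
    unfolding primitive_def
  proof (intro allI impI)
    fix x y :: real assume "x \<le> y"
    then have "f y - f x = (LINT t:{x..y}|lborel. wderiv \<psi> t)"
      using H1_pairD(3)[OF f(1)] by (simp add: primitive_def)
    also have "\<dots> = (LINT t:{x..y}|lborel. f1 t)"
      unfolding set_lebesgue_integral_def
    proof (rule integral_cong_AE)
      show "AE t in lborel. indicator {x..y} t *\<^sub>R wderiv \<psi> t = indicator {x..y} t *\<^sub>R f1 t"
        using f1(2) by eventually_elim simp
    qed (use L2D(1)[OF H1_pairD(2)[OF f(1)]] L2D(1)[OF H1_pairD(1)[OF f1(1)]] in auto)
    finally show "f y - f x = (LINT t:{x..y}|lborel. f1 t)" .
  qed
  then have "H1_pair f f1" using H1_pairD[OF f(1)] H1_pairD[OF f1(1)] by (simp add: H1_pair_def)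
  then have "jet (\<lambda>i. if i = 0 then f else if i = 1 then f1 else wderiv (wderiv \<psi>))"
    using f1(1) by (simp add: jet_def)
  from that[OF this] show ?thesis using f f1 by simp
qed

lemma integral_weight_square_cong:
  assumes "AE x in lborel. f x = h x" "k \<in> borel_measurable borel" "f \<in> borel_measurable borel" "h \<in> borel_measurable borel"
  shows "(LINT x|lborel. k x * (f x)\<^sup>2) = (LINT x|lborel. k x * ((h x)\<^sup>2 :: real))"
proof (rule integral_cong_AE)
  show "AE x in lborel. k x * (f x)\<^sup>2 = k x * (h x)\<^sup>2" using assms(1) by eventually_elim simp
qed (use assms in simp_all)

lemma test_fun_smooth_bounded:
  assumes "test_fun p" shows "smooth_bounded p"
proof
  fix k show "smooth_upto bounded_fun k p"
    using assms
  proof (induction k arbitrary: p)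
    case (Suc k)
    then have C: "C_inf p" by (simp add: test_fun_def)
    obtain B where "\<And>x. \<bar>p x\<bar> \<le> B" using test_fun_bounded[OF Suc.prems] by blast
    then have "bounded_fun p"
      unfolding bounded_fun_def using C by (auto intro!: borel_measurable_continuous_onI C_inf_continuous_on)
    then show ?case
      using Suc C by (simp add: C_inf_differentiable test_fun_deriv)
  qed simp
qed

lemma test_fun_H1_pair: "test_fun p \<Longrightarrow> H1_pair p (deriv p)"
  using jet_test_fun[of p] by (simp add: jet_def)

text \<open>A supremum above \<kappa> provides an admissible function with quotient above \<kappa>,
  and clearing denominators gives the negative energy. The supremum ranges over H^1 whereas the
  energy lives on jets, hence the averaging at the end.\<close>

lemma horizontal_trial_function:
  assumes g: "g > 0" and r: "test_fun r" and M: "M \<noteq> 0" and x1: "\<xi>1 \<noteq> 0" and \<kappa>: "\<kappa> > 0"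
    and lt: "\<kappa> < Sup {((g * \<kappa> * (LINT x|lborel. r x * (\<psi> x)\<^sup>2)) / (M * \<xi>1)\<^sup>2
        - (LINT x|lborel. (wderiv \<psi> x)\<^sup>2)) / (LINT x|lborel. (\<psi> x)\<^sup>2) | \<psi>. Hk 1 \<psi> \<and> nonzero_L2 \<psi>}"
  shows "\<exists>v. jet v \<and> (M * \<xi>1)\<^sup>2 * \<kappa> * (LINT x|lborel. (v 0 x)\<^sup>2) + (M * \<xi>1)\<^sup>2 * (LINT x|lborel. (v 1 x)\<^sup>2)
      < (LINT x|lborel. (g * \<kappa> * r x) * (v 0 x)\<^sup>2)"
proof -
  let ?S = "{((g * \<kappa> * (LINT x|lborel. r x * (\<psi> x)\<^sup>2)) / (M * \<xi>1)\<^sup>2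
        - (LINT x|lborel. (wderiv \<psi> x)\<^sup>2)) / (LINT x|lborel. (\<psi> x)\<^sup>2) | \<psi>. Hk 1 \<psi> \<and> nonzero_L2 \<psi>}"
  \<comment> \<open>Only for a nonempty set does a number below the supremum lie below some
    element.\<close>
  have "?S \<noteq> {}"
  proof -
    obtain p where p: "test_fun p" "(LINT x|lborel. p x) = 1" by (rule test_fun_normalized)
    have "nonzero_L2 p"
      unfolding nonzero_L2_def using p(2) integral_eq_zero_AE[of p lborel] by auto
    moreover have "Hk 1 p" by (rule H1_pair_Hk_1[OF test_fun_H1_pair[OF p(1)]])
    ultimately show ?thesis by blast
  qed
  from less_cSupD[OF this lt] obtain \<psi> where \<psi>: "Hk 1 \<psi>"
    and q: "\<kappa> < ((g * \<kappa> * (LINT x|lborel. r x * (\<psi> x)\<^sup>2)) / (M * \<xi>1)\<^sup>2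
        - (LINT x|lborel. (wderiv \<psi> x)\<^sup>2)) / (LINT x|lborel. (\<psi> x)\<^sup>2)"
    by blast
  define N J I where "N = (LINT x|lborel. (\<psi> x)\<^sup>2)" and "J = (LINT x|lborel. (wderiv \<psi> x)\<^sup>2)"
    and "I = (LINT x|lborel. r x * (\<psi> x)\<^sup>2)"
  define b where "b = (M * \<xi>1)\<^sup>2"
  have b: "b > 0" using M x1 by (simp add: b_def)
  have "N \<ge> 0" by (simp add: N_def)
  \<comment> \<open>Division by zero gives 0, so a vanishing denominator would make the quotient 0,
    contradicting that it exceeds \<kappa> > 0.\<close>
  moreover have "N \<noteq> 0"
  proof
    assume "N = 0" then show False using q \<kappa> by (simp add: N_def)
  qed
  ultimately have N: "N > 0" by simp
  have "\<kappa> * N < g * \<kappa> * I / b - J"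
    using q N by (simp add: N_def[symmetric] J_def[symmetric] I_def[symmetric] b_def[symmetric] pos_less_divide_eq)
  then have "b * (\<kappa> * N) < b * (g * \<kappa> * I / b - J)" using b by (rule mult_strict_left_mono)
  then have key: "b * \<kappa> * N + b * J < g * \<kappa> * I" using b by (simp add: right_diff_distrib mult.assoc)
  obtain f where f: "H1_pair f (wderiv \<psi>)" "AE x in lborel. \<psi> x = f x" by (rule Hk_1_H1_pair[OF \<psi>])
  have m: "\<psi> \<in> borel_measurable borel" "f \<in> borel_measurable borel" "r \<in> borel_measurable borel"
    using L2D(1)[OF Hk_1_wderiv(1)[OF \<psi>]] L2D(1)[OF H1_pairD(1)[OF f(1)]] L2D(1)[OF test_fun_L2[OF r]] by auto
  have "N = (LINT x|lborel. (f x)\<^sup>2)" "I = (LINT x|lborel. r x * (f x)\<^sup>2)"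
    using integral_weight_square_cong[OF f(2), of "\<lambda>_. 1"] integral_weight_square_cong[OF f(2), of r] m
    by (simp_all add: N_def I_def)
  then have "b * \<kappa> * (LINT x|lborel. (f x)\<^sup>2) + b * (LINT x|lborel. (wderiv \<psi> x)\<^sup>2)
      < (LINT x|lborel. (g * \<kappa> * r x) * (f x)\<^sup>2)"
    using key by (simp add: J_def mult.assoc)
  then show ?thesis
    unfolding b_def[symmetric] using b \<kappa> test_fun_integrable[OF r]
    by (intro H1_trial_smoothing[OF f(1)]) auto
qed

text \<open>For \<xi>1 = 0 a horizontal field exerts no restoring force on the mode, so any bump
  supported where the density increases has negative energy at growth rate zero.\<close>

lemma nonmagnetic_trial_function:
  assumes g: "g > 0" and r: "test_fun r" "r x0 > 0"
  shows "\<exists>v. jet v \<and> 0 < (LINT x|lborel. (g * r x) * (v 0 x)\<^sup>2)"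
proof -
  have cr: "continuous_on UNIV r" using r(1) by (simp add: test_fun_def C_inf_continuous_on)
  then have "open {x. r x > 0}" by (intro open_Collect_less continuous_on_const)
  then obtain d where d: "d > 0" "ball x0 d \<subseteq> {x. r x > 0}"
    using r(2) open_contains_ball by blast
  define p where "p = bump (x0 - d) (x0 + d) 1"
  have p: "test_fun p" unfolding p_def by (rule test_fun_bump) simp
  have nn: "0 \<le> (g * r x) * (p x)\<^sup>2" for x
  proof (cases "x \<in> ball x0 d")
    case True
    then have "r x > 0" using d by auto
    then show ?thesis using g by simp
  next
    case False
    then have "p x = 0" by (auto simp: p_def bump_eq dist_real_def)
    then show ?thesis by simp
  qed
  have cp: "continuous_on UNIV p" using p by (simp add: test_fun_def C_inf_continuous_on)
  have int: "integrable lborel (\<lambda>x. (g * r x) * (p x)\<^sup>2)"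
    unfolding power2_eq_square using p r(1)
    by (intro integrable_mult_test_fun test_fun_mult locally_integrable_continuous continuous_intros cr) (auto simp: test_fun_def)
  have "(LINT x|lborel. (g * r x) * (p x)\<^sup>2) \<noteq> 0"
  proof
    assume "(LINT x|lborel. (g * r x) * (p x)\<^sup>2) = 0"
    then have "AE x in lborel. (g * r x) * (p x)\<^sup>2 = 0"
      using int nn by (subst (asm) integral_nonneg_eq_0_iff_AE) auto
    then have "(g * r x0) * (p x0)\<^sup>2 = 0"
      by (rule continuous_AE_zero_imp_zero[rotated]) (intro continuous_intros cr cp)
    then show False using g r(2) d by (simp add: p_def bump_eq)
  qed
  moreover have "0 \<le> (LINT x|lborel. (g * r x) * (p x)\<^sup>2)" using nn by (rule Bochner_Integration.integral_nonneg)
  ultimately show ?thesis using jet_test_fun[OF p] by (intro exI[of _ "\<lambda>i. (deriv ^^ i) p"]) auto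
qed

lemma Mc_less_iff:
  assumes "ereal \<bar>M\<bar> < Mc g \<rho>" shows "ereal (M\<^sup>2) < Mc_sq g \<rho>"
proof (cases "Mc_sq g \<rho>")
  case (real r)
  then have "\<bar>M\<bar> < sqrt r" using assms by (simp add: Mc_def)
  then have "sqrt (M\<^sup>2) < sqrt r" by simp
  then show ?thesis using real by (simp only: real_sqrt_less_iff ereal_less_eq less_ereal.simps)
next
  \<comment> \<open>Here \<open>Mc\<close> is sqrt 0 = 0, since \<open>real_of_ereal\<close> sends
    minus infinity to 0, and no absolute value lies below it.\<close>
  case MInf
  then show ?thesis using assms by (simp add: Mc_def)
qed simp

lemma vc_quot_eq:
  assumes r: "test_fun (deriv \<rho>)" and \<psi>: "Hk 1 \<psi>" and f: "AE x in lborel. \<psi> x = f x" "AE x in lborel. wderiv \<psi> x = f1 x"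
    and L: "L2 f" "L2 f1"
  shows "vc_quot g \<rho> M \<psi> = (LINT x|lborel. (g * deriv \<rho> x) * (f x)\<^sup>2) - M\<^sup>2 * (LINT x|lborel. (f1 x)\<^sup>2)"
proof -
  note W = Hk_1_wderiv[OF \<psi>]
  have m[measurable]: "deriv \<rho> \<in> borel_measurable borel" by (rule L2D(1)[OF test_fun_L2[OF r]])
  note [measurable] = L2D(1)[OF W(1)] L2D(1)[OF W(2)] L[THEN L2D(1)]
  obtain B where B: "\<And>x. \<bar>deriv \<rho> x\<bar> \<le> B" using test_fun_bounded[OF r] by blast
  have "integrable lborel (\<lambda>x. g * (deriv \<rho> x * f x * f x))"
    by (intro integrable_mult_right integrable_bounded_mult_L2[OF L(1,1) m B])
  then have int: "integrable lborel (\<lambda>x. (g * deriv \<rho> x) * (f x)\<^sup>2)"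
    by (simp add: power2_eq_square mult.assoc)
  have "vc_quot g \<rho> M \<psi> = (LINT x|lborel. (g * deriv \<rho> x) * (f x)\<^sup>2 - M\<^sup>2 * (f1 x)\<^sup>2)"
    unfolding vc_quot_def
  proof (rule integral_cong_AE)
    show "AE x in lborel. g * deriv \<rho> x * (\<psi> x)\<^sup>2 - M\<^sup>2 * (wderiv \<psi> x)\<^sup>2 = g * deriv \<rho> x * (f x)\<^sup>2 - M\<^sup>2 * (f1 x)\<^sup>2"
      using f by eventually_elim simp
  qed simp_all
  then show ?thesis using int L2D(2)[OF L(2)] by simp
qed

text \<open>The bound on M makes \<open>M_vc\<close> nonempty, so that its infimum carries
  information; averaging is needed because \<open>Mc\<close> ranges over H^1 and \<open>M_vc\<close>
  over H^2. A function with quotient below k^2 then yields the inequality on multiplying by the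
  positive denominator.\<close>

lemma vertical_trial_function:
  assumes g: "g > 0" and r: "test_fun (deriv \<rho>)" and M: "ereal \<bar>M\<bar> < Mc g \<rho>"
    and lt: "xi_vc g \<rho> M < k"
  shows "\<exists>v. jet v \<and> M\<^sup>2 * k\<^sup>2 * (LINT x|lborel. (v 1 x)\<^sup>2) + M\<^sup>2 * (LINT x|lborel. (v 2 x)\<^sup>2)
      < (LINT x|lborel. (g * k\<^sup>2 * deriv \<rho> x) * (v 0 x)\<^sup>2)"
proof -
  have mr: "deriv \<rho> \<in> borel_measurable borel" by (rule L2D(1)[OF test_fun_L2[OF r]])
  have ir: "integrable lborel (\<lambda>x. g * deriv \<rho> x)" using test_fun_integrable[OF r] by simp
  have "\<exists>\<psi>. \<psi> \<in> M_vc g \<rho> M"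
  proof -
    obtain \<psi> where \<psi>: "Hk 1 \<psi>"
      and q: "M\<^sup>2 < (LINT x|lborel. g * deriv \<rho> x * (\<psi> x)\<^sup>2) / (LINT x|lborel. (wderiv \<psi> x)\<^sup>2)"
      using Mc_less_iff[OF M] unfolding Mc_sq_def less_SUP_iff by auto
    obtain f where f: "H1_pair f (wderiv \<psi>)" "AE x in lborel. \<psi> x = f x" by (rule Hk_1_H1_pair[OF \<psi>])
    define J where "J = (LINT x|lborel. (wderiv \<psi> x)\<^sup>2)"
    \<comment> \<open>The quotient would be 0 by the convention for division by zero, yet it exceeds
      M^2.\<close>
    have "J \<noteq> 0"
    proof
      assume "J = 0" then have "M\<^sup>2 < 0" using q by (simp add: J_def)
      then show False by simp
    qed
    moreover have "J \<ge> 0" by (simp add: J_def)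
    ultimately have J: "J > 0" by simp
    have "(LINT x|lborel. g * deriv \<rho> x * (\<psi> x)\<^sup>2) = (LINT x|lborel. g * deriv \<rho> x * (f x)\<^sup>2)"
      using mr L2D(1)[OF Hk_1_wderiv(1)[OF \<psi>]] L2D(1)[OF H1_pairD(1)[OF f(1)]]
      by (intro integral_weight_square_cong[OF f(2)]) auto
    then have "0 * (LINT x|lborel. (f x)\<^sup>2) + M\<^sup>2 * (LINT x|lborel. (wderiv \<psi> x)\<^sup>2) < (LINT x|lborel. (g * deriv \<rho> x) * (f x)\<^sup>2)"
      using q J by (simp add: J_def[symmetric] pos_less_divide_eq)
    from H1_trial_smoothing[OF f(1) _ _ ir this] obtain v where
      v: "jet v" "M\<^sup>2 * (LINT x|lborel. (v 1 x)\<^sup>2) < (LINT x|lborel. (g * deriv \<rho> x) * (v 0 x)\<^sup>2)" by auto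
    have H: "H1_pair (v 0) (v 1)" using v(1) by (simp add: jet_def)
    have "vc_quot g \<rho> M (v 0) = (LINT x|lborel. (g * deriv \<rho> x) * (v 0 x)\<^sup>2) - M\<^sup>2 * (LINT x|lborel. (v 1 x)\<^sup>2)"
      by (rule vc_quot_eq[OF r H1_pair_Hk_1[OF H] _ H1_pair_wderiv(1)[OF H] H1_pairD(1,2)[OF H]]) simp
    then have "v 0 \<in> M_vc g \<rho> M" using v jet_Hk_2[OF v(1)] by (simp add: M_vc_def)
    then show ?thesis by blast
  qed
  then have ne: "(\<lambda>\<psi>. M\<^sup>2 * (LINT x|lborel. (wderiv (wderiv \<psi>) x)\<^sup>2) / vc_quot g \<rho> M \<psi>) ` M_vc g \<rho> M \<noteq> {}"
    by blast
  have "Inf ((\<lambda>\<psi>. M\<^sup>2 * (LINT x|lborel. (wderiv (wderiv \<psi>) x)\<^sup>2) / vc_quot g \<rho> M \<psi>) ` M_vc g \<rho> M) < k\<^sup>2"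
  \<comment> \<open>\<open>sqrt\<close> is monotone on all reals, so the comparison works without
    knowing the sign of the infimum or of k.\<close>
  proof (rule ccontr)
    let ?I = "Inf ((\<lambda>\<psi>. M\<^sup>2 * (LINT x|lborel. (wderiv (wderiv \<psi>) x)\<^sup>2) / vc_quot g \<rho> M \<psi>) ` M_vc g \<rho> M)"
    assume "\<not> ?I < k\<^sup>2"
    then have "sqrt (k\<^sup>2) \<le> sqrt ?I" by (intro real_sqrt_le_mono) simp
    then have "\<bar>k\<bar> \<le> sqrt ?I" by (simp only: real_sqrt_abs)
    then show False using lt unfolding xi_vc_def by linarith
  qed
  from cInf_lessD[OF ne this] obtain \<psi> where \<psi>: "\<psi> \<in> M_vc g \<rho> M"
    and q: "M\<^sup>2 * (LINT x|lborel. (wderiv (wderiv \<psi>) x)\<^sup>2) / vc_quot g \<rho> M \<psi> < k\<^sup>2" by auto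
  have H2: "Hk 2 \<psi>" and vq: "vc_quot g \<rho> M \<psi> > 0" using \<psi> by (auto simp: M_vc_def)
  obtain v where v: "jet v" "AE x in lborel. \<psi> x = v 0 x" "AE x in lborel. wderiv \<psi> x = v 1 x" "v 2 = wderiv (wderiv \<psi>)"
    by (rule Hk_2_jet[OF H2])
  have e: "vc_quot g \<rho> M \<psi> = (LINT x|lborel. (g * deriv \<rho> x) * (v 0 x)\<^sup>2) - M\<^sup>2 * (LINT x|lborel. (v 1 x)\<^sup>2)"
    by (rule vc_quot_eq[OF r Hk_2_wderiv(1)[OF H2] v(2,3)]) (rule jet_L2[OF v(1)], simp)+
  define I N1 N2 where "I = (LINT x|lborel. (g * deriv \<rho> x) * (v 0 x)\<^sup>2)"
    and "N1 = (LINT x|lborel. (v 1 x)\<^sup>2)" and "N2 = (LINT x|lborel. (v 2 x)\<^sup>2)"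
  have "M\<^sup>2 * N2 < k\<^sup>2 * (I - M\<^sup>2 * N1)"
    using q vq by (simp only: e[folded I_def N1_def, symmetric] N2_def v(4) pos_divide_less_eq)
  then have "M\<^sup>2 * k\<^sup>2 * N1 + M\<^sup>2 * N2 < k\<^sup>2 * I"
    by (simp add: algebra_simps)
  moreover have "k\<^sup>2 * I = (LINT x|lborel. (g * k\<^sup>2 * deriv \<rho> x) * (v 0 x)\<^sup>2)"
  proof -
    have "(g * k\<^sup>2 * deriv \<rho> x) * (v 0 x)\<^sup>2 = k\<^sup>2 * ((g * deriv \<rho> x) * (v 0 x)\<^sup>2)" for x by simp
    then show ?thesis unfolding I_def by (simp only: integral_mult_right_zero)
  qed
  ultimately show ?thesis using v(1) unfolding N1_def N2_def by (intro exI[of _ v] conjI) simp_all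
qed

section \<open>Normal modes\<close>

text \<open>The positive part of |\<rho>| - C is continuous and vanishes almost everywhere, hence
  everywhere. The lower bound is recorded because the infimum of a set of reals is a lower bound
  only if one exists.\<close>

lemma smooth_bounded_density:
  assumes d: "\<forall>x. \<rho> differentiable (at x)" and b: "\<exists>C. AE x in lborel. \<bar>\<rho> x\<bar> \<le> C"
    and r: "test_fun (deriv \<rho>)"
  shows "smooth_bounded \<rho>" "bdd_below (range \<rho>)"
proof -
  have D: "(\<rho> has_real_derivative deriv \<rho> x) (at x)" for x
    using d differentiable_DERIV_deriv by auto
  have c: "continuous_on UNIV \<rho>"
    by (auto intro!: continuous_at_imp_continuous_on DERIV_isCont D)
  obtain C where C: "AE x in lborel. \<bar>\<rho> x\<bar> \<le> C" using b by blast
  have "max (\<bar>\<rho> x\<bar> - C) 0 = 0" for x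
  proof (rule continuous_AE_zero_imp_zero[where f = "\<lambda>x. max (\<bar>\<rho> x\<bar> - C) 0"])
    show "continuous_on UNIV (\<lambda>x. max (\<bar>\<rho> x\<bar> - C) 0)" by (intro continuous_intros c)
    show "AE x in lborel. max (\<bar>\<rho> x\<bar> - C) 0 = 0" using C by eventually_elim auto
  qed
  then have C': "\<bar>\<rho> x\<bar> \<le> C" for x by (metis diff_le_0_iff_le max.cobounded1)
  have "- C \<le> \<rho> x" for x using C'[of x] by linarith
  then show "bdd_below (range \<rho>)" by (auto simp: bdd_below_def)
  have bf: "bounded_fun \<rho>"
    unfolding bounded_fun_def using C' c by (auto intro: borel_measurable_continuous_onI)
  show "smooth_bounded \<rho>"
  proof
    fix k show "smooth_upto bounded_fun k \<rho>"
    proof (cases k)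
      case (Suc n)
      show ?thesis unfolding Suc
        by (rule smooth_upto_SucI[where f' = "deriv \<rho>"])
           (fact D, fact bf, rule test_fun_smooth_bounded[OF r, rule_format])
    qed simp
  qed
qed

lemma deriv_cmult_C_inf: "C_inf f \<Longrightarrow> deriv (\<lambda>x. t * f x) = (\<lambda>x. t * deriv f x)"
  by (intro deriv_eqI DERIV_cmult C_inf_DERIV)

lemma trial_function_exists:
  fixes \<xi> :: "real \<times> real"
  assumes g: "g > 0" and r: "test_fun (deriv \<rho>)" and x0: "deriv \<rho> x0 > 0"
    and M: "admissible_M d g \<rho> M" and \<xi>: "\<xi> \<in> Ag d g \<rho> M"
  defines "a \<equiv> (case d of Horizontal \<Rightarrow> 0 | Vertical \<Rightarrow> M\<^sup>2)"
    and "b \<equiv> (case d of Horizontal \<Rightarrow> (M * fst \<xi>)\<^sup>2 | Vertical \<Rightarrow> M\<^sup>2 * (norm \<xi>)\<^sup>2)"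
    and "c \<equiv> (case d of Horizontal \<Rightarrow> (M * fst \<xi>)\<^sup>2 * (norm \<xi>)\<^sup>2 | Vertical \<Rightarrow> 0)"
  shows "norm \<xi> > 0 \<and> (\<exists>v. jet v \<and>
    (LINT x|lborel. c * (v 0 x)\<^sup>2) + (LINT x|lborel. b * (v 1 x)\<^sup>2) + (LINT x|lborel. a * (v 2 x)\<^sup>2)
        < (LINT x|lborel. (g * (norm \<xi>)\<^sup>2 * deriv \<rho> x) * (v 0 x)\<^sup>2))"
proof (cases d)
  case Horizontal
  have mem: "\<xi> \<in> Ag_hor g \<rho> M" and M0: "M \<noteq> 0"
    using \<xi> M Horizontal by (auto simp: Ag_def admissible_M_def)
  then have pos: "norm \<xi> > 0" by (auto simp: Ag_hor_def zero_prod_def)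
  show ?thesis
  proof (cases "fst \<xi> = 0")
    case True
    have "g * (norm \<xi>)\<^sup>2 > 0" using g pos by simp
    from nonmagnetic_trial_function[OF this r x0] show ?thesis
      using True Horizontal pos by (simp add: a_def b_def c_def)
  next
    case False
    then have "norm \<xi> < S_hor g \<rho> M \<xi>" using mem by (auto simp: Ag_hor_def)
    then have "sqrt ((norm \<xi>)\<^sup>2) < S_hor g \<rho> M \<xi>" by simp
    then have lt: "(norm \<xi>)\<^sup>2 < Sup {((g * (norm \<xi>)\<^sup>2 * (LINT x|lborel. deriv \<rho> x * (\<psi> x)\<^sup>2)) / (M * fst \<xi>)\<^sup>2
        - (LINT x|lborel. (wderiv \<psi> x)\<^sup>2)) / (LINT x|lborel. (\<psi> x)\<^sup>2) | \<psi>. Hk 1 \<psi> \<and> nonzero_L2 \<psi>}"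
      unfolding S_hor_def real_sqrt_less_iff .
    have "(norm \<xi>)\<^sup>2 > 0" using pos by simp
    from horizontal_trial_function[OF g r M0 False this lt] show ?thesis
      using Horizontal pos by (simp add: a_def b_def c_def)
  qed
next
  case Vertical
  have "xi_vc g \<rho> M < norm \<xi>" and Mc: "ereal \<bar>M\<bar> < Mc g \<rho>"
    using \<xi> M Vertical by (auto simp: Ag_def Ag_ver_def admissible_M_def)
  note tr = vertical_trial_function[OF g r Mc this(1)]
  \<comment> \<open>At \<xi> = 0 the trial inequality would make M^2 times a square integral
    negative.\<close>
  have "norm \<xi> \<noteq> 0"
  proof
    assume z: "norm \<xi> = 0"
    from tr obtain v :: "nat \<Rightarrow> real \<Rightarrow> real" where "M\<^sup>2 * (LINT x|lborel. (v 2 x)\<^sup>2) < 0" by (auto simp: z)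
    moreover have "0 \<le> M\<^sup>2 * (LINT x|lborel. (v 2 x)\<^sup>2)" for v :: "nat \<Rightarrow> real \<Rightarrow> real" by simp
    ultimately show False by (meson not_less)
  qed
  then show ?thesis using tr Vertical by (simp add: a_def b_def c_def)
qed

text \<open>The weighted integral E is finite since \<rho> is bounded. If it vanished, then \<psi> =
  0 almost everywhere, contradicting the buoyancy normalization; so \<psi> may be divided by the
  square root of E.\<close>

lemma normalized_growing_mode_exists:
  fixes \<kappa> \<mu> a b c :: real
  assumes pos: "\<kappa> > 0" "\<mu> > 0" "a \<ge> 0" "b \<ge> 0" "c \<ge> 0"
    and \<rho>: "smooth_bounded \<rho>" "\<And>x. 0 < \<rho> x"
    and w: "smooth_bounded w" "integrable lborel w"
    and v0: "jet v0" "(LINT x|lborel. c * (v0 0 x)\<^sup>2) + (LINT x|lborel. b * (v0 1 x)\<^sup>2) + (LINT x|lborel. a * (v0 2 x)\<^sup>2)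
        < (LINT x|lborel. w x * (v0 0 x)\<^sup>2)"
  shows "\<exists>s>0. \<exists>\<psi>. smooth_L2 \<psi> \<and> (LINT x|lborel. \<rho> x * (\<kappa> * (\<psi> x)\<^sup>2 + (deriv \<psi> x)\<^sup>2)) = 1 \<and>
    (\<forall>x. (s * \<mu> + a) * deriv (deriv (deriv (deriv \<psi>))) x =
       s\<^sup>2 * deriv \<rho> x * deriv \<psi> x + (2 * s * \<mu> * \<kappa> + b + s\<^sup>2 * \<rho> x) * deriv (deriv \<psi>) x
       - (s * \<mu> * \<kappa>\<^sup>2 + c + s\<^sup>2 * \<kappa> * \<rho> x - w x) * \<psi> x)"
proof -
  have "\<exists>s>0. \<exists>\<psi>. smooth_L2 \<psi> \<and> (LINT x|lborel. w x * (\<psi> x)\<^sup>2) = 1 \<and>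
    (\<forall>x. (s * \<mu> + a) * deriv (deriv (deriv (deriv \<psi>))) x =
       s\<^sup>2 * deriv \<rho> x * deriv \<psi> x + (2 * s * \<mu> * \<kappa> + b + s\<^sup>2 * \<rho> x) * deriv (deriv \<psi>) x
       - (s * \<mu> * \<kappa>\<^sup>2 + c + s\<^sup>2 * \<kappa> * \<rho> x - w x) * \<psi> x)"
    by (rule growing_mode_exists[OF pos \<rho>(1) less_imp_le[OF \<rho>(2)] w v0])
  then obtain s \<psi> where s: "s > 0" and sm: "smooth_L2 \<psi>" and n1: "(LINT x|lborel. w x * (\<psi> x)\<^sup>2) = 1"
    and ode: "\<forall>x. (s * \<mu> + a) * deriv (deriv (deriv (deriv \<psi>))) x =
       s\<^sup>2 * deriv \<rho> x * deriv \<psi> x + (2 * s * \<mu> * \<kappa> + b + s\<^sup>2 * \<rho> x) * deriv (deriv \<psi>) x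
       - (s * \<mu> * \<kappa>\<^sup>2 + c + s\<^sup>2 * \<kappa> * \<rho> x - w x) * \<psi> x"
    by (elim exE conjE)
  note H = smooth_L2_H1_pair[OF sm]
  define E where "E = (\<lambda>x. \<rho> x * (\<kappa> * (\<psi> x)\<^sup>2 + (deriv \<psi> x)\<^sup>2))"
  obtain B where B: "\<rho> \<in> borel_measurable borel" "\<And>x. \<bar>\<rho> x\<bar> \<le> B"
    using smooth_upto_allD[OF \<rho>(1)] by (auto simp: bounded_fun_def)
  have "integrable lborel (\<lambda>x. \<kappa> * (\<rho> x * \<psi> x * \<psi> x) + \<rho> x * deriv \<psi> x * deriv \<psi> x)"
    by (intro Bochner_Integration.integrable_add integrable_mult_right
        integrable_bounded_mult_L2[OF H1_pairD(1)[OF H] H1_pairD(1)[OF H] B]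
        integrable_bounded_mult_L2[OF H1_pairD(2)[OF H] H1_pairD(2)[OF H] B])
  moreover have "E = (\<lambda>x. \<kappa> * (\<rho> x * \<psi> x * \<psi> x) + \<rho> x * deriv \<psi> x * deriv \<psi> x)"
    by (simp add: E_def fun_eq_iff power2_eq_square algebra_simps)
  ultimately have iE: "integrable lborel E" by simp
  have E0: "0 \<le> E x" for x using \<rho>(2)[of x] pos by (simp add: E_def)
  have "(LINT x|lborel. E x) \<noteq> 0"
  proof
    assume "(LINT x|lborel. E x) = 0"
    then have "AE x in lborel. E x = 0"
      using iE E0 by (subst (asm) integral_nonneg_eq_0_iff_AE) auto
    then have "AE x in lborel. w x * (\<psi> x)\<^sup>2 = 0"
    proof eventually_elim
      case (elim x)
      have "0 \<le> \<rho> x * (deriv \<psi> x)\<^sup>2" "0 \<le> \<rho> x * (\<kappa> * (\<psi> x)\<^sup>2)" using \<rho>(2)[of x] pos by simp_all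
      then have "\<rho> x * (\<kappa> * (\<psi> x)\<^sup>2) = 0" using elim by (simp only: E_def distrib_left)
      then have "\<psi> x = 0" using \<rho>(2)[of x] pos by simp
      then show ?case by simp
    qed
    then have "(LINT x|lborel. w x * (\<psi> x)\<^sup>2) = 0" by (rule integral_eq_zero_AE)
    then show False using n1 by simp
  qed
  moreover have "0 \<le> (LINT x|lborel. E x)" using E0 by (rule Bochner_Integration.integral_nonneg)
  ultimately have Epos: "(LINT x|lborel. E x) > 0" by simp
  define t where "t = 1 / sqrt (LINT x|lborel. E x)"
  define \<Psi> where "\<Psi> = (\<lambda>x. t * \<psi> x)"
  note C = smooth_upto_all_C_inf[OF sm]
  have d: "deriv \<Psi> = (\<lambda>x. t * deriv \<psi> x)" "deriv (deriv \<Psi>) = (\<lambda>x. t * deriv (deriv \<psi>) x)"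
    "deriv (deriv (deriv (deriv \<Psi>))) = (\<lambda>x. t * deriv (deriv (deriv (deriv \<psi>))) x)"
    unfolding \<Psi>_def by (simp_all add: deriv_cmult_C_inf C C_inf_deriv)
  have "smooth_L2 \<Psi>" unfolding \<Psi>_def by (rule smooth_L2_cmult[OF sm])
  moreover have "(LINT x|lborel. \<rho> x * (\<kappa> * (\<Psi> x)\<^sup>2 + (deriv \<Psi> x)\<^sup>2)) = 1"
  proof -
    have "\<rho> x * (\<kappa> * (\<Psi> x)\<^sup>2 + (deriv \<Psi> x)\<^sup>2) = t\<^sup>2 * E x" for x
      unfolding d by (simp add: \<Psi>_def E_def power_mult_distrib algebra_simps)
    then have "(LINT x|lborel. \<rho> x * (\<kappa> * (\<Psi> x)\<^sup>2 + (deriv \<Psi> x)\<^sup>2)) = t\<^sup>2 * (LINT x|lborel. E x)"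
      by (simp only: integral_mult_right_zero)
    then show ?thesis using Epos by (simp add: t_def power_divide)
  qed
  moreover have "\<forall>x. (s * \<mu> + a) * deriv (deriv (deriv (deriv \<Psi>))) x =
       s\<^sup>2 * deriv \<rho> x * deriv \<Psi> x + (2 * s * \<mu> * \<kappa> + b + s\<^sup>2 * \<rho> x) * deriv (deriv \<Psi>) x
       - (s * \<mu> * \<kappa>\<^sup>2 + c + s\<^sup>2 * \<kappa> * \<rho> x - w x) * \<Psi> x"
  proof
    fix x
    have "(s * \<mu> + a) * (t * deriv (deriv (deriv (deriv \<psi>))) x) = t * ((s * \<mu> + a) * deriv (deriv (deriv (deriv \<psi>))) x)"
      by simp
    also have "\<dots> = t * (s\<^sup>2 * deriv \<rho> x * deriv \<psi> x + (2 * s * \<mu> * \<kappa> + b + s\<^sup>2 * \<rho> x) * deriv (deriv \<psi>) x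
       - (s * \<mu> * \<kappa>\<^sup>2 + c + s\<^sup>2 * \<kappa> * \<rho> x - w x) * \<psi> x)"
      by (simp only: ode[rule_format])
    finally show "(s * \<mu> + a) * deriv (deriv (deriv (deriv \<Psi>))) x =
       s\<^sup>2 * deriv \<rho> x * deriv \<Psi> x + (2 * s * \<mu> * \<kappa> + b + s\<^sup>2 * \<rho> x) * deriv (deriv \<Psi>) x
       - (s * \<mu> * \<kappa>\<^sup>2 + c + s\<^sup>2 * \<kappa> * \<rho> x - w x) * \<Psi> x"
      by (subst d(3), subst d(2), subst d(1)) (simp add: \<Psi>_def algebra_simps)
  qed
  ultimately show ?thesis using s by (intro exI[of _ s] exI[of _ \<Psi>] conjI)
qed

theorem theorem2p2:
  fixes g \<mu> M :: real and rho :: "real \<Rightarrow> real" and d :: field_dir and \<xi> :: "real \<times> real"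
  assumes "g > 0" and "\<mu> > 0"
    and "\<forall>x. rho differentiable (at x)"
    and "\<exists>C. AE x in lborel. \<bar>rho x\<bar> \<le> C"
    and "C_inf (deriv rho)" and "compact (closure {x. deriv rho x \<noteq> 0})"
    and "(INF x. rho x) > 0"
    and "\<exists>x0. deriv rho x0 > 0"
    and "admissible_M d g rho M"
    and "\<xi> \<in> Ag d g rho M"
  shows "\<exists>lam>0. \<exists>\<phi> \<theta> \<psi> \<pi> :: real \<Rightarrow> real.
     Hinf \<phi> \<and> Hinf \<theta> \<and> Hinf \<psi> \<and> Hinf \<pi> \<and>
     C_inf \<phi> \<and> C_inf \<theta> \<and> C_inf \<psi> \<and> C_inf \<pi> \<and>
     (\<forall>x. lam\<^sup>2 * rho x * \<phi> x - lam * fst \<xi> * \<pi> x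
            + lam * \<mu> * ((norm \<xi>)\<^sup>2 * \<phi> x - deriv (deriv \<phi>) x) = M\<^sup>2 * B1 d \<xi> \<phi> \<theta> \<psi> x) \<and>
     (\<forall>x. lam\<^sup>2 * rho x * \<theta> x - lam * snd \<xi> * \<pi> x
            + lam * \<mu> * ((norm \<xi>)\<^sup>2 * \<theta> x - deriv (deriv \<theta>) x) = M\<^sup>2 * B2 d \<xi> \<phi> \<theta> \<psi> x) \<and>
     (\<forall>x. lam\<^sup>2 * rho x * \<psi> x + lam * deriv \<pi> x
            + lam * \<mu> * ((norm \<xi>)\<^sup>2 * \<psi> x - deriv (deriv \<psi>) x) - g * deriv rho x * \<psi> x
            = M\<^sup>2 * B3 d \<xi> \<phi> \<theta> \<psi> x) \<and>
     (\<forall>x. fst \<xi> * \<phi> x + snd \<xi> * \<theta> x + deriv \<psi> x = 0) \<and>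
     (\<phi> \<longlongrightarrow> 0) at_top \<and> (\<phi> \<longlongrightarrow> 0) at_bot \<and>
     (\<theta> \<longlongrightarrow> 0) at_top \<and> (\<theta> \<longlongrightarrow> 0) at_bot \<and>
     (\<psi> \<longlongrightarrow> 0) at_top \<and> (\<psi> \<longlongrightarrow> 0) at_bot \<and>
     \<psi> \<in> calA rho \<xi>"
proof -
  define \<kappa> where "\<kappa> = (norm \<xi>)\<^sup>2"
  \<comment> \<open>Tension is the squared derivative of the mode along the field: M \<xi>1 times
    the mode for a horizontal field, M times its x_3-derivative for a vertical one. With the factor
    \<kappa> it reads M^2 \<xi>1^2 (\<kappa> \<psi>^2 + \<psi>'^2), respectively M^2 (\<kappa>
    \<psi>'^2 + \<psi>''^2).\<close>
  define a where "a = (case d of Horizontal \<Rightarrow> 0 | Vertical \<Rightarrow> M\<^sup>2)"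
  define b where "b = (case d of Horizontal \<Rightarrow> (M * fst \<xi>)\<^sup>2 | Vertical \<Rightarrow> M\<^sup>2 * \<kappa>)"
  define c where "c = (case d of Horizontal \<Rightarrow> (M * fst \<xi>)\<^sup>2 * \<kappa> | Vertical \<Rightarrow> 0)"
  have r: "test_fun (deriv rho)" using assms by (simp add: test_fun_def)
  obtain x0 where x0: "deriv rho x0 > 0" using assms by blast
  note rho = smooth_bounded_density[OF assms(3,4) r]
  have rho_pos: "0 < rho x" for x
    using assms(7) cINF_lower[OF rho(2), of x] by simp
  have tr: "norm \<xi> > 0 \<and> (\<exists>v. jet v \<and>
    (LINT x|lborel. c * (v 0 x)\<^sup>2) + (LINT x|lborel. b * (v 1 x)\<^sup>2) + (LINT x|lborel. a * (v 2 x)\<^sup>2)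
        < (LINT x|lborel. (g * \<kappa> * deriv rho x) * (v 0 x)\<^sup>2))"
    unfolding a_def b_def c_def \<kappa>_def by (rule trial_function_exists[OF assms(1) r x0 assms(9,10)])
  then obtain v where v: "jet v"
    "(LINT x|lborel. c * (v 0 x)\<^sup>2) + (LINT x|lborel. b * (v 1 x)\<^sup>2) + (LINT x|lborel. a * (v 2 x)\<^sup>2)
        < (LINT x|lborel. (g * \<kappa> * deriv rho x) * (v 0 x)\<^sup>2)"
    by (elim conjE exE)
  have \<kappa>: "\<kappa> > 0" using tr by (simp add: \<kappa>_def)
  have abc: "a \<ge> 0" "b \<ge> 0" "c \<ge> 0"
    using \<kappa> by (auto simp: a_def b_def c_def split: field_dir.split)
  have w: "smooth_bounded (\<lambda>x. g * \<kappa> * deriv rho x)" "integrable lborel (\<lambda>x. g * \<kappa> * deriv rho x)"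
    using smooth_bounded_cmult[OF test_fun_smooth_bounded[OF r]] test_fun_integrable[OF r] by simp_all
  obtain s \<psi> where s: "s > 0" and sm: "smooth_L2 \<psi>"
    and n1: "(LINT x|lborel. rho x * (\<kappa> * (\<psi> x)\<^sup>2 + (deriv \<psi> x)\<^sup>2)) = 1"
    and ode: "\<forall>x. (s * \<mu> + a) * deriv (deriv (deriv (deriv \<psi>))) x =
       s\<^sup>2 * deriv rho x * deriv \<psi> x + (2 * s * \<mu> * \<kappa> + b + s\<^sup>2 * rho x) * deriv (deriv \<psi>) x
       - (s * \<mu> * \<kappa>\<^sup>2 + c + s\<^sup>2 * \<kappa> * rho x - g * \<kappa> * deriv rho x) * \<psi> x"
    using normalized_growing_mode_exists[OF \<kappa> assms(2) abc rho(1) rho_pos w v] by (elim exE conjE)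
  define \<psi>1 \<psi>2 \<psi>3 \<psi>4 where "\<psi>1 = deriv \<psi>" and "\<psi>2 = deriv \<psi>1" and "\<psi>3 = deriv \<psi>2" and "\<psi>4 = deriv \<psi>3"
  note \<psi>_defs = \<psi>1_def \<psi>2_def \<psi>3_def \<psi>4_def
  have sm1: "smooth_L2 \<psi>1" unfolding \<psi>1_def by (rule smooth_upto_all_deriv[OF sm])
  have sm2: "smooth_L2 \<psi>2" unfolding \<psi>2_def by (rule smooth_upto_all_deriv[OF sm1])
  have sm3: "smooth_L2 \<psi>3" unfolding \<psi>3_def by (rule smooth_upto_all_deriv[OF sm2])
  have D: "(\<psi>1 has_real_derivative \<psi>2 x) (at x)" "(\<psi>2 has_real_derivative \<psi>3 x) (at x)"
    "(\<psi>3 has_real_derivative \<psi>4 x) (at x)" "(rho has_real_derivative deriv rho x) (at x)" for x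
    unfolding \<psi>2_def \<psi>3_def \<psi>4_def
    by (rule C_inf_DERIV[OF smooth_upto_all_C_inf[OF sm1]] C_inf_DERIV[OF smooth_upto_all_C_inf[OF sm2]]
        C_inf_DERIV[OF smooth_upto_all_C_inf[OF sm3]] C_inf_DERIV[OF smooth_upto_all_C_inf[OF rho(1)]]
        C_inf_DERIV[OF smooth_upto_all_C_inf[OF sm1], unfolded \<psi>2_def]
        C_inf_DERIV[OF smooth_upto_all_C_inf[OF sm2], unfolded \<psi>3_def \<psi>2_def]
        C_inf_DERIV[OF smooth_upto_all_C_inf[OF sm3], unfolded \<psi>3_def \<psi>2_def])+
  define \<phi> where "\<phi> = (\<lambda>x. - fst \<xi> / \<kappa> * \<psi>1 x)"
  define \<theta> where "\<theta> = (\<lambda>x. - snd \<xi> / \<kappa> * \<psi>1 x)"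
  \<comment> \<open>The value that a horizontal momentum equation forces after its common factor, a
    component of \<xi>, is cancelled; the formula stays valid when that component is zero.\<close>
  define \<pi> where "\<pi> = (\<lambda>x. 1 / (s * \<kappa>) * ((- s\<^sup>2) * (rho x * \<psi>1 x) + ((- (s * \<mu> + a) * \<kappa>) * \<psi>1 x + (s * \<mu> + a) * \<psi>3 x)))"
  have sm\<phi>: "smooth_L2 \<phi>" unfolding \<phi>_def by (rule smooth_L2_cmult[OF sm1])
  have sm\<theta>: "smooth_L2 \<theta>" unfolding \<theta>_def by (rule smooth_L2_cmult[OF sm1])
  have sm\<pi>: "smooth_L2 \<pi>" unfolding \<pi>_def
    by (rule smooth_L2_cmult[OF smooth_L2_add[OF smooth_L2_cmult[OF smooth_L2_mult[OF rho(1) sm1]]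
          smooth_L2_add[OF smooth_L2_cmult[OF sm1] smooth_L2_cmult[OF sm3]]]])
  have d\<phi>: "deriv \<phi> = (\<lambda>x. - fst \<xi> / \<kappa> * \<psi>2 x)" "deriv (deriv \<phi>) = (\<lambda>x. - fst \<xi> / \<kappa> * \<psi>3 x)"
    and d\<theta>: "deriv \<theta> = (\<lambda>x. - snd \<xi> / \<kappa> * \<psi>2 x)" "deriv (deriv \<theta>) = (\<lambda>x. - snd \<xi> / \<kappa> * \<psi>3 x)"
  proof -
    show 1: "deriv \<phi> = (\<lambda>x. - fst \<xi> / \<kappa> * \<psi>2 x)" unfolding \<phi>_def by (intro deriv_eqI DERIV_cmult D)
    show "deriv (deriv \<phi>) = (\<lambda>x. - fst \<xi> / \<kappa> * \<psi>3 x)" unfolding 1 by (intro deriv_eqI DERIV_cmult D)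
    show 2: "deriv \<theta> = (\<lambda>x. - snd \<xi> / \<kappa> * \<psi>2 x)" unfolding \<theta>_def by (intro deriv_eqI DERIV_cmult D)
    show "deriv (deriv \<theta>) = (\<lambda>x. - snd \<xi> / \<kappa> * \<psi>3 x)" unfolding 2 by (intro deriv_eqI DERIV_cmult D)
  qed
  have "deriv \<pi> x = 1 / (s * \<kappa>) * ((- s\<^sup>2) * (deriv rho x * \<psi>1 x + \<psi>2 x * rho x) + ((- (s * \<mu> + a) * \<kappa>) * \<psi>2 x + (s * \<mu> + a) * \<psi>4 x))" for x
    unfolding \<pi>_def by (intro DERIV_imp_deriv DERIV_cmult DERIV_add DERIV_mult D)
  moreover have "s * \<kappa> * (1 / (s * \<kappa>) * T) = T" for T using s \<kappa> by simp
  ultimately have d\<pi>: "s * \<kappa> * deriv \<pi> x = (- s\<^sup>2) * (deriv rho x * \<psi>1 x + \<psi>2 x * rho x) + ((- (s * \<mu> + a) * \<kappa>) * \<psi>2 x + (s * \<mu> + a) * \<psi>4 x)" for x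
    by simp
  have \<pi>: "s * \<kappa> * \<pi> x = - s\<^sup>2 * (rho x * \<psi>1 x) - (s * \<mu> + a) * \<kappa> * \<psi>1 x + (s * \<mu> + a) * \<psi>3 x" for x
    using s \<kappa> by (simp add: \<pi>_def) (simp add: algebra_simps)
  have \<phi>: "\<kappa> * \<phi> x = - fst \<xi> * \<psi>1 x" "\<kappa> * deriv \<phi> x = - fst \<xi> * \<psi>2 x" "\<kappa> * deriv (deriv \<phi>) x = - fst \<xi> * \<psi>3 x" for x
    using \<kappa> by (simp add: \<phi>_def, simp add: d\<phi>(1), simp add: d\<phi>(2))
  have \<theta>: "\<kappa> * \<theta> x = - snd \<xi> * \<psi>1 x" "\<kappa> * deriv (deriv \<theta>) x = - snd \<xi> * \<psi>3 x" for x
    using \<kappa> by (simp add: \<theta>_def, simp add: d\<theta>(2))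
  have \<kappa>_eq: "\<kappa> = (fst \<xi>)\<^sup>2 + (snd \<xi>)\<^sup>2"
    by (cases \<xi>) (simp add: \<kappa>_def norm_Pair)
  have ode': "(s * \<mu> + a) * \<psi>4 x = s\<^sup>2 * deriv rho x * \<psi>1 x + (2 * s * \<mu> * \<kappa> + b + s\<^sup>2 * rho x) * \<psi>2 x
       - (s * \<mu> * \<kappa>\<^sup>2 + c + s\<^sup>2 * \<kappa> * rho x - g * \<kappa> * deriv rho x) * \<psi> x" for x
    unfolding \<psi>_defs by (rule ode[rule_format])
  \<comment> \<open>Each equation is verified after multiplication by \<kappa>, where \<phi>,
    \<theta> and \<pi> enter through identities without denominators.\<close>
  have cancel: "y = z" if "\<kappa> * y = \<kappa> * z" for y z :: real
    using that \<kappa> by simp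
  have e1: "s\<^sup>2 * rho x * \<phi> x - s * fst \<xi> * \<pi> x + s * \<mu> * (\<kappa> * \<phi> x - deriv (deriv \<phi>) x) = M\<^sup>2 * B1 d \<xi> \<phi> \<theta> \<psi> x" for x
  proof (rule cancel)
    have "\<kappa> * (s\<^sup>2 * rho x * \<phi> x - s * fst \<xi> * \<pi> x + s * \<mu> * (\<kappa> * \<phi> x - deriv (deriv \<phi>) x))
      = s\<^sup>2 * rho x * (\<kappa> * \<phi> x) - fst \<xi> * (s * \<kappa> * \<pi> x) + s * \<mu> * (\<kappa> * (\<kappa> * \<phi> x) - \<kappa> * deriv (deriv \<phi>) x)"
      by (simp add: algebra_simps)
    also have "\<dots> = a * (- fst \<xi> * \<psi>3 x + fst \<xi> * \<kappa> * \<psi>1 x)"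
      unfolding \<phi> \<pi> by (simp add: algebra_simps)
    also have "\<dots> = \<kappa> * (M\<^sup>2 * B1 d \<xi> \<phi> \<theta> \<psi> x)"
    proof (cases d)
      case Vertical
      have "\<kappa> * (M\<^sup>2 * B1 d \<xi> \<phi> \<theta> \<psi> x) = M\<^sup>2 * (\<kappa> * deriv (deriv \<phi>) x + fst \<xi> * \<kappa> * \<psi>1 x)"
        using Vertical by (simp add: B1_def \<psi>1_def algebra_simps)
      then show ?thesis unfolding \<phi> using Vertical by (auto simp: a_def)
    qed (simp add: a_def B1_def)
    finally show "\<kappa> * (s\<^sup>2 * rho x * \<phi> x - s * fst \<xi> * \<pi> x + s * \<mu> * (\<kappa> * \<phi> x - deriv (deriv \<phi>) x)) = \<kappa> * (M\<^sup>2 * B1 d \<xi> \<phi> \<theta> \<psi> x)" .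
  qed
  have e2: "s\<^sup>2 * rho x * \<theta> x - s * snd \<xi> * \<pi> x + s * \<mu> * (\<kappa> * \<theta> x - deriv (deriv \<theta>) x) = M\<^sup>2 * B2 d \<xi> \<phi> \<theta> \<psi> x" for x
  proof (rule cancel)
    have "\<kappa> * (s\<^sup>2 * rho x * \<theta> x - s * snd \<xi> * \<pi> x + s * \<mu> * (\<kappa> * \<theta> x - deriv (deriv \<theta>) x))
      = s\<^sup>2 * rho x * (\<kappa> * \<theta> x) - snd \<xi> * (s * \<kappa> * \<pi> x) + s * \<mu> * (\<kappa> * (\<kappa> * \<theta> x) - \<kappa> * deriv (deriv \<theta>) x)"
      by (simp add: algebra_simps)
    also have "\<dots> = a * (- snd \<xi> * \<psi>3 x + snd \<xi> * \<kappa> * \<psi>1 x)"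
      unfolding \<theta> \<pi> by (simp add: algebra_simps)
    also have "\<dots> = \<kappa> * (M\<^sup>2 * B2 d \<xi> \<phi> \<theta> \<psi> x)"
    proof (cases d)
      case Vertical
      have "\<kappa> * (M\<^sup>2 * B2 d \<xi> \<phi> \<theta> \<psi> x) = M\<^sup>2 * (\<kappa> * deriv (deriv \<theta>) x + snd \<xi> * \<kappa> * \<psi>1 x)"
        using Vertical by (simp add: B2_def \<psi>1_def algebra_simps)
      then show ?thesis unfolding \<theta> using Vertical by (auto simp: a_def)
    next
      case Horizontal
      have "\<kappa> * (M\<^sup>2 * B2 d \<xi> \<phi> \<theta> \<psi> x) = M\<^sup>2 * (fst \<xi> * snd \<xi> * (\<kappa> * \<phi> x) - (fst \<xi>)\<^sup>2 * (\<kappa> * \<theta> x))"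
        using Horizontal by (simp add: B2_def algebra_simps)
      \<comment> \<open>(\<phi>, \<theta>) is parallel to \<xi>, so a horizontal field has no effect
        on this component.\<close>
      also have "\<dots> = 0" unfolding \<phi> \<theta> by (simp add: power2_eq_square)
      finally show ?thesis using Horizontal by (simp add: a_def)
    qed
    finally show "\<kappa> * (s\<^sup>2 * rho x * \<theta> x - s * snd \<xi> * \<pi> x + s * \<mu> * (\<kappa> * \<theta> x - deriv (deriv \<theta>) x)) = \<kappa> * (M\<^sup>2 * B2 d \<xi> \<phi> \<theta> \<psi> x)" .
  qed
  have e3: "s\<^sup>2 * rho x * \<psi> x + s * deriv \<pi> x + s * \<mu> * (\<kappa> * \<psi> x - deriv (deriv \<psi>) x) - g * deriv rho x * \<psi> x
      = M\<^sup>2 * B3 d \<xi> \<phi> \<theta> \<psi> x" for x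
  proof (rule cancel)
    have "\<kappa> * (s\<^sup>2 * rho x * \<psi> x + s * deriv \<pi> x + s * \<mu> * (\<kappa> * \<psi> x - deriv (deriv \<psi>) x) - g * deriv rho x * \<psi> x)
      = s\<^sup>2 * \<kappa> * rho x * \<psi> x + s * \<kappa> * deriv \<pi> x + s * \<mu> * \<kappa> * (\<kappa> * \<psi> x - \<psi>2 x) - g * \<kappa> * deriv rho x * \<psi> x"
      by (simp add: \<psi>1_def \<psi>2_def algebra_simps)
    \<comment> \<open>The fourth-order equation cancels all inertial, viscous and buoyancy terms;
      only magnetic ones remain, and for a vertical field b = a \<kappa> removes these too.\<close>
    also have "\<dots> = (b - a * \<kappa>) * \<psi>2 x - c * \<psi> x"
      unfolding d\<pi> ode' by (simp add: algebra_simps power2_eq_square)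
    also have "\<dots> = \<kappa> * (M\<^sup>2 * B3 d \<xi> \<phi> \<theta> \<psi> x)"
    proof (cases d)
      case Horizontal
      have "\<kappa> * (M\<^sup>2 * B3 d \<xi> \<phi> \<theta> \<psi> x) = M\<^sup>2 * (- ((fst \<xi>)\<^sup>2 * (\<kappa> * \<psi> x) + fst \<xi> * (\<kappa> * deriv \<phi> x)))"
        using Horizontal by (simp add: B3_def algebra_simps)
      then show ?thesis unfolding \<phi> using Horizontal
        by (simp add: a_def b_def c_def power_mult_distrib power2_eq_square algebra_simps)
    qed (simp add: a_def b_def c_def B3_def)
    finally show "\<kappa> * (s\<^sup>2 * rho x * \<psi> x + s * deriv \<pi> x + s * \<mu> * (\<kappa> * \<psi> x - deriv (deriv \<psi>) x) - g * deriv rho x * \<psi> x)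
      = \<kappa> * (M\<^sup>2 * B3 d \<xi> \<phi> \<theta> \<psi> x)" .
  qed
  have e4: "fst \<xi> * \<phi> x + snd \<xi> * \<theta> x + deriv \<psi> x = 0" for x
  proof (rule cancel)
    have "\<kappa> * (fst \<xi> * \<phi> x + snd \<xi> * \<theta> x + deriv \<psi> x) = fst \<xi> * (\<kappa> * \<phi> x) + snd \<xi> * (\<kappa> * \<theta> x) + \<kappa> * \<psi>1 x"
      by (simp add: \<psi>1_def algebra_simps)
    also have "\<dots> = (\<kappa> - ((fst \<xi>)\<^sup>2 + (snd \<xi>)\<^sup>2)) * \<psi>1 x"
      unfolding \<phi> \<theta> by (simp add: power2_eq_square algebra_simps)
    finally show "\<kappa> * (fst \<xi> * \<phi> x + snd \<xi> * \<theta> x + deriv \<psi> x) = \<kappa> * 0"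
      using \<kappa>_eq by simp
  qed
  have A: "\<psi> \<in> calA rho \<xi>"
    unfolding calA_def
  proof (intro CollectI conjI)
    note H = smooth_L2_H1_pair[OF sm]
    have m: "rho \<in> borel_measurable borel"
      using smooth_upto_allD[OF rho(1)] by (simp add: bounded_fun_def)
    show "Hk 2 \<psi>" using smooth_L2_Hinf[OF sm] by (simp add: Hinf_def)
    \<comment> \<open>\<open>calA\<close> is stated with the chosen weak derivative, which agrees
      with the classical one almost everywhere.\<close>
    have "(LINT x|lborel. rho x * ((norm \<xi>)\<^sup>2 * (\<psi> x)\<^sup>2 + (wderiv \<psi> x)\<^sup>2)) = (LINT x|lborel. rho x * (\<kappa> * (\<psi> x)\<^sup>2 + (deriv \<psi> x)\<^sup>2))"
    proof (rule integral_cong_AE)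
      show "AE x in lborel. rho x * ((norm \<xi>)\<^sup>2 * (\<psi> x)\<^sup>2 + (wderiv \<psi> x)\<^sup>2) = rho x * (\<kappa> * (\<psi> x)\<^sup>2 + (deriv \<psi> x)\<^sup>2)"
        using H1_pair_wderiv(1)[OF H] by eventually_elim (simp add: \<kappa>_def)
    qed (use m L2D(1)[OF H1_pairD(1)[OF H]] L2D(1)[OF H1_pairD(2)[OF H]] L2D(1)[OF H1_pair_wderiv(2)[OF H]] in simp_all)
    then show "(LINT x|lborel. rho x * ((norm \<xi>)\<^sup>2 * (\<psi> x)\<^sup>2 + (wderiv \<psi> x)\<^sup>2)) = 1" using n1 by simp
  qed
  show ?thesis
    using s e1[unfolded \<kappa>_def] e2[unfolded \<kappa>_def] e3[unfolded \<kappa>_def] e4 A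
    by (intro exI[of _ s] exI[of _ \<phi>] exI[of _ \<theta>] exI[of _ \<psi>] exI[of _ \<pi>] conjI allI
        smooth_L2_Hinf smooth_upto_all_C_inf[of L2] H1_pair_tendsto_0[OF smooth_L2_H1_pair] sm[rule_format] sm\<phi>[rule_format] sm\<theta>[rule_format] sm\<pi>[rule_format])
qed

end
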